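(* Let $n\ge 2$ and let $k\ge 1$ be an integer. Let $j\in\mathbb Z$ and let $a,b\ge 0$ be integers with $a+b=k+1$ (so that $(-j-1)^b(-j)^a$ is a fixed shape). Let $\mathcal B$ and $\mathcal A$ be two cascades in the basis $B$ of the simple Lie algebra $\mathfrak g$ of type $C_n$, placed in degrees $-j-1$ and $-j$ respectively, with multiplicities $(m_{\beta,j+1})_{\beta\in\mathcal B}$ and $(m_{\alpha,j})_{\alpha\in\mathcal A}$ in $\mathbb Z_{\ge 0}$, such that $$\sum_{\beta\in\mathcal B}m_{\beta,j+1}=b,\qquad \sum_{\alpha\in\mathcal A}m_{\alpha,j}=a .$$ Let $r\in\{1,\dots,n,\underline n,\dots,\underline 1\}$. If the points of the cascade $\mathcal B$ lie in the upper triangle $\triangle_r$ and the points of the cascade $\mathcal A$ lie in the lower triangle ${}^r\!\triangle$, then the colored partition $$\prod_{\beta\in\mathcal B}X_\beta(-j-1)^{m_{\beta,j+1}}\ \prod_{\alpha\in\mathcal A}X_\alpha(-j)^{m_{\alpha,j}}$$ is the leading term of a relation for level $k$ standard modules for the affine Lie algebra of type $C_n^{(1)}$; that is, it is the leading term of some nonzero relation of the form $u\cdot r_{(k+1)\theta}(m)$ with $u\in U(\mathfrak g)$ and $m=b(-j-1)+a(-j)$.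
   Context: **Lie algebra and basis.** $\mathfrak g$ is the simple complex Lie algebra of type $C_n$, with Cartan subalgebra $\mathfrak h$ and roots $\Delta=\{\pm(\varepsilon_i\pm\varepsilon_j)\mid i,j=1,\dots,n\}\setminus\{0\}$. The simple roots are $\alpha_i=\varepsilon_i-\varepsilon_{i+1}$ ($1\le i\le n-1$) and $\alpha_n=2\varepsilon_n$. The maximal root is $\theta=2\varepsilon_1$. The invariant form $\langle\ ,\ \rangle$ is normalized by $\langle\theta,\theta\rangle=2$. Root vectors $X_\alpha$ are chosen with $[X_\alpha,X_{-\alpha}]=\alpha^\vee$. The index set is $\{1,2,\dots,n,\underline n,\dots,\underline 2,\underline 1\}$ with order $1\succ 2\succ\cdots\succ n\succ\underline n\succ\cdots\succ\underline 2\succ\underline 1$. An interval such as $\{a,\dots,b\}$ means all indices listed from $a$ to $b$ in the sequence $1,2,\dots,n,\underline n,\dots,\underline 1$. For $i,j\in\{1,\dots,n\}$ put: - $X_{ij}=X_{\varepsilon_i+\varepsilon_j}$ for $i\le j$; - $X_{\underline i\,\underline j}=X_{-\varepsilon_i-\varepsilon_j}$ for $i\ge j$; - $X_{i\underline j}=X_{\varepsilon_i-\varepsilon_j}$ for $i\ne j$; - $X_{i\underline i}=\alpha_i^\vee$. Then $B=\{X_{ab}\mid b\in\{1,\dots,n,\underline n,\dots,\underline 1\},\ a\in\{1,\dots,b\}\}$ is a basis of $\mathfrak g$, displayed as a triangle with $X_{ab}$ (also written simply $ab$) in column $a$ and row $b$. It is ordered by $X_{ab}\succ X_{a'b'}$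 iff $b\succ b'$, or $b=b'$ and $a\succ a'$. Here $x_\theta=X_{11}$. **Triangles.** For an index $r$, $\triangle_r=\{X_{ab}\in B\mid b\in\{1,\dots,r\}\}$ (rows $1,\dots,r$) and ${}^r\!\triangle=\{X_{ab}\in B\mid a\in\{r,\dots,\underline 1\}\}$ (columns $r,\dots,\underline 1$). **Cascades.** A cascade in $B$ is a finite sequence $(X_{a_1b_1},\dots,X_{a_sb_s})$ of elements of $B$ such that for each $i<s$ either $b_{i+1}\prec b_i$ and $a_{i+1}=a_i$, or $b_{i+1}=b_i$ and $a_{i+1}\succ a_i$. The empty cascade is also allowed for $\mathcal B$. A cascade is also regarded as a subset of $B$. It is a cascade with multiplicities if each of its places is given a multiplicity in $\mathbb Z_{\ge0}$. A cascade in degree $i$ is obtained by replacing each $X_{ab}$ by $X_{ab}(i)$. **Affine algebra and colored partitions.** $\hat{\mathfrak g}=\coprod_{i\in\mathbb Z}\mathfrak g\otimes t^i+\mathbb Cc$ with $c$ central, $x(i)=x\otimes t^i$, and $[x(i),y(j)]=[x,y](i+j)+i\delta_{i+j,0}\langle x,y\rangle c$. Let $\mathcal U=U(\hat{\mathfrak g})/(c-k)$, with its usual filtration and associated graded algebra $\mathcal S\cong S(\hat{\mathfrak g}/\mathbb Cc)$. Let $\bar B=\{X(i)\mid X\in B,\ i\in\mathbb Z\}$, ordered by $X(i)\prec Y(j)$ iff $i<j$, or $i=j$ and $X\prec Y$. A colored partition is a monomial $\Pi=X_1(j_1)\cdots X_\ell(j_\ell)\in\mathcal S$ in elements of $\bar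 B$ (commuting factors). We index its parts so that $X_1(j_1)\preceq\cdots\preceq X_\ell(j_\ell)$. Its length is $\ell$, its degree is $|\Pi|=\sum j_i$, and its shape $\mathrm{sh}\,\Pi$ is the sequence $j_1\le\cdots\le j_\ell$. $X(\Pi)\in\mathcal U$ denotes the corresponding ordered product. Colored partitions are linearly ordered by $\Pi\prec\Phi$ if - $\ell(\Pi)>\ell(\Phi)$; or - lengths are equal and $|\Pi|<|\Phi|$; or - lengths and degrees are equal and $\mathrm{sh}\,\Pi\prec\mathrm{sh}\,\Phi$ in reverse lexicographical order (compare entries from the right; at the first difference the smaller entry gives the smaller shape); or - lengths, degrees and shapes are equal and the sequence of colors $(X_1,\dots,X_\ell)$ of $\Pi$ is smaller than that of $\Phi$ in reverse lexicographical order (compare from the right, using the order on $B$). **Relations and leading terms.** For $m\in\mathbb Z$ let $r_{(k+1)\theta}(m)=\sum_{j_1+\cdots+j_{k+1}=m}x_\theta(j_1)\cdots x_\theta(j_{k+1})$, the coefficient of $z^{-m-k-1}$ in $x_\theta(z)^{k+1}$, where $x_\theta(z)=\sum_i x_\theta(i)z^{-i-1}$. These infinite sums annihilate all level $k$ standard modules. Relations (for level $k$ standard modules) are the elements $r(m)=u\cdot r_{(k+1)\theta}(m)$, $u\in U(\mathfrak g)$, $m\in\mathbb Z$, where $\mathfrak g=\mathfrak g\otimes1$ acts by the adjoint action. These are exactly the coefficients of the vertex operators $Y(v,z)$, $v\in U(\mathfrak g)x_\theta(-1)^{k+1}\mathbf 1$, in the universal affine vertex algebra of level $k$. A nonzero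 relation can be written as $r(m)=\sum_\Psi c_\Psi X(\Psi)$, where every $\Psi$ has degree $m$ and length at most $k+1$. Its leading term is the smallest $\Psi$ of length $k+1$ and degree $m$ with $c_\Psi\ne0$. Writing $m=b(-j-1)+a(-j)$ with $a+b=k+1$, the leading term is equivalently the smallest colored partition occurring with nonzero coefficient in $u\cdot\big(x_\theta(-j-1)^bx_\theta(-j)^a\big)\in\mathcal S$, where $X\in\mathfrak g$ acts on $\mathcal S$ as the derivation with $X\cdot Y(i)=[X,Y](i)$. *)

theory Defs
  imports Complex_Main "HOL-Library.Multiset" "HOL-Library.Poly_Mapping" "Jordan_Normal_Form.Matrix"
begin

section \<open>The simple Lie algebra of type C\<close>

text \<open>
  The simple complex Lie algebra of type \<open>C\<^sub>n\<close> is realized as the symplectic Lie algebra, with the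
  diagonal matrices as Cartan subalgebra. Its elements are the block matrices with rows
  \<open>(P, Q)\<close> and \<open>(R, -P\<^sup>T)\<close>, where \<open>Q\<close> and \<open>R\<close> are symmetric; matrix positions are counted from 0.
\<close>

definition symp_form :: "nat \<Rightarrow> complex mat" where
  "symp_form n = four_block_mat (0\<^sub>m n n) (1\<^sub>m n) (- 1\<^sub>m n) (0\<^sub>m n n)"

definition sp :: "nat \<Rightarrow> complex mat set" where
  "sp n = {x \<in> carrier_mat (2 * n) (2 * n).
             transpose_mat x * symp_form n + symp_form n * x = 0\<^sub>m (2 * n) (2 * n)}"

definition bracket :: "complex mat \<Rightarrow> complex mat \<Rightarrow> complex mat" where
  "bracket x y = x * y - y * x"

text \<open>The trace form of the defining representation is the invariant form with
  \<open>\<langle>\<theta>, \<theta>\<rangle> = 2\<close>: since \<open>\<theta>\<^sup>\<or>\<close> is diagonal with entries 1 and -1 in positions 0 and \<open>n\<close>, one has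
  \<open>\<langle>\<theta>\<^sup>\<or>, \<theta>\<^sup>\<or>\<rangle> = 2\<close>, and \<open>\<langle>\<theta>\<^sup>\<or>, \<theta>\<^sup>\<or>\<rangle> = 4 / \<langle>\<theta>, \<theta>\<rangle>\<close>.\<close>

definition inv_form :: "nat \<Rightarrow> complex mat \<Rightarrow> complex mat \<Rightarrow> complex" where
  "inv_form n x y = (\<Sum>i < 2 * n. (x * y) $$ (i, i))"

definition cartan :: "nat \<Rightarrow> complex mat set" where
  "cartan n = {h \<in> sp n. diagonal_mat h}"

text \<open>Weights are integral combinations of \<open>\<epsilon>\<^sub>1, \<dots>, \<epsilon>\<^sub>n\<close>, given by their coefficients.\<close>

type_synonym weight = "nat \<Rightarrow>\<^sub>0 int"

definition eps :: "nat \<Rightarrow> weight" where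
  "eps i = Poly_Mapping.single i 1"

definition weight_eval :: "nat \<Rightarrow> weight \<Rightarrow> complex mat \<Rightarrow> complex" where
  "weight_eval n \<alpha> h = (\<Sum>i = 1..n. of_int (Poly_Mapping.lookup \<alpha> i) * h $$ (i - 1, i - 1))"

definition roots :: "nat \<Rightarrow> weight set" where
  "roots n = (\<Union>i \<in> {1..n}. \<Union>j \<in> {1..n}.
      {eps i + eps j, eps i - eps j, - (eps i + eps j), - (eps i - eps j)}) - {0}"

definition simple_root :: "nat \<Rightarrow> nat \<Rightarrow> weight" where
  "simple_root n i = (if i < n then eps i - eps (i + 1) else eps n + eps n)"

definition root_space :: "nat \<Rightarrow> weight \<Rightarrow> complex mat set" where
  "root_space n \<alpha> = {x \<in> sp n. \<forall>h \<in> cartan n. bracket h x = weight_eval n \<alpha> h \<cdot>\<^sub>m x}"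

text \<open>The coroot \<open>\<alpha>\<^sup>\<or> \<in> \<hh>\<close> corresponds to \<open>2 \<alpha> / \<langle>\<alpha>, \<alpha>\<rangle>\<close>, that is
  \<open>\<epsilon>\<^sub>i(\<alpha>\<^sup>\<or>) = 2 \<langle>\<epsilon>\<^sub>i, \<alpha>\<rangle> / \<langle>\<alpha>, \<alpha>\<rangle>\<close>. As the \<open>\<epsilon>\<^sub>i\<close> are orthogonal of equal length, this is
  \<open>2 \<alpha>\<^sub>i / \<Sum>\<^sub>l \<alpha>\<^sub>l\<^sup>2\<close> in terms of coefficients.\<close>

definition coroot_coeff :: "nat \<Rightarrow> weight \<Rightarrow> nat \<Rightarrow> complex" where
  "coroot_coeff n \<alpha> i = 2 * of_int (Poly_Mapping.lookup \<alpha> i)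
                          / of_int (\<Sum>l = 1..n. (Poly_Mapping.lookup \<alpha> l)\<^sup>2)"

definition coroot :: "nat \<Rightarrow> weight \<Rightarrow> complex mat" where
  "coroot n \<alpha> = mat (2 * n) (2 * n) (\<lambda>(p, q).
      if p \<noteq> q then 0
      else if p < n then coroot_coeff n \<alpha> (p + 1)
      else - coroot_coeff n \<alpha> (p - n + 1))"

definition root_vectors :: "nat \<Rightarrow> (weight \<Rightarrow> complex mat) \<Rightarrow> bool" where
  "root_vectors n xr \<longleftrightarrow>
     (\<forall>\<alpha> \<in> roots n. xr \<alpha> \<in> root_space n \<alpha> \<and> bracket (xr \<alpha>) (xr (- \<alpha>)) = coroot n \<alpha>)"


section \<open>The ordered basis, triangles and cascades\<close>

text \<open>\<open>Under i\<close> is the underlined index. The sequence \<open>Plain 1, \<dots>, Plain n, Under n, \<dots>, Under 1\<close> is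
  decreasing, so its interval \<open>{a, \<dots>, b}\<close> consists of the indices \<open>c\<close> with \<open>b \<le> c \<le> a\<close>.\<close>

datatype index = Plain nat | Under nat

instantiation index :: linorder
begin

fun less_eq_index :: "index \<Rightarrow> index \<Rightarrow> bool" where
  "Plain i \<le> Plain j \<longleftrightarrow> j \<le> i"
| "Under i \<le> Under j \<longleftrightarrow> i \<le> j"
| "Under i \<le> Plain j \<longleftrightarrow> True"
| "Plain i \<le> Under j \<longleftrightarrow> False"

definition less_index :: "index \<Rightarrow> index \<Rightarrow> bool" where
  "x < y \<longleftrightarrow> x \<le> y \<and> x \<noteq> (y :: index)"

instance
proof
  fix x y z :: index
  show "x < y \<longleftrightarrow> x \<le> y \<and> \<not> y \<le> x"
    unfolding less_index_def by (cases x; cases y) auto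
  show "x \<le> x" by (cases x) auto
  show "x \<le> y \<Longrightarrow> y \<le> z \<Longrightarrow> x \<le> z" by (cases x; cases y; cases z) auto
  show "x \<le> y \<Longrightarrow> y \<le> x \<Longrightarrow> x = y" by (cases x; cases y) auto
  show "x \<le> y \<or> y \<le> x" by (cases x; cases y) auto
qed

end

definition indices :: "nat \<Rightarrow> index set" where
  "indices n = Plain ` {1..n} \<union> Under ` {1..n}"

text \<open>\<open>Color a b\<close> is the label of the basis element \<open>X\<^sub>a\<^sub>b\<close> in column \<open>a\<close> and row \<open>b\<close>.\<close>

datatype color = Color (col: index) (row: index)

instantiation color :: linorder
begin

definition less_eq_color :: "color \<Rightarrow> color \<Rightarrow> bool" where
  "x \<le> y \<longleftrightarrow> row x < row y \<or> row x = row y \<and> col x \<le> col y"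

definition less_color :: "color \<Rightarrow> color \<Rightarrow> bool" where
  "x < y \<longleftrightarrow> row x < row y \<or> row x = row y \<and> col x < col y"

instance
  by standard (auto simp: less_eq_color_def less_color_def intro: color.expand)

end

definition basis :: "nat \<Rightarrow> color set" where
  "basis n = {Color a b | a b. a \<in> indices n \<and> b \<in> indices n \<and> b \<le> a}"

fun basis_elem :: "nat \<Rightarrow> (weight \<Rightarrow> complex mat) \<Rightarrow> color \<Rightarrow> complex mat" where
  "basis_elem n xr (Color (Plain i) (Plain j)) = xr (eps i + eps j)"
| "basis_elem n xr (Color (Under i) (Under j)) = xr (- eps i - eps j)"
| "basis_elem n xr (Color (Plain i) (Under j)) =
     (if i = j then coroot n (simple_root n i) else xr (eps i - eps j))"
| "basis_elem n xr (Color (Under i) (Plain j)) = undefined" \<comment> \<open>not in the basis\<close>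

definition upper_triangle :: "nat \<Rightarrow> index \<Rightarrow> color set" where
  "upper_triangle n r = {x \<in> basis n. r \<le> row x}"

definition lower_triangle :: "nat \<Rightarrow> index \<Rightarrow> color set" where
  "lower_triangle n r = {x \<in> basis n. col x \<le> r}"

definition cascade :: "nat \<Rightarrow> color list \<Rightarrow> bool" where
  "cascade n xs \<longleftrightarrow> set xs \<subseteq> basis n \<and>
     (\<forall>i. i + 1 < length xs \<longrightarrow>
        (row (xs ! (i + 1)) < row (xs ! i) \<and> col (xs ! (i + 1)) = col (xs ! i)) \<or>
        (row (xs ! (i + 1)) = row (xs ! i) \<and> col (xs ! (i + 1)) > col (xs ! i)))"


section \<open>Colored partitions\<close>

text \<open>\<open>Part x i\<close> stands for \<open>X(i)\<close> where \<open>X\<close> is the basis element labelled by \<open>x\<close>. A colored partition,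
  being a monomial in commuting variables, is a multiset of parts.\<close>

datatype part = Part (part_color: color) (part_deg: int)

instantiation part :: linorder
begin

definition less_eq_part :: "part \<Rightarrow> part \<Rightarrow> bool" where
  "p \<le> q \<longleftrightarrow> part_deg p < part_deg q \<or> part_deg p = part_deg q \<and> part_color p \<le> part_color q"

definition less_part :: "part \<Rightarrow> part \<Rightarrow> bool" where
  "p < q \<longleftrightarrow> part_deg p < part_deg q \<or> part_deg p = part_deg q \<and> part_color p < part_color q"

instance
  by standard (auto simp: less_eq_part_def less_part_def intro: part.expand)

end

definition colored_partitions :: "nat \<Rightarrow> part multiset set" where
  "colored_partitions n = {\<pi>. \<forall>p \<in># \<pi>. part_color p \<in> basis n}"

definition cp_deg :: "part multiset \<Rightarrow> int" where
  "cp_deg \<pi> = (\<Sum>p \<in># \<pi>. part_deg p)"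

definition cp_shape :: "part multiset \<Rightarrow> int list" where
  "cp_shape \<pi> = map part_deg (sorted_list_of_multiset \<pi>)"

definition cp_colors :: "part multiset \<Rightarrow> color list" where
  "cp_colors \<pi> = map part_color (sorted_list_of_multiset \<pi>)"

definition rev_lex_less :: "'a :: linorder list \<Rightarrow> 'a list \<Rightarrow> bool" where
  "rev_lex_less xs ys \<longleftrightarrow> (rev xs, rev ys) \<in> lex {(x, y). x < y}"

definition cp_less :: "part multiset \<Rightarrow> part multiset \<Rightarrow> bool" (infix \<open>\<prec>\<^sub>c\<^sub>p\<close> 50) where
  "\<pi> \<prec>\<^sub>c\<^sub>p \<phi> \<longleftrightarrow>
     size \<pi> > size \<phi> \<or>
     size \<pi> = size \<phi> \<and> cp_deg \<pi> < cp_deg \<phi> \<or>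
     size \<pi> = size \<phi> \<and> cp_deg \<pi> = cp_deg \<phi> \<and> rev_lex_less (cp_shape \<pi>) (cp_shape \<phi>) \<or>
     size \<pi> = size \<phi> \<and> cp_deg \<pi> = cp_deg \<phi> \<and> cp_shape \<pi> = cp_shape \<phi> \<and>
       rev_lex_less (cp_colors \<pi>) (cp_colors \<phi>)"


section \<open>The universal enveloping algebra of the affine Lie algebra at level k\<close>

text \<open>Free associative algebras are monoid algebras \<open>'a fmon \<Rightarrow>\<^sub>0 complex\<close> of free monoids.\<close>

datatype 'a fmon = FMon (letters: "'a list")

instantiation fmon :: (type) monoid_add
begin

definition zero_fmon :: "'a fmon" where
  "0 = FMon []"

definition plus_fmon :: "'a fmon \<Rightarrow> 'a fmon \<Rightarrow> 'a fmon" where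
  "v + w = FMon (letters v @ letters w)"

instance
  by standard (auto simp: zero_fmon_def plus_fmon_def)

end

definition gen :: "'a \<Rightarrow> 'a fmon \<Rightarrow>\<^sub>0 complex" where
  "gen s = Poly_Mapping.single (FMon [s]) 1"

definition scal :: "complex \<Rightarrow> 'a fmon \<Rightarrow>\<^sub>0 complex" where
  "scal z = Poly_Mapping.single 0 z"

definition free_alg :: "'a set \<Rightarrow> ('a fmon \<Rightarrow>\<^sub>0 complex) set" where
  "free_alg S = {f. \<forall>w \<in> Poly_Mapping.keys f. set (letters w) \<subseteq> S}"

text \<open>\<open>Loop x i\<close> is \<open>x(i) = x \<otimes> t\<^sup>i\<close> and \<open>Cent\<close> is the central element \<open>c\<close>. The algebra
  \<open>\<U> = U(\<gg>')/(c - k)\<close>, with \<open>\<gg>'\<close> the affine Lie algebra, is the quotient of the free algebra on the symbols \<open>x(i)\<close>, \<open>x \<in> \<gg>\<close>, and \<open>c\<close>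
  by the two-sided ideal generated by the relations below: the first two make \<open>x \<mapsto> x(i)\<close> linear
  (so that one gets the tensor algebra of \<open>\<gg>'\<close>), the next two are the commutation relations of
  \<open>\<gg>'\<close>, and the last one sets the level. Elements of \<open>\<U>\<close> are given by representatives in the
  free algebra.\<close>

datatype aff_gen = Loop "complex mat" int | Cent

type_synonym aff_alg = "aff_gen fmon \<Rightarrow>\<^sub>0 complex"

definition aff_gens :: "nat \<Rightarrow> aff_gen set" where
  "aff_gens n = insert Cent {Loop x i | x i. x \<in> sp n}"

inductive_set aff_relators :: "nat \<Rightarrow> nat \<Rightarrow> aff_alg set" for n k :: nat where
  add: "x \<in> sp n \<Longrightarrow> y \<in> sp n \<Longrightarrow>
    gen (Loop (x + y) i) - (gen (Loop x i) + gen (Loop y i)) \<in> aff_relators n k"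
| smult: "x \<in> sp n \<Longrightarrow>
    gen (Loop (z \<cdot>\<^sub>m x) i) - scal z * gen (Loop x i) \<in> aff_relators n k"
| comm: "x \<in> sp n \<Longrightarrow> y \<in> sp n \<Longrightarrow>
    gen (Loop x i) * gen (Loop y j) - gen (Loop y j) * gen (Loop x i)
      - (gen (Loop (bracket x y) (i + j))
         + (if i + j = 0 then scal (of_int i * inv_form n x y) * gen Cent else 0))
      \<in> aff_relators n k"
| cent: "x \<in> sp n \<Longrightarrow>
    gen Cent * gen (Loop x i) - gen (Loop x i) * gen Cent \<in> aff_relators n k"
| level: "gen Cent - scal (of_nat k) \<in> aff_relators n k"

inductive_set aff_ideal :: "nat \<Rightarrow> nat \<Rightarrow> aff_alg set" for n k :: nat where
  zero: "0 \<in> aff_ideal n k"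
| step: "f \<in> aff_ideal n k \<Longrightarrow> p \<in> free_alg (aff_gens n) \<Longrightarrow> q \<in> free_alg (aff_gens n) \<Longrightarrow>
    \<rho> \<in> aff_relators n k \<Longrightarrow> f + p * \<rho> * q \<in> aff_ideal n k"

text \<open>Infinite sums such as \<open>r\<^bsub>(k+1)\<theta>\<^esub>(m)\<close> live in the completion of \<open>\<U>\<close> for the topology in which the
  left ideals of \<open>\<U>\<close> generated by all \<open>x(i)\<close>, \<open>x \<in> \<gg>\<close>, \<open>i \<ge> N\<close>, form a basis of neighbourhoods of
  0. The following set is the preimage of such a left ideal in the free algebra.\<close>

inductive_set aff_nbhd :: "nat \<Rightarrow> nat \<Rightarrow> int \<Rightarrow> aff_alg set" for n k :: nat and N :: int where
  ideal: "f \<in> aff_ideal n k \<Longrightarrow> f \<in> aff_nbhd n k N"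
| step: "f \<in> aff_nbhd n k N \<Longrightarrow> p \<in> free_alg (aff_gens n) \<Longrightarrow> x \<in> sp n \<Longrightarrow> N \<le> i \<Longrightarrow>
    f + p * gen (Loop x i) \<in> aff_nbhd n k N"

text \<open>The unordered sums \<open>\<Sum>\<^bsub>i \<in> I\<^esub> f\<^sub>i\<close> and \<open>\<Sum>\<^bsub>j \<in> J\<^esub> g\<^sub>j\<close> both converge in the completion and
  have the same value: on all sufficiently large finite index sets the two partial sums differ
  by an element of a prescribed neighbourhood (applied to two finite subsets of \<open>I\<close> and one of \<open>J\<close>,
  this contains the Cauchy condition).\<close>

definition same_sum ::
  "nat \<Rightarrow> nat \<Rightarrow> 'i set \<Rightarrow> ('i \<Rightarrow> aff_alg) \<Rightarrow> 'j set \<Rightarrow> ('j \<Rightarrow> aff_alg) \<Rightarrow> bool" where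
  "same_sum n k I f J g \<longleftrightarrow>
     (\<forall>N. \<exists>I0 J0. finite I0 \<and> I0 \<subseteq> I \<and> finite J0 \<and> J0 \<subseteq> J \<and>
        (\<forall>I1 J1. finite I1 \<and> I0 \<subseteq> I1 \<and> I1 \<subseteq> I \<and> finite J1 \<and> J0 \<subseteq> J1 \<and> J1 \<subseteq> J \<longrightarrow>
           (\<Sum>i \<in> I1. f i) - (\<Sum>j \<in> J1. g j) \<in> aff_nbhd n k N))"


section \<open>Relations and their leading terms\<close>

text \<open>\<open>X(\<pi>)\<close>: the product of the parts in increasing order.\<close>

definition cp_elem :: "nat \<Rightarrow> (weight \<Rightarrow> complex mat) \<Rightarrow> part multiset \<Rightarrow> aff_alg" where
  "cp_elem n xr \<pi> = prod_list
     (map (\<lambda>p. gen (Loop (basis_elem n xr (part_color p)) (part_deg p))) (sorted_list_of_multiset \<pi>))"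

text \<open>The action on \<open>\<U>\<close> of an element of \<open>U(\<gg>)\<close>, given by a representative \<open>u\<close> in the free algebra
  on \<open>\<gg>\<close>: a product \<open>x\<^sub>1 \<cdots> x\<^sub>s\<close> acts by \<open>ad x\<^sub>1(0) \<circ> \<cdots> \<circ> ad x\<^sub>s(0)\<close>.\<close>

definition ad0 :: "complex mat \<Rightarrow> aff_alg \<Rightarrow> aff_alg" where
  "ad0 x f = gen (Loop x 0) * f - f * gen (Loop x 0)"

definition env_act :: "(complex mat fmon \<Rightarrow>\<^sub>0 complex) \<Rightarrow> aff_alg \<Rightarrow> aff_alg" where
  "env_act u f = (\<Sum>w \<in> Poly_Mapping.keys u. scal (Poly_Mapping.lookup u w) * foldr ad0 (letters w) f)"

text \<open>The relation \<open>u \<cdot> r\<^bsub>(k+1)\<theta>\<^esub>(m)\<close> is the sum over \<open>rel_index k m\<close> of the family \<open>rel_term n xr u\<close>.\<close>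

definition rel_index :: "nat \<Rightarrow> int \<Rightarrow> int list set" where
  "rel_index k m = {js. length js = k + 1 \<and> sum_list js = m}"

definition rel_term ::
  "nat \<Rightarrow> (weight \<Rightarrow> complex mat) \<Rightarrow> (complex mat fmon \<Rightarrow>\<^sub>0 complex) \<Rightarrow> int list \<Rightarrow> aff_alg" where
  "rel_term n xr u js = env_act u
     (prod_list (map (\<lambda>i. gen (Loop (basis_elem n xr (Color (Plain 1) (Plain 1))) i)) js))"

definition rel_nonzero ::
  "nat \<Rightarrow> nat \<Rightarrow> (weight \<Rightarrow> complex mat) \<Rightarrow> (complex mat fmon \<Rightarrow>\<^sub>0 complex) \<Rightarrow> int \<Rightarrow> bool" where
  "rel_nonzero n k xr u m \<longleftrightarrow>
     \<not> same_sum n k (rel_index k m) (rel_term n xr u) (rel_index k m) (\<lambda>_. 0)"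

definition rel_support :: "nat \<Rightarrow> nat \<Rightarrow> int \<Rightarrow> part multiset set" where
  "rel_support n k m = {\<psi> \<in> colored_partitions n. cp_deg \<psi> = m \<and> size \<psi> \<le> k + 1}"

text \<open>The coefficients \<open>c\<close> in \<open>r(m) = \<Sum>\<^sub>\<psi> c\<^sub>\<psi> X(\<psi>)\<close> are unique by the
  Poincare-Birkhoff-Witt theorem.\<close>

definition rel_expansion ::
  "nat \<Rightarrow> nat \<Rightarrow> (weight \<Rightarrow> complex mat) \<Rightarrow> (complex mat fmon \<Rightarrow>\<^sub>0 complex) \<Rightarrow> int
    \<Rightarrow> (part multiset \<Rightarrow> complex) \<Rightarrow> bool" where
  "rel_expansion n k xr u m c \<longleftrightarrow>
     same_sum n k (rel_index k m) (rel_term n xr u)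
       (rel_support n k m) (\<lambda>\<psi>. scal (c \<psi>) * cp_elem n xr \<psi>)"

definition is_leading_term ::
  "nat \<Rightarrow> nat \<Rightarrow> (weight \<Rightarrow> complex mat) \<Rightarrow> (complex mat fmon \<Rightarrow>\<^sub>0 complex) \<Rightarrow> int
    \<Rightarrow> part multiset \<Rightarrow> bool" where
  "is_leading_term n k xr u m \<pi> \<longleftrightarrow>
     (\<exists>c. rel_expansion n k xr u m c \<and>
          \<pi> \<in> rel_support n k m \<and> size \<pi> = k + 1 \<and> c \<pi> \<noteq> 0 \<and>
          (\<forall>\<psi> \<in> rel_support n k m. size \<psi> = k + 1 \<and> c \<psi> \<noteq> 0 \<and> \<psi> \<noteq> \<pi> \<longrightarrow> \<pi> \<prec>\<^sub>c\<^sub>p \<psi>))"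

end

theory Submission
  imports Defs "HOL-Library.Nonpos_Ints" "HOL-Library.Multiset_Order"
begin

text \<open>
  Under \<open>U(\<gg>)\<close> the power \<open>x\<^sub>\<theta>\<^sup>k\<^sup>+\<^sup>1\<close> generates the module \<open>S\<^sup>2\<^sup>k\<^sup>+\<^sup>2(V)\<close>, where \<open>V\<close> is the defining
  representation and \<open>\<gg> = S\<^sup>2(V)\<close>. Its weight vector for a multiset \<open>\<mu>\<close> of \<open>2 k + 2\<close> basis vectors of \<open>V\<close> is
  the sum of all products \<open>X\<^sub>a\<^sub>b X\<^sub>c\<^sub>d \<cdots>\<close> over the ways to split \<open>\<mu>\<close> into ordered pairs, up to nonzero factors
  and larger terms coming from the coroots. Take for \<open>\<mu>\<close> all rows and columns of the points of the two cascades.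
  Regard \<open>X\<^sub>a\<^sub>b\<close> as the interval from \<open>b\<close> to \<open>a\<close>: a cascade is a nested family of intervals, and among all pairings
  of given endpoints the nested one gives the smallest monomial. The index \<open>r\<close> puts the endpoints of \<open>\<A>\<close> below
  those of \<open>\<B>\<close>, so the smallest monomial of balanced shape is the given one. All pairings contributing
  to it do so with the same nonzero weight, so they do not cancel.

  For the relation not to vanish it suffices, by applying raising operators, that the coefficients of
  \<open>x\<^sub>\<theta>(z)\<^sup>k\<^sup>+\<^sup>1\<close> do not vanish in the completion of \<open>\<U>\<close>. Here \<open>\<U>\<close> acts on polynomial functions on the big cell of a
  semi-infinite Grassmannian; the constant term of a polynomial is a functional that kills
  the left ideals generated by all sufficiently high modes, and the products applied to a suitable monomial have
  nonnegative constant terms, so these cannot cancel.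
\<close>

section \<open>Linear extension of maps on monomials\<close>

text \<open>An expansion with a nonzero coefficient does not by itself show that a relation is
  nonzero; that would take independence of the ordered monomials in the completion. Nonvanishing is
  therefore proved apart, with positivity in place of independence. Vector fields reverse brackets,
  so products act in reading order and the last factor acts last; this fits the left ideals, whose
  generators end in high modes. The cut of the loop space is movable: raised at one basis vector
  above all degrees of a chosen product, it makes every factor of that product differentiate, at the
  price of a coboundary in degree 0 and a larger bound for the high modes. The expansion must treat
  infinitely many products at once. The operator \<open>u\<close> is independent of the degrees,
  because the action of degree 0 does not change them. As the modes of x_\<theta> commute, the
  degrees may be sorted before expanding; then only parts with degrees of one sign have to be
  exchanged, which preserves the sum of the positive degrees. Hence every coefficient is a finite
  sum and the tails tend to zero.\<close>

definition lin_ext :: "('a \<Rightarrow> ('b::monoid_add \<Rightarrow>\<^sub>0 complex)) \<Rightarrow> ('a \<Rightarrow>\<^sub>0 complex) \<Rightarrow> ('b \<Rightarrow>\<^sub>0 complex)" where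
  "lin_ext F f = (\<Sum>w \<in> Poly_Mapping.keys f. Poly_Mapping.single 0 (Poly_Mapping.lookup f w) * F w)"

lemma lookup_scale:
  "Poly_Mapping.lookup (Poly_Mapping.single 0 c * f) w = c * Poly_Mapping.lookup f (w :: 'a::monoid_add)"
  for c :: "'c::semiring_1"
  unfolding mult_map_scale_conv_mult[symmetric] by (simp add: Poly_Mapping.map.rep_eq when_def)

text \<open>Scalars sit at the neutral monomial, so they are central even when the monoid is
  noncommutative, as for words.\<close>

lemma scale_comm: "Poly_Mapping.single 0 c * f = f * Poly_Mapping.single 0 c"
  for f :: "'a::monoid_add \<Rightarrow>\<^sub>0 complex"
proof -
  have f: "f = (\<Sum>w\<in>Poly_Mapping.keys f. Poly_Mapping.single w (Poly_Mapping.lookup f w))"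
    by (rule poly_mapping_eqI) (simp add: lookup_sum lookup_single when_def in_keys_iff)
  show ?thesis
    by (subst (1 2) f) (simp add: sum_distrib_left sum_distrib_right mult_single mult.commute)
qed

lemma scale_left_comm: "g * (Poly_Mapping.single 0 c * f) = Poly_Mapping.single 0 c * (g * f)"
  for f :: "'a::monoid_add \<Rightarrow>\<^sub>0 complex"
  by (metis mult.assoc scale_comm)

lemma scale_add: "Poly_Mapping.single 0 (c + d) * f = Poly_Mapping.single 0 c * f + Poly_Mapping.single 0 d * f"
  for f :: "'a::monoid_add \<Rightarrow>\<^sub>0 complex"
  by (simp add: single_add distrib_right)

lemma scale_mult: "Poly_Mapping.single 0 (c * d) * f = Poly_Mapping.single 0 c * (Poly_Mapping.single 0 d * f)"
  for f :: "'a::monoid_add \<Rightarrow>\<^sub>0 complex"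
  by (simp add: mult_single flip: mult.assoc)

lemma lin_ext_superset:
  assumes "finite K" "Poly_Mapping.keys f \<subseteq> K"
  shows "lin_ext F f = (\<Sum>w \<in> K. Poly_Mapping.single 0 (Poly_Mapping.lookup f w) * F w)"
  unfolding lin_ext_def by (rule sum.mono_neutral_left) (use assms in \<open>auto simp: in_keys_iff\<close>)

lemma lin_ext_single [simp]: "lin_ext F (Poly_Mapping.single w c) = Poly_Mapping.single 0 c * F w"
  by (subst lin_ext_superset[of "{w}"]) auto

lemma lin_ext_zero [simp]: "lin_ext F 0 = 0"
  by (simp add: lin_ext_def)

lemma lin_ext_add: "lin_ext F (f + g) = lin_ext F f + lin_ext F g"
proof -
  let ?K = "Poly_Mapping.keys f \<union> Poly_Mapping.keys g"
  have "lin_ext F h = (\<Sum>w \<in> ?K. Poly_Mapping.single 0 (Poly_Mapping.lookup h w) * F w)"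
    if "h \<in> {f, g, f + g}" for h
    by (rule lin_ext_superset) (use that Poly_Mapping.keys_add[of f g] in auto)
  then show ?thesis
    by (simp add: lookup_add scale_add sum.distrib)
qed

lemma lin_ext_scale:
  "lin_ext F (Poly_Mapping.single 0 c * f) = Poly_Mapping.single 0 c * lin_ext F (f :: 'a::monoid_add \<Rightarrow>\<^sub>0 complex)"
proof -
  have "Poly_Mapping.keys (Poly_Mapping.single 0 c * f) \<subseteq> Poly_Mapping.keys f"
    by (auto simp: in_keys_iff lookup_scale)
  then have "lin_ext F (Poly_Mapping.single 0 c * f)
      = (\<Sum>w \<in> Poly_Mapping.keys f. Poly_Mapping.single 0 (Poly_Mapping.lookup (Poly_Mapping.single 0 c * f) w) * F w)"
    by (intro lin_ext_superset) auto
  then show ?thesis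
    by (simp add: lin_ext_def sum_distrib_left lookup_scale scale_mult)
qed

lemma lin_ext_uminus: "lin_ext F (- f) = - lin_ext F f"
  using lin_ext_add[of F f "- f"] by (simp add: eq_neg_iff_add_eq_0 add.commute)

lemma lin_ext_minus: "lin_ext F (f - g) = lin_ext F f - lin_ext F g"
  using lin_ext_add[of F f "- g"] by (simp add: lin_ext_uminus)

lemma lin_ext_sum: "lin_ext F (\<Sum>i\<in>I. f i) = (\<Sum>i\<in>I. lin_ext F (f i))"
  by (induction I rule: infinite_finite_induct) (auto simp: lin_ext_add)

lemma poly_mapping_linear_induct [case_names single add]:
  fixes f :: "'a \<Rightarrow>\<^sub>0 complex"
  assumes "\<And>w c. P (Poly_Mapping.single w c)" "\<And>f g. P f \<Longrightarrow> P g \<Longrightarrow> P (f + g)"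
  shows "P f"
proof -
  have "f = (\<Sum>w\<in>Poly_Mapping.keys f. Poly_Mapping.single w (Poly_Mapping.lookup f w))"
    by (rule poly_mapping_eqI) (simp add: lookup_sum lookup_single when_def in_keys_iff)
  moreover have "P (\<Sum>w\<in>K. Poly_Mapping.single w (Poly_Mapping.lookup f w))" if "finite K" for K
    using that
  proof (induction K rule: finite_induct)
    case empty
    then show ?case using assms(1)[of undefined 0] by simp
  qed (auto intro: assms)
  ultimately show ?thesis by (metis finite_keys)
qed

section \<open>Derivations of polynomial rings\<close>

type_synonym 'v pol = "'v multiset \<Rightarrow>\<^sub>0 complex"

definition var :: "'v \<Rightarrow> 'v pol" where
  "var v = Poly_Mapping.single {#v#} 1"

lemma single_empty_one [simp]: "Poly_Mapping.single {#} 1 = 1"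
  by (metis single_one zero_multiset_def)

text \<open>The sum meets a variable as often as it occurs, which produces the exponent of the power
  rule.\<close>

definition mon_deriv :: "('v \<Rightarrow> 'v pol) \<Rightarrow> 'v multiset \<Rightarrow> 'v pol" where
  "mon_deriv g M = (\<Sum>v\<in>#M. g v * Poly_Mapping.single (M - {#v#}) 1)"

text \<open>The vector field \<open>g\<close> may have infinitely many components; only those at
  variables of the argument enter.\<close>

definition pderiv_of :: "('v \<Rightarrow> 'v pol) \<Rightarrow> 'v pol \<Rightarrow> 'v pol" where
  "pderiv_of g = lin_ext (mon_deriv g)"

lemma mon_deriv_union:
  "mon_deriv g (M + N) = mon_deriv g M * Poly_Mapping.single N 1 + Poly_Mapping.single M 1 * mon_deriv g N"
proof -
  have "g v * Poly_Mapping.single (M + N - {#v#}) 1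
      = g v * Poly_Mapping.single (M - {#v#}) 1 * Poly_Mapping.single N 1" if "v \<in># M" for v
    using multi_member_split[OF that] by (auto simp: mult_single mult.assoc)
  moreover have "g v * Poly_Mapping.single (M + N - {#v#}) 1
      = Poly_Mapping.single M 1 * (g v * Poly_Mapping.single (N - {#v#}) 1)" if "v \<in># N" for v
    using multi_member_split[OF that] by (auto simp: mult_single mult.left_commute)
  ultimately show ?thesis
    by (simp add: mon_deriv_def sum_mset_distrib_left sum_mset_distrib_right multiset.map_comp o_def cong: image_mset_cong)
qed

lemma pderiv_of_add: "pderiv_of g (f + h) = pderiv_of g f + pderiv_of g h"
  and pderiv_of_uminus: "pderiv_of g (- f) = - pderiv_of g f"
  and pderiv_of_zero [simp]: "pderiv_of g 0 = 0"
  and pderiv_of_scale: "pderiv_of g (Poly_Mapping.single 0 c * f) = Poly_Mapping.single 0 c * pderiv_of g f"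
  by (simp_all add: pderiv_of_def lin_ext_add lin_ext_uminus lin_ext_scale)

lemma pderiv_of_mult: "pderiv_of g (f * h) = pderiv_of g f * h + f * pderiv_of g h"
proof (induction f rule: poly_mapping_linear_induct)
  case (single M c)
  show ?case
  proof (induction h rule: poly_mapping_linear_induct)
    case (single N d)
    have mon: "pderiv_of g (Poly_Mapping.single (M + N) 1)
        = pderiv_of g (Poly_Mapping.single M 1) * Poly_Mapping.single N 1
          + Poly_Mapping.single M 1 * pderiv_of g (Poly_Mapping.single N 1)"
      by (simp add: pderiv_of_def mon_deriv_union)
    have *: "Poly_Mapping.single K e = Poly_Mapping.single 0 e * Poly_Mapping.single K 1" for K :: "'a multiset" and e :: complex
      by (simp add: mult_single)
    have c: "Poly_Mapping.single M c * Poly_Mapping.single N d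
        = Poly_Mapping.single 0 c * (Poly_Mapping.single 0 d * Poly_Mapping.single (M + N) 1)"
      by (simp add: mult_single)
    have S: "pderiv_of g (Poly_Mapping.single K e) = Poly_Mapping.single 0 e * pderiv_of g (Poly_Mapping.single K 1)" for K e
      by (metis * pderiv_of_scale)
    have "pderiv_of g (Poly_Mapping.single M c * Poly_Mapping.single N d)
        = Poly_Mapping.single 0 c * (Poly_Mapping.single 0 d * (pderiv_of g (Poly_Mapping.single M 1) * Poly_Mapping.single N 1
          + Poly_Mapping.single M 1 * pderiv_of g (Poly_Mapping.single N 1)))"
      unfolding c pderiv_of_scale mon ..
    also have "\<dots> = (Poly_Mapping.single 0 c * pderiv_of g (Poly_Mapping.single M 1)) * (Poly_Mapping.single 0 d * Poly_Mapping.single N 1)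
        + (Poly_Mapping.single 0 c * Poly_Mapping.single M 1) * (Poly_Mapping.single 0 d * pderiv_of g (Poly_Mapping.single N 1))"
      by (simp only: algebra_simps)
    finally show ?case
      by (simp only: S[of M c] S[of N d] flip: *[of M c] *[of N d])
  qed (simp add: pderiv_of_add algebra_simps)
qed (simp add: pderiv_of_add algebra_simps)

lemma pderiv_of_var [simp]: "pderiv_of g (var v) = g v"
  by (simp add: pderiv_of_def var_def mon_deriv_def single_empty_one)

lemma pderiv_of_const [simp]: "pderiv_of g (Poly_Mapping.single 0 c) = 0"
  by (simp add: pderiv_of_def mon_deriv_def)

lemma pderiv_of_one [simp]: "pderiv_of g 1 = 0"
  using pderiv_of_const[of g 1] by simp

text \<open>The variables generate the ring, so a derivation is known from its values there.
  Differences and commutators of vector fields are identified in this way.\<close>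

lemma derivation_eq_pderiv_of:
  assumes add: "\<And>f h. D (f + h) = D f + D h"
    and scale: "\<And>c f. D (Poly_Mapping.single 0 c * f) = Poly_Mapping.single 0 c * D f"
    and mult: "\<And>f h. D (f * h) = D f * h + f * D h"
    and on_var: "\<And>v. D (var v) = g v"
  shows "D f = pderiv_of g f"
proof -
  have one: "D 1 = 0" using mult[of 1 1] by simp
  have mon: "D (Poly_Mapping.single M 1) = pderiv_of g (Poly_Mapping.single M 1)" for M
  proof (induction M)
    case empty
    then show ?case using one by simp
  next
    case (add v M)
    have "Poly_Mapping.single (add_mset v M) 1 = var v * Poly_Mapping.single M 1"
      by (simp add: var_def mult_single)
    then show ?case by (simp add: mult on_var add pderiv_of_mult)
  qed
  show ?thesis
  proof (induction f rule: poly_mapping_linear_induct)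
    case (single M c)
    have "Poly_Mapping.single M c = Poly_Mapping.single 0 c * Poly_Mapping.single M 1"
      by (simp add: mult_single)
    then show ?case by (metis scale mon pderiv_of_scale)
  qed (simp add: add pderiv_of_add)
qed

lemma pderiv_of_commutator:
  "pderiv_of g (pderiv_of h f) - pderiv_of h (pderiv_of g f)
    = pderiv_of (\<lambda>v. pderiv_of g (h v) - pderiv_of h (g v)) f"
  by (rule derivation_eq_pderiv_of[where D = "\<lambda>f. pderiv_of g (pderiv_of h f) - pderiv_of h (pderiv_of g f)"])
    (auto simp: pderiv_of_add pderiv_of_mult pderiv_of_scale algebra_simps)

section \<open>Sections over the big cell of a Grassmannian\<close>

text \<open>
  The predicate \<open>P\<close> splits a basis of a vector space into two halves. The graph of a map \<open>Z\<close> from the half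
  satisfying \<open>P\<close> to the other one is the column space of \<open>Y = (1; Z)\<close> and the kernel of \<open>G = (-Z, 1)\<close>. A matrix unit
  moves \<open>Z\<close> along the vector field with components \<open>G\<^sub>u\<^sub>,\<^sub>w\<^sub>1 Y\<^sub>w\<^sub>2\<^sub>,\<^sub>w\<close>; the multiplication operator \<open>gr_mult\<close> is its
  action on the fibres of the determinant line bundle, here in the power \<open>k\<close>.
\<close>

abbreviation const :: "complex \<Rightarrow> 'v pol" where
  "const c \<equiv> Poly_Mapping.single 0 c"

definition grY :: "('w \<Rightarrow> bool) \<Rightarrow> 'w \<Rightarrow> 'w \<Rightarrow> ('w \<times> 'w) pol" where
  "grY P u w = (if P u then (if u = w then 1 else 0) else var (u, w))"

definition grG :: "('w \<Rightarrow> bool) \<Rightarrow> 'w \<Rightarrow> 'w \<Rightarrow> ('w \<times> 'w) pol" where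
  "grG P u w = (if P w then - var (u, w) else (if u = w then 1 else 0))"

definition gr_field :: "('w \<Rightarrow> bool) \<Rightarrow> 'w \<Rightarrow> 'w \<Rightarrow> 'w \<times> 'w \<Rightarrow> ('w \<times> 'w) pol" where
  "gr_field P w1 w2 v = (if \<not> P (fst v) \<and> P (snd v) then grG P (fst v) w1 * grY P w2 (snd v) else 0)"

definition gr_mult :: "('w \<Rightarrow> bool) \<Rightarrow> 'w \<Rightarrow> 'w \<Rightarrow> ('w \<times> 'w) pol" where
  "gr_mult P w1 w2 = (if P w1 \<and> \<not> P w2 then var (w2, w1) else 0)"

definition gr_op :: "('w \<Rightarrow> bool) \<Rightarrow> complex \<Rightarrow> 'w \<Rightarrow> 'w \<Rightarrow> ('w \<times> 'w) pol \<Rightarrow> ('w \<times> 'w) pol" where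
  "gr_op P k w1 w2 f = pderiv_of (gr_field P w1 w2) f + const k * (gr_mult P w1 w2 * f)"

lemma pderiv_of_diff_field: "pderiv_of (\<lambda>v. g v - h v) f = pderiv_of g f - pderiv_of h f"
  by (rule sym, rule derivation_eq_pderiv_of[where D = "\<lambda>f. pderiv_of g f - pderiv_of h f"])
   (auto simp: pderiv_of_add pderiv_of_mult pderiv_of_scale algebra_simps)

lemma pderiv_of_if_field: "pderiv_of (\<lambda>v. if b then g v else 0) f = (if b then pderiv_of g f else 0)"
  using pderiv_of_diff_field[of g g f] by auto

text \<open>The sign is opposite to that in the bracket of matrix units: the vector fields of a
  group action reverse brackets.\<close>

lemma pderiv_gr_field:
  "pderiv_of (gr_field P w1 w2) (gr_field P w3 w4 v) - pderiv_of (gr_field P w3 w4) (gr_field P w1 w2 v)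
    = (if w4 = w1 then gr_field P w3 w2 v else 0) - (if w2 = w3 then gr_field P w1 w4 v else 0)"
  by (cases "P w1"; cases "P w2"; cases "P w3"; cases "P w4")
     (auto simp: gr_field_def grG_def grY_def pderiv_of_mult pderiv_of_uminus)

text \<open>The constant is left over when two opposite matrix units cross the cut: one multiplies
  by a coordinate and the other differentiates it. It is the source of the level.\<close>

lemma pderiv_gr_mult:
  "pderiv_of (gr_field P w1 w2) (gr_mult P w3 w4) - pderiv_of (gr_field P w3 w4) (gr_mult P w1 w2)
    = (if w4 = w1 then gr_mult P w3 w2 else 0) - (if w2 = w3 then gr_mult P w1 w4 else 0)
      + const (if w4 = w1 \<and> w2 = w3 then of_bool (P w2 \<and> \<not> P w1) - of_bool (P w1 \<and> \<not> P w2) else 0)"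
  by (cases "P w1"; cases "P w2"; cases "P w3"; cases "P w4")
     (auto simp: gr_field_def gr_mult_def grG_def grY_def pderiv_of_mult pderiv_of_uminus single_uminus)

text \<open>A projective action with reversed brackets; the scalar is \<open>k\<close> times the
  cocycle of the splitting \<open>P\<close>.\<close>

lemma gr_op_commutator:
  "gr_op P k w1 w2 (gr_op P k w3 w4 f) - gr_op P k w3 w4 (gr_op P k w1 w2 f)
    = (if w4 = w1 then gr_op P k w3 w2 f else 0) - (if w2 = w3 then gr_op P k w1 w4 f else 0)
      + const (if w4 = w1 \<and> w2 = w3 then k * (of_bool (P w2 \<and> \<not> P w1) - of_bool (P w1 \<and> \<not> P w2)) else 0) * f"
  (is "?L = ?R")
proof -
  let ?D1 = "pderiv_of (gr_field P w1 w2)" and ?D2 = "pderiv_of (gr_field P w3 w4)"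
  let ?m1 = "gr_mult P w1 w2" and ?m2 = "gr_mult P w3 w4"
  have "?L = (?D1 (?D2 f) - ?D2 (?D1 f)) + const k * ((?D1 ?m2 - ?D2 ?m1) * f)"
    by (simp add: gr_op_def pderiv_of_add pderiv_of_mult algebra_simps del: zero_multiset_def)
  also have "?D1 (?D2 f) - ?D2 (?D1 f) = (if w4 = w1 then pderiv_of (gr_field P w3 w2) f else 0)
      - (if w2 = w3 then pderiv_of (gr_field P w1 w4) f else 0)"
    by (simp add: pderiv_of_commutator pderiv_gr_field pderiv_of_diff_field pderiv_of_if_field)
  also note pderiv_gr_mult
  finally show ?thesis
    by (auto simp: gr_op_def algebra_simps mult_single)
qed

lemma gr_op_add: "gr_op P k w1 w2 (f + g) = gr_op P k w1 w2 f + gr_op P k w1 w2 g"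
  by (simp add: gr_op_def pderiv_of_add algebra_simps)

lemma gr_op_scale: "gr_op P k w1 w2 (const c * f) = const c * gr_op P k w1 w2 f"
  unfolding gr_op_def pderiv_of_scale by (simp add: algebra_simps)

lemma gr_op_zero [simp]: "gr_op P k w1 w2 0 = 0"
  by (simp add: gr_op_def)

lemma gr_op_sum: "gr_op P k w1 w2 (\<Sum>i\<in>I. f i) = (\<Sum>i\<in>I. gr_op P k w1 w2 (f i))"
  by (induction I rule: infinite_finite_induct) (auto simp: gr_op_add)

section \<open>Loop algebra operators as locally finite sums of matrix units\<close>

abbreviation half :: "(nat \<Rightarrow> int) \<Rightarrow> nat \<times> int \<Rightarrow> bool" where
  "half \<kappa> w \<equiv> \<kappa> (fst w) \<le> snd w"

type_synonym fock = "((nat \<times> int) \<times> (nat \<times> int)) pol"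

text \<open>The part of the loop element that starts in degree \<open>q\<close>: it sends the basis
  vector \<open>(b, q)\<close> to \<open>(a, q + i)\<close> with coefficient
  \<open>x a b\<close>.\<close>

definition loop_summand ::
  "(nat \<Rightarrow> int) \<Rightarrow> complex \<Rightarrow> nat \<Rightarrow> (nat \<Rightarrow> nat \<Rightarrow> complex) \<Rightarrow> int \<Rightarrow> fock \<Rightarrow> int \<Rightarrow> fock" where
  "loop_summand \<kappa> k N x i f q =
     (\<Sum>a<N. \<Sum>b<N. const (x a b) * gr_op (half \<kappa>) k (a, q + i) (b, q) f)"

text \<open>\<open>Sum_any\<close> has the intended value because only finitely many
  \<open>q\<close> act nontrivially on a given polynomial.\<close>

definition loop_op ::
  "(nat \<Rightarrow> int) \<Rightarrow> complex \<Rightarrow> nat \<Rightarrow> (nat \<Rightarrow> nat \<Rightarrow> complex) \<Rightarrow> int \<Rightarrow> fock \<Rightarrow> fock" where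
  "loop_op \<kappa> k N x i f = Sum_any (loop_summand \<kappa> k N x i f)"

lemma pderiv_of_single_eq_0:
  assumes "\<And>v. v \<in># M \<Longrightarrow> g v = 0"
  shows "pderiv_of g (Poly_Mapping.single M c) = 0"
  using assms by (simp add: pderiv_of_def mon_deriv_def cong: image_mset_cong)

text \<open>For \<open>w2\<close> in the half \<open>P\<close> the row of \<open>grY\<close> at
  \<open>w2\<close> is a unit vector, so the field only moves coordinates with second index
  \<open>w2\<close>. The companion lemma uses the unit columns of \<open>grG\<close> outside
  \<open>P\<close>.\<close>

lemma gr_op_vanishes:
  assumes "\<And>u w. (u, w) \<in># M \<Longrightarrow> w \<noteq> w2" "P w2"
  shows "gr_op P k w1 w2 (Poly_Mapping.single M c) = 0"
proof -
  have "pderiv_of (gr_field P w1 w2) (Poly_Mapping.single M c) = 0"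
    by (rule pderiv_of_single_eq_0) (use assms in \<open>force simp: gr_field_def grY_def\<close>)
  then show ?thesis using assms(2) by (simp add: gr_op_def gr_mult_def)
qed

lemma gr_op_vanishes':
  assumes "\<And>u w. (u, w) \<in># M \<Longrightarrow> u \<noteq> w1" "\<not> P w1"
  shows "gr_op P k w1 w2 (Poly_Mapping.single M c) = 0"
proof -
  have "pderiv_of (gr_field P w1 w2) (Poly_Mapping.single M c) = 0"
    by (rule pderiv_of_single_eq_0) (use assms in \<open>force simp: gr_field_def grG_def\<close>)
  then show ?thesis using assms(2) by (simp add: gr_op_def gr_mult_def)
qed

text \<open>For large \<open>q\<close> the index \<open>(b, q)\<close> lies in the half and is
  absent from \<open>f\<close>; for very negative \<open>q\<close> the index
  \<open>(a, q + i)\<close> lies outside and is absent. The bound does not involve a matrix, so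
  several matrices can share one window of summation.\<close>

lemma gr_op_locally_finite:
  "\<exists>B. \<forall>q. B < \<bar>q\<bar> \<longrightarrow> (\<forall>a<N. \<forall>b<N. gr_op (half \<kappa>) k (a, q + i) (b, q) f = 0)"
proof (induction f rule: poly_mapping_linear_induct)
  case (single M c)
  define F where "F = \<kappa> ` {..<N} \<union> (\<lambda>v. snd (fst v)) ` set_mset M \<union> (\<lambda>v. snd (snd v)) ` set_mset M"
  have "finite F" by (simp add: F_def)
  then have "finite (abs ` F)" by simp
  then have "\<forall>z\<in>F. \<bar>z\<bar> \<le> Max (abs ` F)" by auto
  then obtain B where B: "\<forall>z\<in>F. \<bar>z\<bar> \<le> B" by blast
  show ?case
  proof (intro exI allI impI)
    fix q a b assume q: "B + \<bar>i\<bar> < \<bar>q\<bar>" and a: "a < N" and b: "b < N"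
    have ka: "\<bar>\<kappa> a\<bar> \<le> B" and kb: "\<bar>\<kappa> b\<bar> \<le> B" using B a b by (auto simp: F_def)
    have M: "\<bar>s\<bar> \<le> B \<and> \<bar>t\<bar> \<le> B" if "((c, s), (d, t)) \<in># M" for c s d t
      using B that by (force simp: F_def)
    show "gr_op (half \<kappa>) k (a, q + i) (b, q) (Poly_Mapping.single M c) = 0"
    proof (cases "q \<ge> 0")
      case True
      show ?thesis by (rule gr_op_vanishes) (use True q kb M in \<open>fastforce+\<close>)
    next
      case False
      show ?thesis by (rule gr_op_vanishes') (use False q ka M in \<open>fastforce+\<close>)
    qed
  qed
next
  case (add f g)
  then obtain B C where "\<forall>q. B < \<bar>q\<bar> \<longrightarrow> (\<forall>a<N. \<forall>b<N. gr_op (half \<kappa>) k (a, q + i) (b, q) f = 0)"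
    "\<forall>q. C < \<bar>q\<bar> \<longrightarrow> (\<forall>a<N. \<forall>b<N. gr_op (half \<kappa>) k (a, q + i) (b, q) g = 0)"
    by blast
  then show ?case
    by (intro exI[of _ "max B C"]) (auto simp: gr_op_add)
qed

lemma loop_summand_bounded: "\<exists>B. \<forall>q. B < \<bar>q\<bar> \<longrightarrow> loop_summand \<kappa> k N x i f q = 0"
  using gr_op_locally_finite[of N \<kappa> k i f] by (fastforce simp: loop_summand_def)

lemma loop_op_eq_sum:
  assumes "\<And>q. B < \<bar>q\<bar> \<Longrightarrow> loop_summand \<kappa> k N x i f q = 0" "{- B..B} \<subseteq> A" "finite A"
  shows "loop_op \<kappa> k N x i f = (\<Sum>q\<in>A. loop_summand \<kappa> k N x i f q)"
  unfolding loop_op_def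
proof (rule Sum_any.expand_superset)
  show "{q. loop_summand \<kappa> k N x i f q \<noteq> 0} \<subseteq> A"
  proof
    fix q assume "q \<in> {q. loop_summand \<kappa> k N x i f q \<noteq> 0}"
    then have "\<not> B < \<bar>q\<bar>" using assms(1) by blast
    then have "q \<in> {- B..B}" by auto
    then show "q \<in> A" using assms(2) by blast
  qed
qed fact

lemma loop_op_windows: "\<exists>B. \<forall>C\<ge>B. loop_op \<kappa> k N x i f = (\<Sum>q\<in>{- C..C}. loop_summand \<kappa> k N x i f q)"
proof -
  obtain B where "\<And>q. B < \<bar>q\<bar> \<Longrightarrow> loop_summand \<kappa> k N x i f q = 0"
    using loop_summand_bounded by blast
  then show ?thesis by (intro exI[of _ B] allI impI loop_op_eq_sum) auto
qed

lemma loop_summand_add: "loop_summand \<kappa> k N x i (f + g) q = loop_summand \<kappa> k N x i f q + loop_summand \<kappa> k N x i g q"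
  by (simp add: loop_summand_def gr_op_add sum.distrib algebra_simps)

lemma loop_summand_scale: "loop_summand \<kappa> k N x i (const c * f) q = const c * loop_summand \<kappa> k N x i f q"
  unfolding loop_summand_def gr_op_scale by (simp add: sum_distrib_left mult.left_commute)

lemma loop_op_add: "loop_op \<kappa> k N x i (f + g) = loop_op \<kappa> k N x i f + loop_op \<kappa> k N x i g"
proof -
  obtain B1 B2 B3 where B: "\<forall>C\<ge>B1. loop_op \<kappa> k N x i (f + g) = (\<Sum>q\<in>{- C..C}. loop_summand \<kappa> k N x i (f + g) q)"
    "\<forall>C\<ge>B2. loop_op \<kappa> k N x i f = (\<Sum>q\<in>{- C..C}. loop_summand \<kappa> k N x i f q)"
    "\<forall>C\<ge>B3. loop_op \<kappa> k N x i g = (\<Sum>q\<in>{- C..C}. loop_summand \<kappa> k N x i g q)"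
    by (metis loop_op_windows)
  define C where "C = max B1 (max B2 B3)"
  have "C \<ge> B1" "C \<ge> B2" "C \<ge> B3" by (auto simp: C_def)
  then show ?thesis using B by (simp add: loop_summand_add sum.distrib)
qed

lemma loop_op_scale: "loop_op \<kappa> k N x i (const c * f) = const c * loop_op \<kappa> k N x i f"
proof -
  obtain B1 B2 where B: "\<forall>C\<ge>B1. loop_op \<kappa> k N x i (const c * f) = (\<Sum>q\<in>{- C..C}. loop_summand \<kappa> k N x i (const c * f) q)"
    "\<forall>C\<ge>B2. loop_op \<kappa> k N x i f = (\<Sum>q\<in>{- C..C}. loop_summand \<kappa> k N x i f q)"
    by (metis loop_op_windows)
  define C where "C = max B1 B2"
  have "C \<ge> B1" "C \<ge> B2" by (auto simp: C_def)
  then show ?thesis using B by (simp only: loop_summand_scale sum_distrib_left)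
qed

lemma loop_op_field_add:
  "loop_op \<kappa> k N (\<lambda>a b. x a b + y a b) i f = loop_op \<kappa> k N x i f + loop_op \<kappa> k N y i f"
proof -
  have s: "loop_summand \<kappa> k N (\<lambda>a b. x a b + y a b) i f q = loop_summand \<kappa> k N x i f q + loop_summand \<kappa> k N y i f q" for q
    by (simp add: loop_summand_def single_add distrib_right sum.distrib)
  obtain B where B: "\<forall>q. B < \<bar>q\<bar> \<longrightarrow> (\<forall>a<N. \<forall>b<N. gr_op (half \<kappa>) k (a, q + i) (b, q) f = 0)"
    using gr_op_locally_finite by blast
  have "loop_op \<kappa> k N z i f = (\<Sum>q\<in>{- B..B}. loop_summand \<kappa> k N z i f q)" for z
    by (rule loop_op_eq_sum) (use B in \<open>auto simp: loop_summand_def\<close>)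
  then show ?thesis by (simp add: s sum.distrib)
qed

lemma loop_op_field_scale:
  "loop_op \<kappa> k N (\<lambda>a b. c * x a b) i f = const c * loop_op \<kappa> k N x i f"
proof -
  have s: "loop_summand \<kappa> k N (\<lambda>a b. c * x a b) i f q = const c * loop_summand \<kappa> k N x i f q" for q
    unfolding loop_summand_def scale_mult by (simp add: sum_distrib_left)
  obtain B where B: "\<forall>q. B < \<bar>q\<bar> \<longrightarrow> (\<forall>a<N. \<forall>b<N. gr_op (half \<kappa>) k (a, q + i) (b, q) f = 0)"
    using gr_op_locally_finite by blast
  have "loop_op \<kappa> k N z i f = (\<Sum>q\<in>{- B..B}. loop_summand \<kappa> k N z i f q)" for z
    by (rule loop_op_eq_sum) (use B in \<open>auto simp: loop_summand_def\<close>)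
  then show ?thesis by (simp add: s sum_distrib_left)
qed

lemma gr_op_sum2: "gr_op P k w1 w2 (\<Sum>a<N. \<Sum>b<N. const (y a b) * F a b)
    = (\<Sum>a<N. \<Sum>b<N. const (y a b) * gr_op P k w1 w2 (F a b))"
  by (simp only: gr_op_sum gr_op_scale)

lemma single_sum: "Poly_Mapping.single w (\<Sum>i\<in>I. c i) = (\<Sum>i\<in>I. Poly_Mapping.single w (c i))"
  by (induction I rule: infinite_finite_induct) (auto simp: single_add)

text \<open>Two summands interact only if the target degree of one is the source degree of the
  other. Each double sum then collapses, and the shared inner index forms the matrix
  product.\<close>

lemma loop_summand_commutator:
  "loop_summand \<kappa> k N x i (loop_summand \<kappa> k N y j f q') q
    - loop_summand \<kappa> k N y j (loop_summand \<kappa> k N x i f q) q'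
   = (if q' = q + i then loop_summand \<kappa> k N (\<lambda>a b. \<Sum>c<N. y a c * x c b) (i + j) f q else 0)
     - (if q = q' + j then loop_summand \<kappa> k N (\<lambda>a b. \<Sum>c<N. x a c * y c b) (i + j) f q' else 0)
     + (if q' = q + i \<and> i + j = 0 then
          const (\<Sum>a<N. \<Sum>b<N. x a b * y b a * (k * (of_bool (\<kappa> b \<le> q \<and> q + i < \<kappa> a) - of_bool (\<kappa> a \<le> q + i \<and> q < \<kappa> b)))) * f
        else 0)"
proof -
  let ?T = "gr_op (half \<kappa>) k"
  let ?C = "\<lambda>a b. k * (of_bool (half \<kappa> (b, q) \<and> \<not> half \<kappa> (a, q + i)) - of_bool (half \<kappa> (a, q + i) \<and> \<not> half \<kappa> (b, q)))"
  let ?S = "\<lambda>F. (\<Sum>a<N. \<Sum>b<N. \<Sum>a'<N. \<Sum>b'<N. F a b a' b')"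
  have 1: "loop_summand \<kappa> k N x i (loop_summand \<kappa> k N y j f q') q
      = ?S (\<lambda>a b a' b'. const (x a b * y a' b') * ?T (a, q + i) (b, q) (?T (a', q' + j) (b', q') f))"
    unfolding loop_summand_def gr_op_sum2 sum_distrib_left scale_mult ..
  have "loop_summand \<kappa> k N y j (loop_summand \<kappa> k N x i f q) q'
      = (\<Sum>a'<N. \<Sum>b'<N. \<Sum>a<N. \<Sum>b<N. const (x a b * y a' b') * ?T (a', q' + j) (b', q') (?T (a, q + i) (b, q) f))"
    unfolding loop_summand_def gr_op_sum2 sum_distrib_left scale_mult
    by (intro sum.cong refl) (simp add: mult.left_commute)
  also have "\<dots> = (\<Sum>a<N. \<Sum>a'<N. \<Sum>b'<N. \<Sum>b<N. const (x a b * y a' b') * ?T (a', q' + j) (b', q') (?T (a, q + i) (b, q) f))"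
    by (subst (2) sum.swap, subst sum.swap) (rule refl)
  also have "\<dots> = ?S (\<lambda>a b a' b'. const (x a b * y a' b') * ?T (a', q' + j) (b', q') (?T (a, q + i) (b, q) f))"
    by (subst (3) sum.swap, subst (2) sum.swap) (rule refl)
  finally have "loop_summand \<kappa> k N x i (loop_summand \<kappa> k N y j f q') q
    - loop_summand \<kappa> k N y j (loop_summand \<kappa> k N x i f q) q'
    = ?S (\<lambda>a b a' b'. const (x a b * y a' b') *
       (?T (a, q + i) (b, q) (?T (a', q' + j) (b', q') f) - ?T (a', q' + j) (b', q') (?T (a, q + i) (b, q) f)))"
    unfolding 1 by (simp only: right_diff_distrib sum_subtractf)
  also have "\<dots> = ?S (\<lambda>a b a' b'.
        (if b' = a then if q' = q + i then const (x a b * y a' b') * ?T (a', q' + j) (b, q) f else 0 else 0)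
      - (if a' = b then if q = q' + j then const (x a b * y a' b') * ?T (a, q + i) (b', q') f else 0 else 0)
      + (if b' = a then if a' = b then if q' = q + i \<and> i + j = 0 then const (x a b * y a' b' * ?C a b) * f else 0 else 0 else 0))"
    by (intro sum.cong refl, subst gr_op_commutator) (auto simp: ring_distribs mult_single simp flip: mult.assoc)
  also have "\<dots> = ?S (\<lambda>a b a' b'. if b' = a then if q' = q + i then const (x a b * y a' b') * ?T (a', q' + j) (b, q) f else 0 else 0)
      - ?S (\<lambda>a b a' b'. if a' = b then if q = q' + j then const (x a b * y a' b') * ?T (a, q + i) (b', q') f else 0 else 0)
      + ?S (\<lambda>a b a' b'. if b' = a then if a' = b then if q' = q + i \<and> i + j = 0 then const (x a b * y a' b' * ?C a b) * f else 0 else 0 else 0)"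
    by (simp only: sum.distrib sum_subtractf)
  also have "?S (\<lambda>a b a' b'. if b' = a then if q' = q + i then const (x a b * y a' b') * ?T (a', q' + j) (b, q) f else 0 else 0)
     = (\<Sum>a<N. \<Sum>b<N. \<Sum>a'<N. if q' = q + i then const (x a b * y a' a) * ?T (a', q' + j) (b, q) f else 0)"
    by (intro sum.cong refl) simp
  also have "\<dots> = (\<Sum>a'<N. \<Sum>b<N. \<Sum>a<N. if q' = q + i then const (x a b * y a' a) * ?T (a', q' + j) (b, q) f else 0)"
    by (subst sum.swap, subst (2) sum.swap, subst sum.swap) (rule refl)
  also have "\<dots> = (if q' = q + i then loop_summand \<kappa> k N (\<lambda>a b. \<Sum>c<N. y a c * x c b) (i + j) f q else 0)"
    by (simp add: loop_summand_def single_sum sum_distrib_right mult.commute add.assoc)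
  also have "?S (\<lambda>a b a' b'. if a' = b then if q = q' + j then const (x a b * y a' b') * ?T (a, q + i) (b', q') f else 0 else 0)
     = (\<Sum>a<N. \<Sum>b<N. \<Sum>b'<N. if q = q' + j then const (x a b * y b b') * ?T (a, q + i) (b', q') f else 0)"
    by (rule sum.cong[OF refl], rule sum.cong[OF refl], subst sum.swap) simp
  also have "\<dots> = (\<Sum>a<N. \<Sum>b'<N. \<Sum>b<N. if q = q' + j then const (x a b * y b b') * ?T (a, q + i) (b', q') f else 0)"
    by (subst (2) sum.swap) (rule refl)
  also have "\<dots> = (if q = q' + j then loop_summand \<kappa> k N (\<lambda>a b. \<Sum>c<N. x a c * y c b) (i + j) f q' else 0)"
    by (simp add: loop_summand_def single_sum sum_distrib_right ac_simps)
  also have "?S (\<lambda>a b a' b'. if b' = a then if a' = b then if q' = q + i \<and> i + j = 0 then const (x a b * y a' b' * ?C a b) * f else 0 else 0 else 0)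
     = (\<Sum>a<N. \<Sum>b<N. if q' = q + i \<and> i + j = 0 then const (x a b * y b a * ?C a b) * f else 0)"
    by (intro sum.cong refl) simp
  also have "\<dots> = (if q' = q + i \<and> i + j = 0 then const (\<Sum>a<N. \<Sum>b<N. x a b * y b a * ?C a b) * f else 0)"
    by (cases "q' = q + i \<and> i + j = 0") (simp_all only: simp_thms single_sum sum_distrib_right if_True if_False sum.neutral_const)
  finally show ?thesis by (simp add: not_le)
qed

text \<open>The signed number of degrees between two cuts. In the commutator it turns crossings of
  the cut into the factor \<open>\<kappa> a - \<kappa> b - i\<close>.\<close>

lemma sum_signed_indicator:
  assumes "finite A" "{lo..<hi} \<subseteq> A" "{hi..<lo} \<subseteq> A"
  shows "(\<Sum>q\<in>A. of_bool (lo \<le> q \<and> q < hi) - of_bool (hi \<le> q \<and> q < lo)) = (of_int (hi - lo) :: complex)"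
proof -
  have "{q\<in>A. lo \<le> q \<and> q < hi} = {lo..<hi}" "{q\<in>A. hi \<le> q \<and> q < lo} = {hi..<lo}"
    using assms by auto
  then have "(\<Sum>q\<in>A. of_bool (lo \<le> q \<and> q < hi)) = (of_nat (card {lo..<hi}) :: complex)"
    "(\<Sum>q\<in>A. of_bool (hi \<le> q \<and> q < lo)) = (of_nat (card {hi..<lo}) :: complex)"
    using assms(1) by (simp_all add: of_bool_def sum.If_cases Int_def)
  then show ?thesis by (cases "lo \<le> hi") (simp_all add: sum_subtractf)
qed

lemma loop_summand_zero [simp]: "loop_summand \<kappa> k N x i 0 q = 0"
  by (simp add: loop_summand_def)

lemma loop_summand_sum: "loop_summand \<kappa> k N x i (\<Sum>t\<in>I. f t) q = (\<Sum>t\<in>I. loop_summand \<kappa> k N x i (f t) q)"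
  by (induction I rule: infinite_finite_induct) (auto simp: loop_summand_add)

text \<open>For a constant cut the scalar is \<open>- k * of_int i\<close> times the trace form, the
  affine cocycle with the reversed sign; a nonconstant cut adds a coboundary.\<close>

lemma loop_op_commutator:
  "loop_op \<kappa> k N x i (loop_op \<kappa> k N y j f) - loop_op \<kappa> k N y j (loop_op \<kappa> k N x i f)
   = loop_op \<kappa> k N (\<lambda>a b. \<Sum>c<N. y a c * x c b) (i + j) f
     - loop_op \<kappa> k N (\<lambda>a b. \<Sum>c<N. x a c * y c b) (i + j) f
     + (if i + j = 0 then const (\<Sum>a<N. \<Sum>b<N. x a b * y b a * (k * of_int (\<kappa> a - \<kappa> b - i))) * f else 0)"
proof -
  let ?S = "loop_summand \<kappa> k N"
  let ?yx = "\<lambda>a b. \<Sum>c<N. y a c * x c b" and ?xy = "\<lambda>a b. \<Sum>c<N. x a c * y c b"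
  let ?c = "\<lambda>q. \<Sum>a<N. \<Sum>b<N. x a b * y b a * (k * (of_bool (\<kappa> b \<le> q \<and> q + i < \<kappa> a) - of_bool (\<kappa> a \<le> q + i \<and> q < \<kappa> b)))"
  obtain B1 where B1: "\<forall>q. B1 < \<bar>q\<bar> \<longrightarrow> (\<forall>a<N. \<forall>b<N. gr_op (half \<kappa>) k (a, q + i) (b, q) f = 0)"
    using gr_op_locally_finite by blast
  obtain B2 where B2: "\<forall>q. B2 < \<bar>q\<bar> \<longrightarrow> (\<forall>a<N. \<forall>b<N. gr_op (half \<kappa>) k (a, q + j) (b, q) f = 0)"
    using gr_op_locally_finite by blast
  obtain B3 where B3: "\<forall>q. B3 < \<bar>q\<bar> \<longrightarrow> (\<forall>a<N. \<forall>b<N. gr_op (half \<kappa>) k (a, q + (i + j)) (b, q) f = 0)"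
    using gr_op_locally_finite by blast
  obtain B4 where B4: "\<And>q. B4 < \<bar>q\<bar> \<Longrightarrow> ?S x i (loop_op \<kappa> k N y j f) q = 0"
    using loop_summand_bounded by blast
  obtain B5 where B5: "\<And>q. B5 < \<bar>q\<bar> \<Longrightarrow> ?S y j (loop_op \<kappa> k N x i f) q = 0"
    using loop_summand_bounded by blast
  define B6 where "B6 = Max (insert 0 ((\<lambda>a. \<bar>\<kappa> a\<bar>) ` {..<N}))"
  have B6: "\<bar>\<kappa> a\<bar> \<le> B6" if "a < N" for a unfolding B6_def using that by auto
  define B where "B = max B1 (max B2 (max B3 (max B4 (max B5 B6))))"
  have B: "B1 \<le> B" "B2 \<le> B" "B3 \<le> B" "B4 \<le> B" "B5 \<le> B" "B6 \<le> B" by (auto simp: B_def)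
  \<comment> \<open>The margin over \<open>B\<close> ensures that a degree which leaves the window
    under a shift by \<open>i\<close> or \<open>j\<close> already lies beyond all bounds, so nothing
    is lost at the ends.\<close>
  define A where "A = {- (B + \<bar>i\<bar> + \<bar>j\<bar>) .. B + \<bar>i\<bar> + \<bar>j\<bar>}"
  have A: "finite A" "{- B..B} \<subseteq> A" "\<And>q. q \<in> A \<Longrightarrow> q + i \<notin> A \<Longrightarrow> B < \<bar>q\<bar>" "\<And>q. q \<in> A \<Longrightarrow> q + j \<notin> A \<Longrightarrow> B < \<bar>q\<bar>"
    by (auto simp: A_def)
  have opx: "loop_op \<kappa> k N x i f = (\<Sum>q\<in>A. ?S x i f q)"
    by (rule loop_op_eq_sum[where B = B]) (use A B B1 in \<open>auto simp: loop_summand_def\<close>)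
  have opy: "loop_op \<kappa> k N y j f = (\<Sum>q\<in>A. ?S y j f q)"
    by (rule loop_op_eq_sum[where B = B]) (use A B B2 in \<open>auto simp: loop_summand_def\<close>)
  have z: "?S z (i + j) f q = 0" if "B < \<bar>q\<bar>" for z q
    using that B B3 by (auto simp: loop_summand_def)
  have opz: "loop_op \<kappa> k N z (i + j) f = (\<Sum>q\<in>A. ?S z (i + j) f q)" for z
    by (rule loop_op_eq_sum[where B = B]) (use A z in auto)
  have "loop_op \<kappa> k N x i (loop_op \<kappa> k N y j f) = (\<Sum>q\<in>A. \<Sum>q'\<in>A. ?S x i (?S y j f q') q)"
  proof -
    have "loop_op \<kappa> k N x i (loop_op \<kappa> k N y j f) = (\<Sum>q\<in>A. ?S x i (loop_op \<kappa> k N y j f) q)"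
      by (rule loop_op_eq_sum[where B = B]) (use A B B4 in auto)
    then show ?thesis by (simp add: opy loop_summand_sum)
  qed
  moreover have "loop_op \<kappa> k N y j (loop_op \<kappa> k N x i f) = (\<Sum>q\<in>A. \<Sum>q'\<in>A. ?S y j (?S x i f q) q')"
  proof -
    have "loop_op \<kappa> k N y j (loop_op \<kappa> k N x i f) = (\<Sum>q\<in>A. ?S y j (loop_op \<kappa> k N x i f) q)"
      by (rule loop_op_eq_sum[where B = B]) (use A B B5 in auto)
    then show ?thesis by (subst sum.swap) (simp add: opx loop_summand_sum)
  qed
  ultimately have "loop_op \<kappa> k N x i (loop_op \<kappa> k N y j f) - loop_op \<kappa> k N y j (loop_op \<kappa> k N x i f)
    = (\<Sum>q\<in>A. \<Sum>q'\<in>A. ?S x i (?S y j f q') q - ?S y j (?S x i f q) q')"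
    by (simp add: sum_subtractf)
  also have "\<dots> = (\<Sum>q\<in>A. \<Sum>q'\<in>A. if q' = q + i then ?S ?yx (i + j) f q else 0)
      - (\<Sum>q\<in>A. \<Sum>q'\<in>A. if q = q' + j then ?S ?xy (i + j) f q' else 0)
      + (\<Sum>q\<in>A. \<Sum>q'\<in>A. if q' = q + i then if i + j = 0 then const (?c q) * f else 0 else 0)"
    unfolding loop_summand_commutator by (simp only: sum.distrib sum_subtractf if_if_eq_conj)
  also have "(\<Sum>q\<in>A. \<Sum>q'\<in>A. if q' = q + i then ?S ?yx (i + j) f q else 0) = loop_op \<kappa> k N ?yx (i + j) f"
    unfolding opz by (rule sum.cong[OF refl]) (use A z in auto)
  also have "(\<Sum>q\<in>A. \<Sum>q'\<in>A. if q = q' + j then ?S ?xy (i + j) f q' else 0) = loop_op \<kappa> k N ?xy (i + j) f"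
    unfolding opz by (subst sum.swap, rule sum.cong[OF refl]) (use A z in auto)
  also have "(\<Sum>q\<in>A. \<Sum>q'\<in>A. if q' = q + i then if i + j = 0 then const (?c q) * f else 0 else 0)
      = (\<Sum>q\<in>A. if i + j = 0 then const (?c q) * f else 0)"
  proof (rule sum.cong[OF refl])
    fix q assume q: "q \<in> A"
    have "?c q = 0" if "q + i \<notin> A"
    proof -
      have "\<not> (\<kappa> b \<le> q \<and> q + i < \<kappa> a) \<and> \<not> (\<kappa> a \<le> q + i \<and> q < \<kappa> b)" if "a < N" "b < N" for a b
        using B6[OF that(1)] B6[OF that(2)] B(6) q \<open>q + i \<notin> A\<close> by (auto simp: A_def)
      then show ?thesis by (intro sum.neutral ballI) (fastforce)
    qed
    then show "(\<Sum>q'\<in>A. if q' = q + i then if i + j = 0 then const (?c q) * f else 0 else 0)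
        = (if i + j = 0 then const (?c q) * f else 0)"
      using A(1) by simp
  qed
  also have "\<dots> = (if i + j = 0 then const (\<Sum>q\<in>A. ?c q) * f else 0)"
    by (simp add: single_sum sum_distrib_right)
  also have "(\<Sum>q\<in>A. ?c q) = (\<Sum>a<N. \<Sum>b<N. x a b * y b a * (k * of_int (\<kappa> a - \<kappa> b - i)))"
  proof -
    have "(\<Sum>q\<in>A. ?c q) = (\<Sum>a<N. \<Sum>b<N. \<Sum>q\<in>A. x a b * y b a * (k * (of_bool (\<kappa> b \<le> q \<and> q < \<kappa> a - i) - of_bool (\<kappa> a - i \<le> q \<and> q < \<kappa> b))))"
      by (subst sum.swap, subst (2) sum.swap) (simp add: algebra_simps)
    also have "\<dots> = (\<Sum>a<N. \<Sum>b<N. x a b * y b a * (k * of_int (\<kappa> a - i - \<kappa> b)))"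
    proof (intro sum.cong refl)
      fix a b assume "a \<in> {..<N}" "b \<in> {..<N}"
      then have ab: "\<bar>\<kappa> a\<bar> \<le> B" "\<bar>\<kappa> b\<bar> \<le> B" using B6[of a] B6[of b] B(6) by auto
      have "(\<Sum>q\<in>A. of_bool (\<kappa> b \<le> q \<and> q < \<kappa> a - i) - of_bool (\<kappa> a - i \<le> q \<and> q < \<kappa> b)) = (of_int (\<kappa> a - i - \<kappa> b) :: complex)"
        by (rule sum_signed_indicator) (use ab in \<open>auto simp: A_def\<close>)
      then show "(\<Sum>q\<in>A. x a b * y b a * (k * (of_bool (\<kappa> b \<le> q \<and> q < \<kappa> a - i) - of_bool (\<kappa> a - i \<le> q \<and> q < \<kappa> b))))
         = x a b * y b a * (k * of_int (\<kappa> a - i - \<kappa> b))"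
        by (simp only: flip: sum_distrib_left)
    qed
    finally show ?thesis by (simp add: algebra_simps)
  qed
  finally show ?thesis .
qed

section \<open>A representation of level k\<close>

text \<open>
  The cut \<open>\<kappa>\<close> splits the basis \<open>e\<^sub>a t\<^sup>q\<close> of the loop space at \<open>q = \<kappa> a\<close>. The cocycle obtained from it
  differs from the one of the affine algebra by the coboundary of \<open>cut_trace\<close>.
\<close>

definition cut_trace :: "(nat \<Rightarrow> int) \<Rightarrow> nat \<Rightarrow> complex mat \<Rightarrow> int \<Rightarrow> complex" where
  "cut_trace \<kappa> n x i = (if i = 0 then \<Sum>a<2 * n. of_int (\<kappa> a) * x $$ (a, a) else 0)"

fun rep_op :: "(nat \<Rightarrow> int) \<Rightarrow> complex \<Rightarrow> nat \<Rightarrow> aff_gen \<Rightarrow> fock \<Rightarrow> fock" where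
  "rep_op \<kappa> k n (Loop x i) f = loop_op \<kappa> k (2 * n) (\<lambda>a b. x $$ (a, b)) i f
     - const (k * cut_trace \<kappa> n x i) * f"
| "rep_op \<kappa> k n Cent f = const k * f"

text \<open>\<open>fold\<close> applies the first letter first: since the operators reverse
  brackets, a product has to act in reading order. The last factor of a product thus acts last, so a
  left ideal ends in the operators of its generators.\<close>

definition rep :: "(nat \<Rightarrow> int) \<Rightarrow> complex \<Rightarrow> nat \<Rightarrow> aff_alg \<Rightarrow> fock \<Rightarrow> fock" where
  "rep \<kappa> k n F h = lin_ext (\<lambda>w. fold (rep_op \<kappa> k n) (letters w) h) F"

lemma rep_op_add: "rep_op \<kappa> k n g (f + h) = rep_op \<kappa> k n g f + rep_op \<kappa> k n g h"
  by (cases g) (simp_all add: loop_op_add algebra_simps)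

lemma rep_op_scale: "rep_op \<kappa> k n g (const c * f) = const c * rep_op \<kappa> k n g f"
  by (cases g) (simp_all only: rep_op.simps loop_op_scale, simp_all add: algebra_simps)

lemma fold_rep_op_add: "fold (rep_op \<kappa> k n) ws (f + h) = fold (rep_op \<kappa> k n) ws f + fold (rep_op \<kappa> k n) ws h"
  by (induction ws arbitrary: f h) (simp_all add: rep_op_add)

lemma fold_rep_op_scale: "fold (rep_op \<kappa> k n) ws (const c * f) = const c * fold (rep_op \<kappa> k n) ws f"
  by (induction ws arbitrary: f) (simp_all only: fold.simps o_apply id_apply rep_op_scale)

lemma rep_add: "rep \<kappa> k n (F + G) h = rep \<kappa> k n F h + rep \<kappa> k n G h"
  and rep_minus: "rep \<kappa> k n (F - G) h = rep \<kappa> k n F h - rep \<kappa> k n G h"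
  and rep_zero [simp]: "rep \<kappa> k n 0 h = 0"
  and rep_sum: "rep \<kappa> k n (\<Sum>i\<in>I. F' i) h = (\<Sum>i\<in>I. rep \<kappa> k n (F' i) h)"
  by (simp_all add: rep_def lin_ext_add lin_ext_minus lin_ext_sum)

lemma rep_arg_add: "rep \<kappa> k n F (f + h) = rep \<kappa> k n F f + rep \<kappa> k n F h"
  unfolding rep_def lin_ext_def fold_rep_op_add by (simp add: algebra_simps sum.distrib)

lemma rep_arg_scale: "rep \<kappa> k n F (const c * f) = const c * rep \<kappa> k n F f"
  unfolding rep_def lin_ext_def fold_rep_op_scale by (simp add: sum_distrib_left mult.left_commute)

lemma rep_arg_zero [simp]: "rep \<kappa> k n F 0 = 0"
  using rep_arg_scale[of \<kappa> k n F 0 0] by simp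

lemma rep_single: "rep \<kappa> k n (Poly_Mapping.single w c) h = const c * fold (rep_op \<kappa> k n) (letters w) h"
  by (simp add: rep_def)

lemma rep_gen: "rep \<kappa> k n (gen s) h = rep_op \<kappa> k n s h"
  by (simp add: gen_def rep_single)

lemma rep_scal: "rep \<kappa> k n (scal c) h = const c * h"
  by (simp add: scal_def rep_single zero_fmon_def)

lemma rep_mult: "rep \<kappa> k n (F * G) h = rep \<kappa> k n G (rep \<kappa> k n F h)"
proof (induction F rule: poly_mapping_linear_induct)
  case (single v c)
  show ?case
  proof (induction G rule: poly_mapping_linear_induct)
    case (single w d)
    show ?case
      unfolding mult_single rep_single fold_rep_op_scale
      by (simp add: plus_fmon_def mult_single mult.commute[of d c] flip: mult.assoc)
  qed (simp add: distrib_left rep_add)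
qed (simp add: distrib_right rep_add rep_arg_add)

lemma rep_one: "rep \<kappa> k n 1 h = h"
  using rep_scal[of \<kappa> k n 1 h] by (simp add: scal_def)

lemma spD: "x \<in> sp n \<Longrightarrow> x \<in> carrier_mat (2 * n) (2 * n)"
  by (simp add: sp_def)

lemma loop_op_cong:
  assumes "\<And>a b. a < N \<Longrightarrow> b < N \<Longrightarrow> x a b = y a b"
  shows "loop_op \<kappa> k N x i f = loop_op \<kappa> k N y i f"
proof -
  have "loop_summand \<kappa> k N x i f = loop_summand \<kappa> k N y i f"
    by (rule ext) (simp add: loop_summand_def assms)
  then show ?thesis by (simp add: loop_op_def)
qed

lemma mult_entry:
  assumes "x \<in> carrier_mat m m" "y \<in> carrier_mat m m" "a < m" "b < m"
  shows "(x * y) $$ (a, b) = (\<Sum>c<m. x $$ (a, c) * y $$ (c, b))"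
  using assms by (simp add: scalar_prod_def lessThan_atLeast0)

lemma bracket_entry:
  assumes "x \<in> carrier_mat m m" "y \<in> carrier_mat m m" "a < m" "b < m"
  shows "bracket x y $$ (a, b) = (\<Sum>c<m. x $$ (a, c) * y $$ (c, b)) - (\<Sum>c<m. y $$ (a, c) * x $$ (c, b))"
proof -
  have "bracket x y $$ (a, b) = (x * y) $$ (a, b) - (y * x) $$ (a, b)"
    using assms unfolding bracket_def by simp
  then show ?thesis using assms by (simp only: mult_entry)
qed

lemma rep_relator:
  assumes "\<rho> \<in> aff_relators n k"
  shows "rep \<kappa> (of_nat k) n \<rho> h = 0"
  using assms
proof cases
  case (add x y i)
  note c = spD[OF add(2)] spD[OF add(3)]
  have "loop_op \<kappa> (of_nat k) (2 * n) (\<lambda>a b. (x + y) $$ (a, b)) i h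
      = loop_op \<kappa> (of_nat k) (2 * n) (\<lambda>a b. x $$ (a, b) + y $$ (a, b)) i h"
    by (rule loop_op_cong) (use c in simp)
  moreover have "cut_trace \<kappa> n (x + y) i = cut_trace \<kappa> n x i + cut_trace \<kappa> n y i"
    using c by (simp add: cut_trace_def algebra_simps flip: sum.distrib)
  ultimately show ?thesis
    by (simp add: add(1) rep_minus rep_add rep_gen loop_op_field_add ring_distribs single_add)
next
  case (smult x z i)
  note c = spD[OF smult(2)]
  have "loop_op \<kappa> (of_nat k) (2 * n) (\<lambda>a b. (z \<cdot>\<^sub>m x) $$ (a, b)) i h
      = loop_op \<kappa> (of_nat k) (2 * n) (\<lambda>a b. z * x $$ (a, b)) i h"
    by (rule loop_op_cong) (use c in simp)
  moreover have "cut_trace \<kappa> n (z \<cdot>\<^sub>m x) i = z * cut_trace \<kappa> n x i"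
    using c by (simp add: cut_trace_def sum_distrib_left mult.left_commute)
  ultimately show ?thesis
    unfolding smult(1) rep_minus rep_mult rep_gen rep_scal rep_op_scale
    by (simp add: loop_op_field_scale ring_distribs mult_single mult.left_commute flip: mult.assoc)
next
  case (comm x y i j)
  note c = spD[OF comm(2)] spD[OF comm(3)]
  let ?op = "loop_op \<kappa> (of_nat k) (2 * n)"
  have "?op (\<lambda>a b. bracket x y $$ (a, b)) (i + j) h
    = ?op (\<lambda>a b. (\<Sum>c<2*n. x $$ (a, c) * y $$ (c, b)) + (-1) * (\<Sum>c<2*n. y $$ (a, c) * x $$ (c, b))) (i + j) h"
    by (rule loop_op_cong) (simp add: bracket_entry[OF c])
  also have "\<dots> = ?op (\<lambda>a b. \<Sum>c<2*n. x $$ (a, c) * y $$ (c, b)) (i + j) h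
      - ?op (\<lambda>a b. \<Sum>c<2*n. y $$ (a, c) * x $$ (c, b)) (i + j) h"
    unfolding loop_op_field_add loop_op_field_scale by (simp add: single_uminus)
  finally have br: "?op (\<lambda>a b. bracket x y $$ (a, b)) (i + j) h = \<dots>" .
  \<comment> \<open>The affine cocycle and that of the cut differ by \<open>cut_trace\<close> of the
    bracket; this is what the scalar subtracted in \<open>rep_op\<close> absorbs.\<close>
  have tr: "cut_trace \<kappa> n (bracket x y) (i + j) - of_int i * inv_form n x y
    = (\<Sum>a<2*n. \<Sum>b<2*n. x $$ (a, b) * y $$ (b, a) * (of_int (\<kappa> a - \<kappa> b - i)))" if "i + j = 0"
  proof -
    have "(\<Sum>a<2 * n. of_int (\<kappa> a) * bracket x y $$ (a, a))
      = (\<Sum>a<2 * n. \<Sum>b<2*n. of_int (\<kappa> a) * (x $$ (a, b) * y $$ (b, a))) - (\<Sum>a<2 * n. \<Sum>b<2*n. of_int (\<kappa> a) * (y $$ (a, b) * x $$ (b, a)))"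
      by (simp add: bracket_entry[OF c] right_diff_distrib sum_subtractf sum_distrib_left)
    also have "(\<Sum>a<2 * n. \<Sum>b<2*n. of_int (\<kappa> a) * (y $$ (a, b) * x $$ (b, a))) = (\<Sum>a<2 * n. \<Sum>b<2*n. of_int (\<kappa> b) * (x $$ (a, b) * y $$ (b, a)))"
      by (subst sum.swap) (simp add: mult.commute)
    finally have t: "(\<Sum>a<2 * n. of_int (\<kappa> a) * bracket x y $$ (a, a))
      = (\<Sum>a<2 * n. \<Sum>b<2*n. of_int (\<kappa> a) * (x $$ (a, b) * y $$ (b, a))) - (\<Sum>a<2 * n. \<Sum>b<2*n. of_int (\<kappa> b) * (x $$ (a, b) * y $$ (b, a)))" .
    have i: "inv_form n x y = (\<Sum>a<2 * n. \<Sum>b<2*n. x $$ (a, b) * y $$ (b, a))"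
      unfolding inv_form_def by (intro sum.cong refl mult_entry[OF c]) auto
    show ?thesis
      unfolding cut_trace_def if_P[OF that] t i sum_distrib_left sum_subtractf[symmetric]
      by (intro sum.cong refl) (simp add: algebra_simps)
  qed
  have m: "?op z l (f - const c * g) = ?op z l f - const c * ?op z l g" for z l f c g
    using loop_op_add[of \<kappa> "of_nat k" "2*n" z l "f - const c * g" "const c * g"]
    unfolding loop_op_scale by simp
  have s: "rep_op \<kappa> (of_nat k) n (Loop y j) (rep_op \<kappa> (of_nat k) n (Loop x i) h)
      - rep_op \<kappa> (of_nat k) n (Loop x i) (rep_op \<kappa> (of_nat k) n (Loop y j) h)
      = ?op (\<lambda>a b. y $$ (a, b)) j (?op (\<lambda>a b. x $$ (a, b)) i h)
     - ?op (\<lambda>a b. x $$ (a, b)) i (?op (\<lambda>a b. y $$ (a, b)) j h)"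
    unfolding rep_op.simps m right_diff_distrib by (simp add: mult.left_commute)
  have r: "rep \<kappa> (of_nat k) n \<rho> h = ?op (\<lambda>a b. y $$ (a, b)) j (?op (\<lambda>a b. x $$ (a, b)) i h)
     - ?op (\<lambda>a b. x $$ (a, b)) i (?op (\<lambda>a b. y $$ (a, b)) j h)
     - rep_op \<kappa> (of_nat k) n (Loop (bracket x y) (i + j)) h
     - (if i + j = 0 then const (of_nat k * (of_int i * inv_form n x y)) * h else 0)"
    unfolding comm(1) rep_minus rep_add rep_mult rep_gen s[symmetric]
    by (cases "i + j = 0") (simp_all add: rep_mult rep_gen rep_scal scale_mult del: rep_op.simps(1) single_of_nat)
  note q = loop_op_commutator[of \<kappa> "of_nat k" "2 * n" "\<lambda>a b. x $$ (a, b)" i "\<lambda>a b. y $$ (a, b)" j h]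
  show ?thesis
  proof (cases "i + j = 0")
    case True
    have "const (of_nat k * cut_trace \<kappa> n (bracket x y) (i + j)) * h
      - const (of_nat k * (of_int i * inv_form n x y)) * h
      = const (\<Sum>a<2*n. \<Sum>b<2*n. x $$ (a, b) * y $$ (b, a) * (of_nat k * of_int (\<kappa> a - \<kappa> b - i))) * h"
      unfolding left_diff_distrib[symmetric] single_diff[symmetric] right_diff_distrib[symmetric] tr[OF True]
      by (simp add: sum_distrib_left mult.left_commute)
    then show ?thesis using q True unfolding r rep_op.simps br by (simp add: algebra_simps)
  next
    case False
    then show ?thesis using q unfolding r rep_op.simps br by (simp add: cut_trace_def algebra_simps)
  qed
next
  case (cent x i)
  then show ?thesis
    by (simp only: rep_minus rep_mult rep_gen rep_op.simps(2) rep_op_scale) simp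
next
  case level
  then show ?thesis by (simp add: rep_minus rep_gen rep_scal)
qed

lemma rep_ideal: "f \<in> aff_ideal n k \<Longrightarrow> rep \<kappa> (of_nat k) n f h = 0"
  by (induction rule: aff_ideal.induct) (auto simp: rep_add rep_mult rep_relator)

section \<open>Nonvanishing of sums of products\<close>

lemma lookup_sum_mset: "Poly_Mapping.lookup (\<Sum>v\<in>#M. F v) K = (\<Sum>v\<in>#M. Poly_Mapping.lookup (F v) K)"
  by (induction M) (auto simp: lookup_add)

lemma lookup_times_monomial:
  "Poly_Mapping.lookup (f * Poly_Mapping.single N 1) K = (if N \<subseteq># K then Poly_Mapping.lookup f (K - N) else 0)"
  for f :: "'v pol"
proof (induction f rule: poly_mapping_linear_induct)
  case (single M c)
  show ?case by (auto simp: mult_single lookup_single when_def) (metis mset_subset_eq_add_right)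
qed (auto simp: lookup_add distrib_right)

lemma lookup_gr_field_empty:
  "Poly_Mapping.lookup (gr_field P w1 w2 v) {#} = of_bool (\<not> P w1 \<and> P w2 \<and> v = (w1, w2))"
  by (cases v) (auto simp: gr_field_def grG_def grY_def var_def mult_single lookup_single lookup_one)

text \<open>The field has a constant component only at \<open>(w1, w2)\<close>, and only if the
  matrix unit leads out of the half \<open>P\<close>. So the part that lowers the degree is the
  partial derivative along this coordinate. If \<open>K\<close> is empty, components of positive
  degree cannot contribute at all.\<close>

lemma lookup_gr_op_monomial:
  assumes "size K < size M \<or> K = {#}"
  shows "Poly_Mapping.lookup (gr_op P k w1 w2 (Poly_Mapping.single M c)) K
    = (if \<not> P w1 \<and> P w2 \<and> M = add_mset (w1, w2) K then c * of_nat (count K (w1, w2) + 1) else 0)"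
proof -
  have "Poly_Mapping.lookup (const k * (gr_mult P w1 w2 * Poly_Mapping.single M c)) K = 0"
    using assms by (auto simp: lookup_scale gr_mult_def var_def mult_single lookup_single when_def)
  moreover have "Poly_Mapping.lookup (pderiv_of (gr_field P w1 w2) (Poly_Mapping.single M c)) K
    = c * (\<Sum>v\<in>#M. of_bool (\<not> P w1 \<and> P w2 \<and> v = (w1, w2) \<and> M = add_mset v K))"
  proof -
    have "Poly_Mapping.lookup (gr_field P w1 w2 v * Poly_Mapping.single (M - {#v#}) 1) K
      = of_bool (\<not> P w1 \<and> P w2 \<and> v = (w1, w2) \<and> M = add_mset v K)" if "v \<in># M" for v
    proof -
      obtain N where N: "M = add_mset v N" using \<open>v \<in># M\<close> multi_member_split by metis
      have "size K \<le> size N" using assms N by auto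
      then have "N \<subseteq># K \<longleftrightarrow> N = K"
        by (metis leD mset_subset_size subset_mset.order_iff_strict)
      then show ?thesis by (auto simp: lookup_times_monomial N lookup_gr_field_empty)
    qed
    then show ?thesis
      by (simp add: pderiv_of_def mon_deriv_def lookup_scale lookup_sum_mset sum_mset_distrib_left multiset.map_comp o_def cong: image_mset_cong)
  qed
  moreover have "(\<Sum>v\<in>#M. of_bool (\<not> P w1 \<and> P w2 \<and> v = (w1, w2) \<and> M = add_mset v K))
    = (if \<not> P w1 \<and> P w2 \<and> M = add_mset (w1, w2) K then of_nat (count K (w1, w2) + 1) else (0::complex))"
  proof -
    have *: "(\<Sum>v\<in>#L. of_bool (v = w \<and> Q)) = (if Q then of_nat (count L w) else (0::complex))" for L Q and w :: "'a \<times> 'a"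
      by (induction L) auto
    have "(\<Sum>v\<in>#M. of_bool (\<not> P w1 \<and> P w2 \<and> v = (w1, w2) \<and> M = add_mset v K))
      = (\<Sum>v\<in>#M. of_bool (v = (w1, w2) \<and> (\<not> P w1 \<and> P w2 \<and> M = add_mset (w1, w2) K)) :: complex)"
      by (intro arg_cong[of _ _ sum_mset] image_mset_cong arg_cong[of _ _ of_bool]) blast
    also have "\<dots> = (if \<not> P w1 \<and> P w2 \<and> M = add_mset (w1, w2) K then of_nat (count K (w1, w2) + 1) else 0)"
      unfolding * by (auto split: if_splits)
    finally show ?thesis .
  qed
  ultimately show ?thesis
    by (simp add: gr_op_def lookup_add)
qed

lemma lookup_gr_op:
  assumes "\<And>M. M \<in> Poly_Mapping.keys f \<Longrightarrow> size K < size M \<or> K = {#}"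
  shows "Poly_Mapping.lookup (gr_op P k w1 w2 f) K
    = (if \<not> P w1 \<and> P w2 then of_nat (count K (w1, w2) + 1) * Poly_Mapping.lookup f (add_mset (w1, w2) K) else 0)"
proof -
  have f: "f = (\<Sum>M\<in>Poly_Mapping.keys f. Poly_Mapping.single M (Poly_Mapping.lookup f M))"
    by (rule poly_mapping_eqI) (simp add: lookup_sum lookup_single when_def in_keys_iff)
  have "Poly_Mapping.lookup (gr_op P k w1 w2 f) K
     = (\<Sum>M\<in>Poly_Mapping.keys f. Poly_Mapping.lookup (gr_op P k w1 w2 (Poly_Mapping.single M (Poly_Mapping.lookup f M))) K)"
    by (subst f, simp only: gr_op_sum lookup_sum)
  also have "\<dots> = (\<Sum>M\<in>Poly_Mapping.keys f. if M = add_mset (w1, w2) K then if \<not> P w1 \<and> P w2 then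
       Poly_Mapping.lookup f M * of_nat (count K (w1, w2) + 1) else 0 else 0)"
    by (rule sum.cong[OF refl]) (use assms in \<open>auto simp: lookup_gr_op_monomial\<close>)
  finally show ?thesis by (auto simp: in_keys_iff)
qed

text \<open>To carry an index of the half to one outside it, a mode of degree \<open>i\<close> needs
  a jump of the cut exceeding \<open>i\<close>; for \<open>N \<le> i\<close> there is none. The
  condition \<open>0 < N\<close> keeps away from degree 0, where \<open>cut_trace\<close>
  lives.\<close>

definition vacuum_cut :: "nat \<Rightarrow> (nat \<Rightarrow> int) \<Rightarrow> int \<Rightarrow> bool" where
  "vacuum_cut n \<kappa> N \<longleftrightarrow> 0 < N \<and> (\<forall>a<2*n. \<forall>b<2*n. \<kappa> a - \<kappa> b \<le> N)"

lemma lookup_loop_op: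
  assumes "\<And>M. M \<in> Poly_Mapping.keys f \<Longrightarrow> size K < size M \<or> K = {#}"
  shows "\<exists>B. \<forall>C\<ge>B. Poly_Mapping.lookup (loop_op \<kappa> k N x i f) K
    = (\<Sum>q\<in>{-C..C}. \<Sum>a<N. \<Sum>b<N. if q + i < \<kappa> a \<and> \<kappa> b \<le> q then
        x a b * (of_nat (count K ((a, q + i), (b, q)) + 1) * Poly_Mapping.lookup f (add_mset ((a, q + i), (b, q)) K)) else 0)"
proof -
  obtain B where B: "\<forall>C\<ge>B. loop_op \<kappa> k N x i f = (\<Sum>q\<in>{- C..C}. loop_summand \<kappa> k N x i f q)"
    using loop_op_windows by blast
  show ?thesis
    by (rule exI[of _ B]) (auto simp: B loop_summand_def lookup_sum lookup_scale lookup_gr_op[OF assms] not_le intro!: sum.cong)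
qed

lemma rep_op_vacuum:
  assumes "vacuum_cut n \<kappa> N" "N \<le> i"
  shows "Poly_Mapping.lookup (rep_op \<kappa> k n (Loop x i) f) {#} = 0"
proof -
  obtain B where B: "\<forall>C\<ge>B. Poly_Mapping.lookup (loop_op \<kappa> k (2*n) (\<lambda>a b. x $$ (a, b)) i f) {#}
    = (\<Sum>q\<in>{-C..C}. \<Sum>a<2*n. \<Sum>b<2*n. if q + i < \<kappa> a \<and> \<kappa> b \<le> q then
        x $$ (a, b) * (of_nat (count {#} ((a, q + i), (b, q)) + 1) * Poly_Mapping.lookup f (add_mset ((a, q + i), (b, q)) {#})) else 0)"
    using lookup_loop_op[of f "{#}" \<kappa> k "2*n" "\<lambda>a b. x $$ (a, b)" i] by auto
  have "\<not> (q + i < \<kappa> a \<and> \<kappa> b \<le> q)" if "a < 2 * n" "b < 2 * n" for a b q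
    using assms that by (force simp: vacuum_cut_def)
  then have "Poly_Mapping.lookup (loop_op \<kappa> k (2*n) (\<lambda>a b. x $$ (a, b)) i f) {#} = 0"
    by (subst B[rule_format, OF order_refl]) (intro sum.neutral ballI, force)
  moreover have "i \<noteq> 0" using assms by (auto simp: vacuum_cut_def)
  ultimately show ?thesis by (simp add: cut_trace_def)
qed

lemma rep_nbhd:
  assumes "f \<in> aff_nbhd n k N" "vacuum_cut n \<kappa> N"
  shows "Poly_Mapping.lookup (rep \<kappa> (of_nat k) n f h) {#} = 0"
  using assms
  by (induction rule: aff_nbhd.induct) (simp_all add: rep_ideal rep_add rep_mult rep_gen lookup_add rep_op_vacuum del: rep_op.simps)

lemma nonneg_Reals_sum_I: "(\<And>i. i \<in> I \<Longrightarrow> f i \<in> nonneg_Reals) \<Longrightarrow> (\<Sum>i\<in>I. f i) \<in> (nonneg_Reals :: complex set)"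
  by (induction I rule: infinite_finite_induct) auto

lemma nonneg_Reals_sum_nonzero:
  fixes f :: "'i \<Rightarrow> complex"
  assumes "finite I" "\<And>i. i \<in> I \<Longrightarrow> f i \<in> nonneg_Reals" "i \<in> I" "f i \<noteq> 0"
  shows "(\<Sum>i\<in>I. f i) \<noteq> 0"
proof
  assume "(\<Sum>i\<in>I. f i) = 0"
  then have "(\<Sum>i\<in>I. Re (f i)) = 0" by (metis Re_sum zero_complex.sel(1))
  then have "Re (f i) = 0"
    using assms by (subst (asm) sum_nonneg_eq_0_iff) (auto simp: complex_nonneg_Reals_iff)
  then show False
    using assms by (metis complex_eq_iff complex_nonneg_Reals_iff zero_complex.sel)
qed

text \<open>Only the lowest order is controlled: a loop operator lowers degrees by at most one, and
  only its lowering part has a sign.\<close>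

definition positive_order :: "nat \<Rightarrow> 'v pol \<Rightarrow> bool" where
  "positive_order d f \<longleftrightarrow> (\<forall>M\<in>Poly_Mapping.keys f. d \<le> size M) \<and> (\<forall>M. size M = d \<longrightarrow> Poly_Mapping.lookup f M \<in> nonneg_Reals)"

text \<open>To lowest order the operator is a sum of partial derivatives with nonnegative
  coefficients \<open>x a b\<close>, so a single nonzero contribution cannot be cancelled.\<close>

lemma loop_op_positive_order:
  assumes f: "positive_order (Suc d) f" and x: "\<And>a b. a < N \<Longrightarrow> b < N \<Longrightarrow> x a b \<in> nonneg_Reals"
  shows "positive_order d (loop_op \<kappa> k N x i f)"
    and "a < N \<Longrightarrow> b < N \<Longrightarrow> x a b \<noteq> 0 \<Longrightarrow> q + i < \<kappa> a \<Longrightarrow> \<kappa> b \<le> q \<Longrightarrow> size K = d \<Longrightarrow>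
      Poly_Mapping.lookup f (add_mset ((a, q + i), (b, q)) K) \<noteq> 0 \<Longrightarrow> Poly_Mapping.lookup (loop_op \<kappa> k N x i f) K \<noteq> 0"
proof -
  define t where "t = (\<lambda>K q a b. if q + i < \<kappa> a \<and> \<kappa> b \<le> q then
        x a b * (of_nat (count K ((a, q + i), (b, q)) + 1) * Poly_Mapping.lookup f (add_mset ((a, q + i), (b, q)) K)) else 0)"
  have K: "\<exists>B. \<forall>C\<ge>B. Poly_Mapping.lookup (loop_op \<kappa> k N x i f) K = (\<Sum>q\<in>{-C..C}. \<Sum>a<N. \<Sum>b<N. t K q a b)" if "size K \<le> d" for K
    unfolding t_def by (rule lookup_loop_op) (use f that in \<open>auto simp: positive_order_def Suc_le_eq\<close>)
  have pos: "t K q a b \<in> nonneg_Reals" if "size K = d" "a < N" "b < N" for K q a b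
    using f x that by (auto simp: t_def positive_order_def intro!: nonneg_Reals_mult_I nonneg_Reals_add_I nonneg_Reals_of_nat_I)
  show "positive_order d (loop_op \<kappa> k N x i f)"
    unfolding positive_order_def
  proof (intro conjI ballI allI impI)
    fix M assume M: "M \<in> Poly_Mapping.keys (loop_op \<kappa> k N x i f)"
    show "d \<le> size M"
    proof (rule ccontr)
      assume d: "\<not> d \<le> size M"
      have "t M q a b = 0" for q a b
        using f d by (force simp: t_def positive_order_def in_keys_iff)
      then show False using K[of M] d M by (auto simp: in_keys_iff)
    qed
  next
    fix M :: "((nat \<times> int) \<times> nat \<times> int) multiset" assume "size M = d"
    then show "Poly_Mapping.lookup (loop_op \<kappa> k N x i f) M \<in> nonneg_Reals"
      using K[of M] pos[of M] by (force intro!: nonneg_Reals_sum_I)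
  qed
  assume a: "a < N" "b < N" "x a b \<noteq> 0" "q + i < \<kappa> a" "\<kappa> b \<le> q" and d: "size K = d"
    and nz: "Poly_Mapping.lookup f (add_mset ((a, q + i), (b, q)) K) \<noteq> 0"
  obtain B where B: "\<forall>C\<ge>B. Poly_Mapping.lookup (loop_op \<kappa> k N x i f) K = (\<Sum>q\<in>{-C..C}. \<Sum>a<N. \<Sum>b<N. t K q a b)"
    using K[of K] d by auto
  define C where "C = max B \<bar>q\<bar>"
  have q: "q \<in> {-C..C}" by (auto simp: C_def)
  have "t K q a b \<noteq> 0" using a nz by (simp add: t_def flip: of_nat_Suc)
  then have "(\<Sum>b<N. t K q a b) \<noteq> 0"
    by (intro nonneg_Reals_sum_nonzero[of _ _ b]) (use a d pos in auto)
  then have "(\<Sum>a<N. \<Sum>b<N. t K q a b) \<noteq> 0"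
    by (intro nonneg_Reals_sum_nonzero[where i = a and f = "\<lambda>a. \<Sum>b<N. t K q a b"]) (use a d pos in \<open>auto intro: nonneg_Reals_sum_I\<close>)
  then have "(\<Sum>q\<in>{-C..C}. \<Sum>a<N. \<Sum>b<N. t K q a b) \<noteq> 0"
    by (intro nonneg_Reals_sum_nonzero[OF _ _ q]) (use d pos in \<open>auto intro!: nonneg_Reals_sum_I\<close>)
  then show "Poly_Mapping.lookup (loop_op \<kappa> k N x i f) K \<noteq> 0"
    using B[rule_format, of C] by (simp add: C_def)
qed

text \<open>Every factor uses up one order, so the constant term is reached exactly after all of
  \<open>js\<close>. The zero diagonal makes \<open>cut_trace\<close> vanish, and the factors act by
  \<open>loop_op\<close> alone.\<close>

lemma fold_rep_op_positive:
  assumes pos: "positive_order (length js) f" and x: "\<And>a b. a < 2 * n \<Longrightarrow> b < 2 * n \<Longrightarrow> x $$ (a, b) \<in> nonneg_Reals"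
    and diag: "\<And>a. a < 2 * n \<Longrightarrow> x $$ (a, a) = 0" and b: "b < 2 * n" and a: "a < 2 * n" and "x $$ (a, b) \<noteq> 0"
  shows "Poly_Mapping.lookup (fold (rep_op \<kappa> k n) (map (Loop x) js) f) {#} \<in> nonneg_Reals"
    and "\<forall>j\<in>set js. j < \<kappa> a \<Longrightarrow> \<kappa> b \<le> 0 \<Longrightarrow> Poly_Mapping.lookup f (mset (map (\<lambda>j. ((a, j), (b, 0))) js)) \<noteq> 0 \<Longrightarrow>
      Poly_Mapping.lookup (fold (rep_op \<kappa> k n) (map (Loop x) js) f) {#} \<noteq> 0"
  using pos
proof (induction js arbitrary: f)
  case Nil
  {
    case 1
    then show ?case by (simp add: positive_order_def)
  next
    case 2
    then show ?case by simp
  }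
next
  case (Cons j js)
  have ct: "cut_trace \<kappa> n x j = 0" using diag by (simp add: cut_trace_def)
  {
    case (1 f)
    let ?f = "loop_op \<kappa> k (2 * n) (\<lambda>a b. x $$ (a, b)) j f"
    from 1 have "positive_order (length js) ?f" using x by (intro loop_op_positive_order) auto
    then show ?case using Cons.IH(1)[of ?f] by (simp add: ct)
  next
    case (2 f)
    let ?f = "loop_op \<kappa> k (2 * n) (\<lambda>a b. x $$ (a, b)) j f"
    from 2 have "positive_order (length js) ?f" using x by (intro loop_op_positive_order) auto
    moreover have "Poly_Mapping.lookup ?f (mset (map (\<lambda>j. ((a, j), (b, 0))) js)) \<noteq> 0"
      by (rule loop_op_positive_order(2)[where a = a and b = b and q = 0 and d = "length js"]) (use 2 assms in auto)
    ultimately show ?case using Cons.IH(2)[of ?f] 2 by (simp add: ct)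
  }
qed

lemma rep_prod_gens:
  "rep \<kappa> k n (prod_list (map gen gs)) h = fold (rep_op \<kappa> k n) gs h"
  by (induction gs arbitrary: h) (simp_all add: rep_one rep_mult rep_gen del: rep_op.simps)

text \<open>The test monomial has one coordinate for each degree of \<open>js0\<close>. The product
  for \<open>js0\<close> differentiates it to a nonzero constant, and all other products of this
  length contribute nonnegative constants.\<close>

lemma positive_sum_not_in_nbhd:
  assumes x: "\<And>a b. a < 2 * n \<Longrightarrow> b < 2 * n \<Longrightarrow> x $$ (a, b) \<in> nonneg_Reals" "\<And>a. a < 2 * n \<Longrightarrow> x $$ (a, a) = 0"
    and ab: "a < 2 * n" "b < 2 * n" "x $$ (a, b) \<noteq> 0"
  shows "\<exists>N. \<forall>I. finite I \<and> js0 \<in> I \<and> (\<forall>js\<in>I. length js = length js0) \<longrightarrow>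
    (\<Sum>js\<in>I. prod_list (map (\<lambda>j. gen (Loop x j)) js)) \<notin> aff_nbhd n k N"
proof -
  have "a \<noteq> b" using assms by auto
  define m where "m = Max (insert 0 (set js0)) + 1"
  \<comment> \<open>Raising the cut at \<open>a\<close> alone puts \<open>(a, j)\<close> outside the
    half for every \<open>j\<close> in \<open>js0\<close> and leaves \<open>(b, 0)\<close> inside,
    so these pairs are true coordinates.\<close>
  define \<kappa> where "\<kappa> c = (if c = a then m else 0)" for c
  have m: "j < m" if "j \<in> set js0" for j
    using that Max_ge[of "insert 0 (set js0)" j] by (simp add: m_def)
  have "0 < m" using Max_ge[of "insert 0 (set js0)" 0] by (simp add: m_def)
  then have cut: "vacuum_cut n \<kappa> m" by (auto simp: vacuum_cut_def \<kappa>_def)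
  let ?M = "mset (map (\<lambda>j. ((a, j), (b, 0))) js0)"
  define h :: fock where "h = Poly_Mapping.single ?M 1"
  have h: "positive_order (length js0) h"
    unfolding positive_order_def h_def by (simp add: lookup_single when_def)
  show ?thesis
  proof (intro exI[of _ m] allI impI notI)
    fix I assume I: "finite I \<and> js0 \<in> I \<and> (\<forall>js\<in>I. length js = length js0)"
      and nb: "(\<Sum>js\<in>I. prod_list (map (\<lambda>j. gen (Loop x j)) js)) \<in> aff_nbhd n k m"
    from rep_nbhd[OF nb cut] have "Poly_Mapping.lookup (rep \<kappa> (of_nat k) n (\<Sum>js\<in>I. prod_list (map (\<lambda>j. gen (Loop x j)) js)) h) {#} = 0"
      .
    moreover have "prod_list (map (\<lambda>j. gen (Loop x j)) js) = prod_list (map gen (map (Loop x) js))" for js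
      by (simp only: list.map_comp o_def)
    ultimately have "(\<Sum>js\<in>I. Poly_Mapping.lookup (fold (rep_op \<kappa> (of_nat k) n) (map (Loop x) js) h) {#}) = 0"
      by (simp only: rep_sum lookup_sum rep_prod_gens)
    moreover have "(\<Sum>js\<in>I. Poly_Mapping.lookup (fold (rep_op \<kappa> (of_nat k) n) (map (Loop x) js) h) {#}) \<noteq> 0"
    proof (rule nonneg_Reals_sum_nonzero[of _ _ js0])
      show "Poly_Mapping.lookup (fold (rep_op \<kappa> (of_nat k) n) (map (Loop x) js) h) {#} \<in> nonneg_Reals" if "js \<in> I" for js
      proof -
        have "length js = length js0" using I that by blast
        then show ?thesis by (intro fold_rep_op_positive(1)[where a = a and b = b]) (use x ab h in auto)
      qed
      show "Poly_Mapping.lookup (fold (rep_op \<kappa> (of_nat k) n) (map (Loop x) js0) h) {#} \<noteq> 0"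
        by (rule fold_rep_op_positive(2)[where a = a and b = b]) (use x ab h m \<open>a \<noteq> b\<close> in \<open>auto simp: \<kappa>_def h_def\<close>)
    qed (use I in blast)+
    ultimately show False by contradiction
  qed
qed

section \<open>Calculus in the affine algebra\<close>

lemma free_alg_zero [simp]: "0 \<in> free_alg S"
  by (simp add: free_alg_def)

lemma free_alg_one [simp]: "1 \<in> free_alg S"
  by (simp add: free_alg_def zero_fmon_def)

lemma free_alg_scal [simp]: "scal c \<in> free_alg S"
  by (simp add: free_alg_def scal_def zero_fmon_def)

lemma free_alg_gen: "s \<in> S \<Longrightarrow> gen s \<in> free_alg S"
  by (simp add: free_alg_def gen_def)

lemma free_alg_add: "f \<in> free_alg S \<Longrightarrow> g \<in> free_alg S \<Longrightarrow> f + g \<in> free_alg S"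
  using Poly_Mapping.keys_add[of f g] by (auto simp: free_alg_def)

lemma free_alg_uminus: "f \<in> free_alg S \<Longrightarrow> - f \<in> free_alg S"
  by (simp add: free_alg_def in_keys_iff)

lemma free_alg_minus: "f \<in> free_alg S \<Longrightarrow> g \<in> free_alg S \<Longrightarrow> f - g \<in> free_alg S"
  using free_alg_add[of f S "- g"] by (simp add: free_alg_uminus)

lemma free_alg_mult: "f \<in> free_alg S \<Longrightarrow> g \<in> free_alg S \<Longrightarrow> f * g \<in> free_alg S"
  using Poly_Mapping.keys_mult[of f g] by (fastforce simp: free_alg_def plus_fmon_def)

lemma free_alg_prod_list: "(\<And>f. f \<in> set fs \<Longrightarrow> f \<in> free_alg S) \<Longrightarrow> prod_list fs \<in> free_alg S"
  by (induction fs) (auto intro: free_alg_mult)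

lemma free_alg_sum: "(\<And>i. i \<in> I \<Longrightarrow> f i \<in> free_alg S) \<Longrightarrow> (\<Sum>i\<in>I. f i) \<in> free_alg S"
  by (induction I rule: infinite_finite_induct) (auto intro: free_alg_add)

lemma scal_mult_scal: "scal a * (scal b * f) = scal (a * b) * f"
  by (simp add: scal_def mult_single flip: mult.assoc)

lemma scal_left_comm: "g * (scal c * f) = scal c * (g * f)"
  by (simp add: scal_def scale_left_comm)

lemma scal_1 [simp]: "scal 1 = 1"
  by (simp add: scal_def)

lemma scal_0 [simp]: "scal 0 = 0"
  by (simp add: scal_def)

lemma scal_add: "scal (a + b) = scal a + scal b"
  by (simp add: scal_def single_add)

lemma scal_uminus: "scal (- a) = - scal a"
  by (simp add: scal_def single_uminus)

lemma scal_sum: "scal (\<Sum>i\<in>I. c i) = (\<Sum>i\<in>I. scal (c i))"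
  by (induction I rule: infinite_finite_induct) (auto simp: scal_add)

lemma loop_gen_free [simp]: "x \<in> sp n \<Longrightarrow> gen (Loop x i) \<in> free_alg (aff_gens n)"
  by (rule free_alg_gen) (auto simp: aff_gens_def)

lemma ideal_add:
  assumes "f \<in> aff_ideal n k" "g \<in> aff_ideal n k" shows "f + g \<in> aff_ideal n k"
  using assms(2)
proof (induction rule: aff_ideal.induct)
  case (step g p q \<rho>)
  then show ?case by (metis add.assoc aff_ideal.step)
qed (use assms in simp)

lemma ideal_lmult:
  assumes "f \<in> aff_ideal n k" "p \<in> free_alg (aff_gens n)" shows "p * f \<in> aff_ideal n k"
  using assms
proof (induction rule: aff_ideal.induct)
  case (step f q r \<rho>)
  then have "p * f + (p * q) * \<rho> * r \<in> aff_ideal n k"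
    by (intro aff_ideal.step free_alg_mult) auto
  then show ?case by (simp add: distrib_left mult.assoc)
qed (auto intro: aff_ideal.zero)

lemma ideal_rmult:
  assumes "f \<in> aff_ideal n k" "p \<in> free_alg (aff_gens n)" shows "f * p \<in> aff_ideal n k"
  using assms
proof (induction rule: aff_ideal.induct)
  case (step f q r \<rho>)
  then have "f * p + q * \<rho> * (r * p) \<in> aff_ideal n k"
    by (intro aff_ideal.step free_alg_mult) auto
  then show ?case by (simp add: distrib_right mult.assoc)
qed (auto intro: aff_ideal.zero)

lemma ideal_scal: "f \<in> aff_ideal n k \<Longrightarrow> scal c * f \<in> aff_ideal n k"
  by (rule ideal_lmult) auto

lemma ideal_uminus: "f \<in> aff_ideal n k \<Longrightarrow> - f \<in> aff_ideal n k"
  using ideal_scal[of f n k "-1"] by (simp add: scal_uminus)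

lemma ideal_minus: "f \<in> aff_ideal n k \<Longrightarrow> g \<in> aff_ideal n k \<Longrightarrow> f - g \<in> aff_ideal n k"
  using ideal_add[of f n k "- g"] ideal_uminus[of g] by simp

lemma ideal_sum: "(\<And>i. i \<in> I \<Longrightarrow> f i \<in> aff_ideal n k) \<Longrightarrow> (\<Sum>i\<in>I. f i) \<in> aff_ideal n k"
  by (induction I rule: infinite_finite_induct) (auto intro: aff_ideal.zero ideal_add)

lemma ideal_relator: "\<rho> \<in> aff_relators n k \<Longrightarrow> \<rho> \<in> aff_ideal n k"
  using aff_ideal.step[OF aff_ideal.zero free_alg_one free_alg_one] by simp

definition aff_eq :: "nat \<Rightarrow> nat \<Rightarrow> aff_alg \<Rightarrow> aff_alg \<Rightarrow> bool" where
  "aff_eq n k f g \<longleftrightarrow> f - g \<in> aff_ideal n k"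

lemma aff_eq_refl [simp]: "aff_eq n k f f"
  by (simp add: aff_eq_def aff_ideal.zero)

lemma aff_eq_sym: "aff_eq n k f g \<Longrightarrow> aff_eq n k g f"
  unfolding aff_eq_def using ideal_uminus by fastforce

lemma aff_eq_trans [trans]: "aff_eq n k f g \<Longrightarrow> aff_eq n k g h \<Longrightarrow> aff_eq n k f h"
  unfolding aff_eq_def using ideal_add by fastforce

lemma aff_eq_add: "aff_eq n k f f' \<Longrightarrow> aff_eq n k g g' \<Longrightarrow> aff_eq n k (f + g) (f' + g')"
  unfolding aff_eq_def using ideal_add[of "f - f'" n k "g - g'"] by (simp add: algebra_simps)

lemma aff_eq_sum: "(\<And>i. i \<in> I \<Longrightarrow> aff_eq n k (f i) (g i)) \<Longrightarrow> aff_eq n k (\<Sum>i\<in>I. f i) (\<Sum>i\<in>I. g i)"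
  unfolding aff_eq_def using ideal_sum[of I "\<lambda>i. f i - g i"] by (simp add: sum_subtractf)

lemma aff_eq_scal: "aff_eq n k f g \<Longrightarrow> aff_eq n k (scal c * f) (scal c * g)"
  unfolding aff_eq_def using ideal_scal[of "f - g"] by (simp add: algebra_simps)

lemma aff_eq_lmult: "aff_eq n k f g \<Longrightarrow> p \<in> free_alg (aff_gens n) \<Longrightarrow> aff_eq n k (p * f) (p * g)"
  unfolding aff_eq_def using ideal_lmult[of "f - g"] by (simp add: algebra_simps)

lemma aff_eq_rmult: "aff_eq n k f g \<Longrightarrow> p \<in> free_alg (aff_gens n) \<Longrightarrow> aff_eq n k (f * p) (g * p)"
  unfolding aff_eq_def using ideal_rmult[of "f - g"] by (simp add: algebra_simps)

text \<open>The ideal is stable under factors from \<open>free_alg (aff_gens n)\<close>; the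
  intermediate product is \<open>f' * g\<close>, hence the conditions on these two.\<close>

lemma aff_eq_mult:
  assumes "aff_eq n k f f'" "aff_eq n k g g'" "g \<in> free_alg (aff_gens n)" "f' \<in> free_alg (aff_gens n)"
  shows "aff_eq n k (f * g) (f' * g')"
  using assms by (meson aff_eq_lmult aff_eq_rmult aff_eq_trans)

lemma aff_eq_add_right: "x \<in> sp n \<Longrightarrow> y \<in> sp n \<Longrightarrow> aff_eq n k (gen (Loop (x + y) i)) (gen (Loop x i) + gen (Loop y i))"
  unfolding aff_eq_def by (intro ideal_relator aff_relators.add)

lemma aff_eq_smult: "x \<in> sp n \<Longrightarrow> aff_eq n k (gen (Loop (z \<cdot>\<^sub>m x) i)) (scal z * gen (Loop x i))"
  unfolding aff_eq_def by (intro ideal_relator aff_relators.smult)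

lemma aff_eq_comm:
  assumes "x \<in> sp n" "y \<in> sp n" "i + j \<noteq> 0 \<or> i = 0 \<or> inv_form n x y = 0"
  shows "aff_eq n k (gen (Loop x i) * gen (Loop y j))
    (gen (Loop y j) * gen (Loop x i) + gen (Loop (bracket x y) (i + j)))"
proof -
  have "(if i + j = 0 then scal (of_int i * inv_form n x y) * gen Cent else 0) = 0"
    using assms(3) by auto
  then show ?thesis
    using ideal_relator[OF aff_relators.comm[OF assms(1,2), of i j k]]
    by (simp add: aff_eq_def algebra_simps)
qed

section \<open>The symplectic Lie algebra in matrix entries\<close>

lemma symp_form_carrier [simp]: "symp_form n \<in> carrier_mat (2 * n) (2 * n)"
  unfolding symp_form_def mult_2 by (rule four_block_carrier_mat) auto

lemma symp_form_dim [simp]: "dim_row (symp_form n) = 2 * n" "dim_col (symp_form n) = 2 * n"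
  by (rule carrier_matD[OF symp_form_carrier])+

text \<open>Position \<open>a < n\<close> has weight \<open>\<epsilon>\<^sub>a\<^sub>+\<^sub>1\<close>, and \<open>dual n a\<close> is the position of opposite weight.\<close>

definition dual :: "nat \<Rightarrow> nat \<Rightarrow> nat" where
  "dual n a = (if a < n then a + n else a - n)"

definition sgn_pos :: "nat \<Rightarrow> nat \<Rightarrow> complex" where
  "sgn_pos n a = (if a < n then 1 else - 1)"

lemma dual_less: "a < 2 * n \<Longrightarrow> dual n a < 2 * n"
  and dual_dual: "a < 2 * n \<Longrightarrow> dual n (dual n a) = a"
  and sgn_pos_dual: "a < 2 * n \<Longrightarrow> sgn_pos n (dual n a) = - sgn_pos n a"
  and sgn_pos_sq: "sgn_pos n a * sgn_pos n a = 1"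
  and sgn_pos_nz: "sgn_pos n a \<noteq> 0"
  by (auto simp: dual_def sgn_pos_def)

lemma symp_form_entry: "a < 2 * n \<Longrightarrow> b < 2 * n \<Longrightarrow> symp_form n $$ (a, b) = (if b = dual n a then sgn_pos n a else 0)"
  by (auto simp: symp_form_def dual_def sgn_pos_def)

text \<open>The condition says that \<open>symp_form n * x\<close> is a symmetric matrix; this is
  the identification with symmetric tensors in coordinates.\<close>

lemma sp_iff:
  "x \<in> sp n \<longleftrightarrow> x \<in> carrier_mat (2 * n) (2 * n) \<and>
    (\<forall>a<2 * n. \<forall>b<2 * n. sgn_pos n a * x $$ (dual n a, b) = sgn_pos n b * x $$ (dual n b, a))"
proof (cases "x \<in> carrier_mat (2 * n) (2 * n)")
  case True
  have l: "(transpose_mat x * symp_form n) $$ (a, b) = - (sgn_pos n b * x $$ (dual n b, a))" if "a < 2 * n" "b < 2 * n" for a b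
  proof -
    have "(transpose_mat x * symp_form n) $$ (a, b) = (\<Sum>c<2*n. transpose_mat x $$ (a, c) * symp_form n $$ (c, b))"
      by (rule mult_entry) (use True that in auto)
    also have "\<dots> = (\<Sum>c<2*n. if c = dual n b then x $$ (c, a) * sgn_pos n c else 0)"
      by (rule sum.cong[OF refl]) (use True that in \<open>auto simp: symp_form_entry dual_dual\<close>)
    finally show ?thesis using that by (simp add: dual_less sgn_pos_dual)
  qed
  have r: "(symp_form n * x) $$ (a, b) = sgn_pos n a * x $$ (dual n a, b)" if "a < 2 * n" "b < 2 * n" for a b
  proof -
    have "(symp_form n * x) $$ (a, b) = (\<Sum>c<2*n. symp_form n $$ (a, c) * x $$ (c, b))"
      by (rule mult_entry) (use True that in auto)
    also have "\<dots> = (\<Sum>c<2*n. if c = dual n a then sgn_pos n a * x $$ (c, b) else 0)"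
      by (rule sum.cong[OF refl]) (use True that in \<open>auto simp: symp_form_entry\<close>)
    finally show ?thesis using that by (simp add: dual_less)
  qed
  have "x \<in> sp n \<longleftrightarrow> (\<forall>a<2 * n. \<forall>b<2 * n. (transpose_mat x * symp_form n) $$ (a, b) + (symp_form n * x) $$ (a, b) = 0)"
  proof
    assume "x \<in> sp n"
    then have e: "transpose_mat x * symp_form n + symp_form n * x = 0\<^sub>m (2 * n) (2 * n)" by (simp add: sp_def)
    show "\<forall>a<2 * n. \<forall>b<2 * n. (transpose_mat x * symp_form n) $$ (a, b) + (symp_form n * x) $$ (a, b) = 0"
    proof (intro allI impI)
      fix a b assume ab: "a < 2 * n" "b < 2 * n"
      have "(transpose_mat x * symp_form n + symp_form n * x) $$ (a, b)
        = (transpose_mat x * symp_form n) $$ (a, b) + (symp_form n * x) $$ (a, b)"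
        using True ab symp_form_carrier[of n] by (intro index_add_mat) auto
      then show "(transpose_mat x * symp_form n) $$ (a, b) + (symp_form n * x) $$ (a, b) = 0"
        using ab by (simp add: e)
    qed
  next
    assume e: "\<forall>a<2 * n. \<forall>b<2 * n. (transpose_mat x * symp_form n) $$ (a, b) + (symp_form n * x) $$ (a, b) = 0"
    have "transpose_mat x * symp_form n + symp_form n * x = 0\<^sub>m (2 * n) (2 * n)"
      by (rule eq_matI) (use True e symp_form_carrier[of n] in \<open>auto simp del: index_mult_mat(1)\<close>)
    then show "x \<in> sp n" using True by (simp add: sp_def)
  qed
  also have "\<dots> \<longleftrightarrow> (\<forall>a<2 * n. \<forall>b<2 * n. - (sgn_pos n b * x $$ (dual n b, a)) + sgn_pos n a * x $$ (dual n a, b) = 0)"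
    by (auto simp: l r simp del: index_mult_mat)
  also have "\<dots> \<longleftrightarrow> (\<forall>a<2 * n. \<forall>b<2 * n. sgn_pos n a * x $$ (dual n a, b) = sgn_pos n b * x $$ (dual n b, a))"
    by simp
  finally show ?thesis using True by simp
qed (simp add: sp_def)

lemma sp_zero: "0\<^sub>m (2 * n) (2 * n) \<in> sp n"
  by (auto simp: sp_iff dual_less)

lemma sp_add: "x \<in> sp n \<Longrightarrow> y \<in> sp n \<Longrightarrow> x + y \<in> sp n"
  by (auto simp: sp_iff dual_less distrib_left)

lemma sp_smult: "x \<in> sp n \<Longrightarrow> z \<cdot>\<^sub>m x \<in> sp n"
  by (auto simp: sp_iff dual_less mult.left_commute)

lemma bracket_sp:
  assumes "x \<in> sp n" "y \<in> sp n" shows "bracket x y \<in> sp n"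
proof -
  have c: "x \<in> carrier_mat (2*n) (2*n)" "y \<in> carrier_mat (2*n) (2*n)" using assms by (auto dest: spD)
  \<comment> \<open>Using the symmetry once for each factor moves the form across the product and
    exchanges the factors with a minus sign, so the commutator is symmetric again.\<close>
  have key: "sgn_pos n a * (\<Sum>c<2*n. x $$ (dual n a, c) * y $$ (c, b)) = - (sgn_pos n b * (\<Sum>c<2*n. y $$ (dual n b, c) * x $$ (c, a)))"
    if "a < 2*n" "b < 2*n" "x \<in> sp n" "y \<in> sp n" for a b x y
  proof -
    have "sgn_pos n a * (\<Sum>c<2*n. x $$ (dual n a, c) * y $$ (c, b)) = (\<Sum>c<2*n. (sgn_pos n a * x $$ (dual n a, c)) * y $$ (c, b))"
      by (simp add: sum_distrib_left mult.assoc)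
    also have "\<dots> = (\<Sum>c<2*n. - sgn_pos n b * (y $$ (dual n b, dual n c) * x $$ (dual n c, a)))"
    proof (rule sum.cong[OF refl])
      fix c assume "c \<in> {..<2*n}"
      then have c: "c < 2*n" by simp
      have 1: "sgn_pos n a * x $$ (dual n a, c) = sgn_pos n c * x $$ (dual n c, a)" using that c by (auto simp: sp_iff)
      have 2: "sgn_pos n (dual n c) * y $$ (dual n (dual n c), b) = sgn_pos n b * y $$ (dual n b, dual n c)"
        using that dual_less[OF c] by (auto simp: sp_iff)
      have "sgn_pos n c * y $$ (c, b) = - (sgn_pos n b * y $$ (dual n b, dual n c))"
        using 2 c by (simp add: dual_dual sgn_pos_dual) (metis minus_minus mult_minus_left)
      moreover have "sgn_pos n c * x $$ (dual n c, a) * y $$ (c, b) = (sgn_pos n c * y $$ (c, b)) * x $$ (dual n c, a)"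
        by (simp only: ac_simps)
      ultimately show "sgn_pos n a * x $$ (dual n a, c) * y $$ (c, b) = - sgn_pos n b * (y $$ (dual n b, dual n c) * x $$ (dual n c, a))"
        unfolding 1 by simp
    qed
    also have "\<dots> = (\<Sum>c<2*n. - sgn_pos n b * (y $$ (dual n b, c) * x $$ (c, a)))"
      by (rule sum.reindex_bij_witness[of _ "dual n" "dual n"]) (auto simp: dual_less dual_dual)
    finally show ?thesis by (simp add: sum_distrib_left sum_negf)
  qed
  show ?thesis
    unfolding sp_iff
  proof (intro conjI allI impI)
    show "bracket x y \<in> carrier_mat (2 * n) (2 * n)" using c unfolding bracket_def by (intro minus_carrier_mat mult_carrier_mat) auto
    fix a b assume ab: "a < 2 * n" "b < 2 * n"
    show "sgn_pos n a * bracket x y $$ (dual n a, b) = sgn_pos n b * bracket x y $$ (dual n b, a)"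
      using key[OF ab assms] key[OF ab assms(2,1)] ab
      by (simp add: bracket_entry[OF c] dual_less right_diff_distrib)
  qed
qed

text \<open>Lifts an equation between matrix entries to a congruence between generators; linear
  algebra in the Lie algebra passes to the affine algebra through it.\<close>

lemma aff_eq_gen_lincomb:
  assumes "finite F" "\<And>t. t \<in> F \<Longrightarrow> M t \<in> sp n" "x \<in> carrier_mat (2*n) (2*n)"
    "\<And>a b. a < 2*n \<Longrightarrow> b < 2*n \<Longrightarrow> x $$ (a, b) = (\<Sum>t\<in>F. c t * M t $$ (a, b))"
  shows "x \<in> sp n \<and> aff_eq n k (gen (Loop x i)) (\<Sum>t\<in>F. scal (c t) * gen (Loop (M t) i))"
  using assms
proof (induction F arbitrary: x rule: finite_induct)
  case empty
  have x: "x = 0\<^sub>m (2*n) (2*n)" by (rule eq_matI) (use empty in auto)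
  have "aff_eq n k (gen (Loop (0 \<cdot>\<^sub>m x) i)) (scal 0 * gen (Loop x i))"
    by (rule aff_eq_smult) (simp add: x sp_zero)
  moreover have "0 \<cdot>\<^sub>m x = x" unfolding x by (rule eq_matI) auto
  ultimately show ?case using sp_zero x by simp
next
  case (insert t F)
  define y where "y = mat (2*n) (2*n) (\<lambda>(a, b). \<Sum>t\<in>F. c t * M t $$ (a, b))"
  have y: "y \<in> sp n" "aff_eq n k (gen (Loop y i)) (\<Sum>t\<in>F. scal (c t) * gen (Loop (M t) i))"
    using insert.IH[of y] insert.prems(1) by (auto simp: y_def)
  have M: "M t \<in> sp n" "M t \<in> carrier_mat (2*n) (2*n)" using insert.prems(1) spD by auto
  have x: "x = c t \<cdot>\<^sub>m M t + y"
    by (rule eq_matI) (use insert.prems insert.hyps M in \<open>auto simp: y_def\<close>)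
  have "aff_eq n k (gen (Loop x i)) (gen (Loop (c t \<cdot>\<^sub>m M t) i) + gen (Loop y i))"
    unfolding x by (intro aff_eq_add_right sp_smult M y)
  also have "aff_eq n k \<dots> (scal (c t) * gen (Loop (M t) i) + (\<Sum>t\<in>F. scal (c t) * gen (Loop (M t) i)))"
    by (intro aff_eq_add aff_eq_smult M y)
  finally show ?case using insert.hyps x y M by (simp add: sp_add sp_smult)
qed

section \<open>The action of degree zero and the neighbourhoods of zero\<close>

lemma ad0_mult: "ad0 x (f * g) = ad0 x f * g + f * ad0 x g"
  by (simp add: ad0_def algebra_simps)

lemma ad0_add: "ad0 x (f + g) = ad0 x f + ad0 x g"
  and ad0_minus: "ad0 x (f - g) = ad0 x f - ad0 x g"
  and ad0_zero [simp]: "ad0 x 0 = 0"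
  and ad0_one [simp]: "ad0 x 1 = 0"
  by (simp_all add: ad0_def algebra_simps)

lemma ad0_scal: "ad0 x (scal c * f) = scal c * ad0 x f"
  unfolding ad0_def right_diff_distrib by (simp add: scal_left_comm mult.assoc)

lemma ad0_sum: "ad0 x (\<Sum>i\<in>I. f i) = (\<Sum>i\<in>I. ad0 x (f i))"
  by (induction I rule: infinite_finite_induct) (auto simp: ad0_add)

lemma ad0_ideal: "x \<in> sp n \<Longrightarrow> f \<in> aff_ideal n k \<Longrightarrow> ad0 x f \<in> aff_ideal n k"
  unfolding ad0_def by (intro ideal_minus ideal_lmult ideal_rmult) auto

lemma ad0_aff_eq: "x \<in> sp n \<Longrightarrow> aff_eq n k f g \<Longrightarrow> aff_eq n k (ad0 x f) (ad0 x g)"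
  unfolding aff_eq_def by (metis ad0_ideal ad0_minus)

lemma ad0_free: "x \<in> sp n \<Longrightarrow> f \<in> free_alg (aff_gens n) \<Longrightarrow> ad0 x f \<in> free_alg (aff_gens n)"
  unfolding ad0_def by (intro free_alg_minus free_alg_mult) auto

lemma ad0_gen: "x \<in> sp n \<Longrightarrow> y \<in> sp n \<Longrightarrow> aff_eq n k (ad0 x (gen (Loop y j))) (gen (Loop (bracket x y) j))"
  using aff_eq_comm[of x n y 0 j k] by (simp add: ad0_def aff_eq_def algebra_simps)

lemma nbhd_add:
  assumes "f \<in> aff_nbhd n k N" "g \<in> aff_nbhd n k N" shows "f + g \<in> aff_nbhd n k N"
  using assms(2)
proof (induction rule: aff_nbhd.induct)
  case (ideal g)
  from assms(1) show ?case
  proof (induction rule: aff_nbhd.induct)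
    case (ideal f)
    then show ?case using \<open>g \<in> aff_ideal n k\<close> by (simp add: aff_nbhd.ideal ideal_add)
  next
    case (step f p x i)
    then show ?case using aff_nbhd.step[of "f + g" n k N p x i] by (simp add: algebra_simps)
  qed
next
  case (step g p x i)
  then show ?case using aff_nbhd.step[of "f + g" n k N p x i] by (simp add: algebra_simps)
qed

lemma nbhd_zero [simp]: "0 \<in> aff_nbhd n k N"
  by (intro aff_nbhd.ideal aff_ideal.zero)

lemma nbhd_gen: "p \<in> free_alg (aff_gens n) \<Longrightarrow> x \<in> sp n \<Longrightarrow> N \<le> i \<Longrightarrow> p * gen (Loop x i) \<in> aff_nbhd n k N"
  using aff_nbhd.step[OF nbhd_zero] by fastforce

lemma nbhd_lmult:
  assumes "f \<in> aff_nbhd n k N" "p \<in> free_alg (aff_gens n)" shows "p * f \<in> aff_nbhd n k N"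
  using assms
proof (induction rule: aff_nbhd.induct)
  case (step f q x i)
  then have "p * f + (p * q) * gen (Loop x i) \<in> aff_nbhd n k N"
    by (intro aff_nbhd.step free_alg_mult) auto
  then show ?case by (simp add: algebra_simps)
qed (auto intro: aff_nbhd.ideal ideal_lmult)

lemma nbhd_uminus: "f \<in> aff_nbhd n k N \<Longrightarrow> - f \<in> aff_nbhd n k N"
  using nbhd_lmult[OF _ free_alg_scal, of f n k N "-1"] by (simp add: scal_uminus)

lemma nbhd_minus: "f \<in> aff_nbhd n k N \<Longrightarrow> g \<in> aff_nbhd n k N \<Longrightarrow> f - g \<in> aff_nbhd n k N"
  using nbhd_add[of f n k N "- g"] nbhd_uminus[of g] by simp

lemma nbhd_sum: "(\<And>i. i \<in> I \<Longrightarrow> f i \<in> aff_nbhd n k N) \<Longrightarrow> (\<Sum>i\<in>I. f i) \<in> aff_nbhd n k N"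
  by (induction I rule: infinite_finite_induct) (auto intro: nbhd_add)

lemma nbhd_aff_eq: "f \<in> aff_nbhd n k N \<Longrightarrow> aff_eq n k f g \<Longrightarrow> g \<in> aff_nbhd n k N"
  using nbhd_minus[of f n k N "f - g"] by (simp add: aff_eq_def aff_nbhd.ideal)

text \<open>By the Leibniz rule the rightmost factor of a generator either stays or becomes a
  bracket in the same degree, so these left ideals are invariant.\<close>

lemma nbhd_ad0:
  assumes "f \<in> aff_nbhd n k N" "x \<in> sp n" shows "ad0 x f \<in> aff_nbhd n k N"
  using assms
proof (induction rule: aff_nbhd.induct)
  case (ideal f)
  then show ?case by (intro aff_nbhd.ideal ad0_ideal)
next
  case (step f p y i)
  have "p * ad0 x (gen (Loop y i)) \<in> aff_nbhd n k N"
  proof (rule nbhd_aff_eq)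
    show "p * gen (Loop (bracket x y) i) \<in> aff_nbhd n k N"
      using step by (intro nbhd_gen bracket_sp)
    show "aff_eq n k (p * gen (Loop (bracket x y) i)) (p * ad0 x (gen (Loop y i)))"
      using step by (intro aff_eq_lmult aff_eq_sym[OF ad0_gen])
  qed
  moreover have "ad0 x p * gen (Loop y i) \<in> aff_nbhd n k N"
    using step by (intro nbhd_gen ad0_free)
  ultimately show ?case
    using step by (simp add: ad0_add ad0_mult nbhd_add)
qed

section \<open>The module of symmetric tensors\<close>

text \<open>\<open>quad n a b\<close> corresponds to \<open>e\<^sub>a e\<^sub>b\<close> under \<open>\<gg> = S\<^sup>2(V)\<close>.\<close>

definition quad :: "nat \<Rightarrow> nat \<Rightarrow> nat \<Rightarrow> complex mat" where
  "quad n a b = mat (2 * n) (2 * n) (\<lambda>(i, j).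
     (if i = a \<and> j = dual n b then sgn_pos n b else 0) + (if i = b \<and> j = dual n a then sgn_pos n a else 0))"

lemma quad_carrier [simp]: "quad n a b \<in> carrier_mat (2 * n) (2 * n)"
  by (simp add: quad_def)

lemma quad_entry: "i < 2 * n \<Longrightarrow> j < 2 * n \<Longrightarrow> quad n a b $$ (i, j) =
   (if i = a \<and> j = dual n b then sgn_pos n b else 0) + (if i = b \<and> j = dual n a then sgn_pos n a else 0)"
  by (simp add: quad_def)

lemma quad_commute: "quad n a b = quad n b a"
  by (rule eq_matI) (auto simp: quad_def)

lemma dual_inj: "a < 2 * n \<Longrightarrow> b < 2 * n \<Longrightarrow> dual n a = dual n b \<longleftrightarrow> a = b"
  by (metis dual_dual)

lemma dual_eq_iff: "a < 2 * n \<Longrightarrow> c < 2 * n \<Longrightarrow> dual n c = a \<longleftrightarrow> c = dual n a"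
  by (auto simp: dual_dual)

lemma quad_sp:
  assumes "a < 2 * n" "b < 2 * n" shows "quad n a b \<in> sp n"
  unfolding sp_iff
proof (intro conjI allI impI)
  fix c d assume cd: "c < 2 * n" "d < 2 * n"
  define P where "P \<longleftrightarrow> c = dual n a \<and> d = dual n b"
  define Q where "Q \<longleftrightarrow> d = dual n a \<and> c = dual n b"
  have P: "P \<Longrightarrow> sgn_pos n c * sgn_pos n b = sgn_pos n d * sgn_pos n a"
    using assms by (simp add: P_def sgn_pos_dual)
  have Q: "Q \<Longrightarrow> sgn_pos n c * sgn_pos n a = sgn_pos n d * sgn_pos n b"
    using assms by (simp add: Q_def sgn_pos_dual)
  have "sgn_pos n c * quad n a b $$ (dual n c, d) = sgn_pos n c * ((if P then sgn_pos n b else 0) + (if Q then sgn_pos n a else 0))"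
    unfolding quad_entry[OF dual_less[OF cd(1)] cd(2)] dual_eq_iff[OF assms(1) cd(1)] dual_eq_iff[OF assms(2) cd(1)] P_def Q_def
    by (simp only: conj_commute)
  moreover have "sgn_pos n d * quad n a b $$ (dual n d, c) = sgn_pos n d * ((if Q then sgn_pos n b else 0) + (if P then sgn_pos n a else 0))"
    unfolding quad_entry[OF dual_less[OF cd(2)] cd(1)] dual_eq_iff[OF assms(1) cd(2)] dual_eq_iff[OF assms(2) cd(2)] P_def Q_def
    by (simp only: conj_commute)
  ultimately show "sgn_pos n c * quad n a b $$ (dual n c, d) = sgn_pos n d * quad n a b $$ (dual n d, c)"
    using P Q by (simp add: distrib_left)
qed simp

text \<open>The Leibniz rule for the product of two basis vectors in the symmetric square:
  \<open>x\<close> acts on one factor at a time.\<close>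

lemma bracket_quad:
  assumes x: "x \<in> sp n" and a: "a < 2 * n" "b < 2 * n"
  shows "aff_eq n k (gen (Loop (bracket x (quad n a b)) j))
    ((\<Sum>s<2*n. scal (x $$ (s, a)) * gen (Loop (quad n s b) j)) + (\<Sum>s<2*n. scal (x $$ (s, b)) * gen (Loop (quad n a s) j)))"
proof -
  have c: "x \<in> carrier_mat (2*n) (2*n)" using x by (rule spD)
  have "aff_eq n k (gen (Loop (bracket x (quad n a b)) j))
    (\<Sum>t\<in>{..<2*n} <+> {..<2*n}. scal (case t of Inl s \<Rightarrow> x $$ (s, a) | Inr s \<Rightarrow> x $$ (s, b))
       * gen (Loop (case t of Inl s \<Rightarrow> quad n s b | Inr s \<Rightarrow> quad n a s) j))"
  proof (rule conjunct2[OF aff_eq_gen_lincomb])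
    fix i l assume il: "i < 2 * n" "l < 2 * n"
    \<comment> \<open>Multiplying by \<open>x\<close> on the right brings in rows of
      \<open>x\<close>; the symplectic condition rewrites them as the columns required by the
      Leibniz rule.\<close>
    have sx: "sgn_pos n c * x $$ (dual n c, l) = sgn_pos n l * x $$ (dual n l, c)" if "c < 2*n" for c
      using x il that by (auto simp: sp_iff)
    have dl: "l = dual n s \<longleftrightarrow> s = dual n l" if "s < 2 * n" for s
      using il that by (metis dual_dual)
    have e1: "(\<Sum>c<2*n. x $$ (i, c) * quad n a b $$ (c, l)) = (if l = dual n b then sgn_pos n b * x $$ (i, a) else 0)
       + (if l = dual n a then sgn_pos n a * x $$ (i, b) else 0)"
    proof -
      have "(\<Sum>c<2*n. x $$ (i, c) * quad n a b $$ (c, l)) = (\<Sum>c<2*n. (if c = a then (if l = dual n b then sgn_pos n b * x $$ (i, a) else 0) else 0)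
         + (if c = b then (if l = dual n a then sgn_pos n a * x $$ (i, b) else 0) else 0))"
        by (rule sum.cong[OF refl]) (use il in \<open>auto simp: quad_entry\<close>)
      then show ?thesis using a by (simp add: sum.distrib)
    qed
    have e2: "(\<Sum>c<2*n. quad n a b $$ (i, c) * x $$ (c, l)) = (if i = a then sgn_pos n b * x $$ (dual n b, l) else 0)
       + (if i = b then sgn_pos n a * x $$ (dual n a, l) else 0)"
    proof -
      have "(\<Sum>c<2*n. quad n a b $$ (i, c) * x $$ (c, l)) = (\<Sum>c<2*n. (if c = dual n b then (if i = a then sgn_pos n b * x $$ (dual n b, l) else 0) else 0)
         + (if c = dual n a then (if i = b then sgn_pos n a * x $$ (dual n a, l) else 0) else 0))"
        by (rule sum.cong[OF refl]) (use il in \<open>auto simp: quad_entry\<close>)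
      then show ?thesis using a by (simp add: sum.distrib dual_less)
    qed
    have f1: "(\<Sum>s<2*n. x $$ (s, a) * quad n s b $$ (i, l)) = (if l = dual n b then sgn_pos n b * x $$ (i, a) else 0)
       + (if i = b then sgn_pos n (dual n l) * x $$ (dual n l, a) else 0)"
    proof -
      have "(\<Sum>s<2*n. x $$ (s, a) * quad n s b $$ (i, l)) = (\<Sum>s<2*n. (if s = i then (if l = dual n b then sgn_pos n b * x $$ (i, a) else 0) else 0)
         + (if s = dual n l then (if i = b then sgn_pos n (dual n l) * x $$ (dual n l, a) else 0) else 0))"
      proof (rule sum.cong[OF refl])
        fix s assume "s \<in> {..<2*n}"
        then show "x $$ (s, a) * quad n s b $$ (i, l) = (if s = i then (if l = dual n b then sgn_pos n b * x $$ (i, a) else 0) else 0)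
           + (if s = dual n l then (if i = b then sgn_pos n (dual n l) * x $$ (dual n l, a) else 0) else 0)"
          using il dl[of s] by (simp add: quad_entry algebra_simps)
      qed
      then show ?thesis using il by (simp add: sum.distrib dual_less)
    qed
    have f2: "(\<Sum>s<2*n. x $$ (s, b) * quad n a s $$ (i, l)) = (if l = dual n a then sgn_pos n a * x $$ (i, b) else 0)
       + (if i = a then sgn_pos n (dual n l) * x $$ (dual n l, b) else 0)"
    proof -
      have "(\<Sum>s<2*n. x $$ (s, b) * quad n a s $$ (i, l)) = (\<Sum>s<2*n. (if s = i then (if l = dual n a then sgn_pos n a * x $$ (i, b) else 0) else 0)
         + (if s = dual n l then (if i = a then sgn_pos n (dual n l) * x $$ (dual n l, b) else 0) else 0))"
      proof (rule sum.cong[OF refl])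
        fix s assume "s \<in> {..<2*n}"
        then show "x $$ (s, b) * quad n a s $$ (i, l) = (if s = i then (if l = dual n a then sgn_pos n a * x $$ (i, b) else 0) else 0)
           + (if s = dual n l then (if i = a then sgn_pos n (dual n l) * x $$ (dual n l, b) else 0) else 0)"
          using il dl[of s] by (simp add: quad_entry algebra_simps)
      qed
      then show ?thesis using il by (simp add: sum.distrib dual_less)
    qed
    show "bracket x (quad n a b) $$ (i, l) = (\<Sum>t\<in>{..<2*n} <+> {..<2*n}. (case t of Inl s \<Rightarrow> x $$ (s, a) | Inr s \<Rightarrow> x $$ (s, b))
       * (case t of Inl s \<Rightarrow> quad n s b | Inr s \<Rightarrow> quad n a s) $$ (i, l))"
      using il a by (simp add: bracket_entry[OF c quad_carrier] e1 e2 f1 f2 sx[OF a(1)] sx[OF a(2)] sgn_pos_dual sum.Plus)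
  qed (use assms c bracket_sp[OF x quad_sp[OF a]] in \<open>auto intro: quad_sp spD\<close>)
  then show ?thesis by (simp add: sum.Plus)
qed

text \<open>Meant for \<open>length ps = 2 * length js\<close>: consecutive positions form the
  pairs, and the default 1 only ends the recursion.\<close>

fun prod_quads :: "nat \<Rightarrow> nat list \<Rightarrow> int list \<Rightarrow> aff_alg" where
  "prod_quads n (a # b # ps) (j # js) = gen (Loop (quad n a b) j) * prod_quads n ps js"
| "prod_quads n _ _ = 1"

lemma prod_quads_free: "set ps \<subseteq> {..<2*n} \<Longrightarrow> prod_quads n ps js \<in> free_alg (aff_gens n)"
  by (induction n ps js rule: prod_quads.induct) (auto intro!: free_alg_mult loop_gen_free quad_sp)

lemma sum_mult_right_scal: "(\<Sum>s\<in>I. scal (c s) * f s) * g = (\<Sum>s\<in>I. scal (c s) * (f s * g))"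
  by (simp add: sum_distrib_right mult.assoc)

lemma ad0_prod_quads:
  assumes "x \<in> sp n" "set ps \<subseteq> {..<2*n}" "length ps = 2 * length js"
  shows "aff_eq n k (ad0 x (prod_quads n ps js))
    (\<Sum>l<length ps. \<Sum>s<2*n. scal (x $$ (s, ps ! l)) * prod_quads n (ps[l := s]) js)"
  using assms
proof (induction n ps js rule: prod_quads.induct)
  case (1 n a b ps j js)
  let ?P = "prod_quads n ps js" and ?E = "gen (Loop (quad n a b) j)"
  have ab: "a < 2*n" "b < 2*n" and ps: "set ps \<subseteq> {..<2*n}" using "1.prems" by auto
  have P: "?P \<in> free_alg (aff_gens n)" using ps by (rule prod_quads_free)
  have E: "?E \<in> free_alg (aff_gens n)" using ab by (simp add: quad_sp)
  have "aff_eq n k (ad0 x ?E * ?P)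
     (((\<Sum>s<2*n. scal (x $$ (s, a)) * gen (Loop (quad n s b) j)) + (\<Sum>s<2*n. scal (x $$ (s, b)) * gen (Loop (quad n a s) j))) * ?P)"
    by (intro aff_eq_rmult P aff_eq_trans[OF ad0_gen bracket_quad] "1.prems" ab quad_sp)
  moreover have "aff_eq n k (?E * ad0 x ?P) (?E * (\<Sum>l<length ps. \<Sum>s<2*n. scal (x $$ (s, ps ! l)) * prod_quads n (ps[l := s]) js))"
    by (intro aff_eq_lmult E "1.IH") (use "1.prems" in auto)
  ultimately have "aff_eq n k (ad0 x (prod_quads n (a # b # ps) (j # js)))
     (((\<Sum>s<2*n. scal (x $$ (s, a)) * gen (Loop (quad n s b) j)) + (\<Sum>s<2*n. scal (x $$ (s, b)) * gen (Loop (quad n a s) j))) * ?P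
       + ?E * (\<Sum>l<length ps. \<Sum>s<2*n. scal (x $$ (s, ps ! l)) * prod_quads n (ps[l := s]) js))"
    by (simp add: ad0_mult aff_eq_add)
  then show ?case
    by (simp add: sum.lessThan_Suc_shift distrib_right sum_mult_right_scal sum_distrib_left[of ?E] scal_left_comm add.assoc
        del: sum.lessThan_Suc)
qed auto

lemma scal_of_nat: "scal (of_nat m) = of_nat m"
  by (simp add: scal_def)

section \<open>Orbit sums over the arrangements of a multiset\<close>

definition arrangements :: "'a multiset \<Rightarrow> 'a list set" where
  "arrangements \<mu> = {ps. mset ps = \<mu>}"

lemma finite_arrangements [simp]: "finite (arrangements \<mu>)"
proof (rule finite_subset)
  show "arrangements \<mu> \<subseteq> {xs. set xs \<subseteq> set_mset \<mu> \<and> length xs = size \<mu>}"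
    by (auto simp: arrangements_def)
qed (simp add: finite_lists_length_eq)

text \<open>Double counting of arrangements with a marked place: replacing the marked
  \<open>r\<close> by \<open>s\<close> is a bijection onto the arrangements of the new multiset with
  a marked \<open>s\<close>, and each of these admits as many marks as \<open>s\<close> has
  multiplicity.\<close>

lemma sum_arrangements_update:
  fixes F :: "nat list \<Rightarrow> aff_alg"
  assumes "r \<in># \<mu>"
  shows "(\<Sum>ps\<in>arrangements \<mu>. \<Sum>l | l < length ps \<and> ps ! l = r. F (ps[l := s]))
    = (\<Sum>ps\<in>arrangements (add_mset s (\<mu> - {#r#})). scal (of_nat (count (add_mset s (\<mu> - {#r#})) s)) * F ps)"
proof -
  let ?\<nu> = "add_mset s (\<mu> - {#r#})"
  have "(\<Sum>ps\<in>arrangements \<mu>. \<Sum>l | l < length ps \<and> ps ! l = r. F (ps[l := s]))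
    = (\<Sum>(ps, l)\<in>Sigma (arrangements \<mu>) (\<lambda>ps. {l. l < length ps \<and> ps ! l = r}). F (ps[l := s]))"
    by (rule sum.Sigma) auto
  also have "\<dots> = (\<Sum>(ps, l)\<in>Sigma (arrangements ?\<nu>) (\<lambda>ps. {l. l < length ps \<and> ps ! l = s}). F ps)"
    by (rule sum.reindex_bij_witness[of _ "\<lambda>(ps, l). (ps[l := r], l)" "\<lambda>(ps, l). (ps[l := s], l)"])
      (use assms in \<open>auto simp: arrangements_def mset_update\<close>)
  also have "\<dots> = (\<Sum>ps\<in>arrangements ?\<nu>. \<Sum>l | l < length ps \<and> ps ! l = s. F ps)"
    by (rule sum.Sigma[symmetric]) auto
  also have "\<dots> = (\<Sum>ps\<in>arrangements ?\<nu>. scal (of_nat (count ?\<nu> s)) * F ps)"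
  proof (rule sum.cong[OF refl])
    fix ps assume "ps \<in> arrangements ?\<nu>"
    then have ps: "mset ps = ?\<nu>" by (simp add: arrangements_def)
    have "{l. l < length ps \<and> ps ! l = s} = {l. l < length ps \<and> s = ps ! l}" by auto
    then have "card {l. l < length ps \<and> ps ! l = s} = count ?\<nu> s"
      unfolding ps[symmetric] by (simp add: count_mset count_list_eq_length_filter length_filter_conv_card)
    then show "(\<Sum>l | l < length ps \<and> ps ! l = s. F ps) = scal (of_nat (count ?\<nu> s)) * F ps"
      by (simp only: sum_constant scal_of_nat)
  qed
  finally show ?thesis .
qed

text \<open>Every distinct arrangement is counted once. Normalized like this, the tensors behave
  like divided powers, whence the integer factors in \<open>shift_tensor\<close>.\<close>

definition sym_tensor :: "nat \<Rightarrow> nat multiset \<Rightarrow> int list \<Rightarrow> aff_alg" where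
  "sym_tensor n \<mu> js = (\<Sum>ps\<in>arrangements \<mu>. prod_quads n ps js)"

definition shift_tensor :: "nat \<Rightarrow> nat multiset \<Rightarrow> nat \<Rightarrow> nat \<Rightarrow> int list \<Rightarrow> aff_alg" where
  "shift_tensor n \<mu> s r js = (if r \<in># \<mu> then
     scal (of_nat (count (add_mset s (\<mu> - {#r#})) s)) * sym_tensor n (add_mset s (\<mu> - {#r#})) js else 0)"

lemma ad0_sym_tensor:
  assumes "x \<in> sp n" "set_mset \<mu> \<subseteq> {..<2*n}" "size \<mu> = 2 * length js"
  shows "aff_eq n k (ad0 x (sym_tensor n \<mu> js)) (\<Sum>r<2*n. \<Sum>s<2*n. scal (x $$ (s, r)) * shift_tensor n \<mu> s r js)"
proof -
  have "aff_eq n k (ad0 x (sym_tensor n \<mu> js))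
    (\<Sum>ps\<in>arrangements \<mu>. \<Sum>l<length ps. \<Sum>s<2*n. scal (x $$ (s, ps ! l)) * prod_quads n (ps[l := s]) js)"
    unfolding sym_tensor_def ad0_sum
    by (intro aff_eq_sum ad0_prod_quads) (use assms in \<open>auto simp: arrangements_def\<close>)
  also have "(\<Sum>ps\<in>arrangements \<mu>. \<Sum>l<length ps. \<Sum>s<2*n. scal (x $$ (s, ps ! l)) * prod_quads n (ps[l := s]) js)
    = (\<Sum>r<2*n. \<Sum>s<2*n. \<Sum>ps\<in>arrangements \<mu>. \<Sum>l | l < length ps \<and> ps ! l = r. scal (x $$ (s, r)) * prod_quads n (ps[l := s]) js)"
  proof -
    have "(\<Sum>l<length ps. \<Sum>s<2*n. scal (x $$ (s, ps ! l)) * prod_quads n (ps[l := s]) js)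
      = (\<Sum>r<2*n. \<Sum>s<2*n. \<Sum>l | l < length ps \<and> ps ! l = r. scal (x $$ (s, r)) * prod_quads n (ps[l := s]) js)"
      if ps: "ps \<in> arrangements \<mu>" for ps
    proof -
      have "(\<Sum>l<length ps. \<Sum>s<2*n. scal (x $$ (s, ps ! l)) * prod_quads n (ps[l := s]) js)
         = (\<Sum>r<2*n. \<Sum>l | l \<in> {..<length ps} \<and> ps ! l = r. \<Sum>s<2*n. scal (x $$ (s, ps ! l)) * prod_quads n (ps[l := s]) js)"
        by (rule sum.group[symmetric]) (use ps assms(2) in \<open>auto simp: arrangements_def dest!: nth_mem\<close>)
      also have "\<dots> = (\<Sum>r<2*n. \<Sum>s<2*n. \<Sum>l | l < length ps \<and> ps ! l = r. scal (x $$ (s, r)) * prod_quads n (ps[l := s]) js)"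
        by (subst sum.swap) (auto intro!: sum.cong)
      finally show ?thesis .
    qed
    then have "(\<Sum>ps\<in>arrangements \<mu>. \<Sum>l<length ps. \<Sum>s<2*n. scal (x $$ (s, ps ! l)) * prod_quads n (ps[l := s]) js)
      = (\<Sum>ps\<in>arrangements \<mu>. \<Sum>r<2*n. \<Sum>s<2*n. \<Sum>l | l < length ps \<and> ps ! l = r. scal (x $$ (s, r)) * prod_quads n (ps[l := s]) js)"
      by (rule sum.cong[OF refl])
    also have "\<dots> = (\<Sum>r<2*n. \<Sum>ps\<in>arrangements \<mu>. \<Sum>s<2*n. \<Sum>l | l < length ps \<and> ps ! l = r. scal (x $$ (s, r)) * prod_quads n (ps[l := s]) js)"
      by (rule sum.swap)
    also have "\<dots> = (\<Sum>r<2*n. \<Sum>s<2*n. \<Sum>ps\<in>arrangements \<mu>. \<Sum>l | l < length ps \<and> ps ! l = r. scal (x $$ (s, r)) * prod_quads n (ps[l := s]) js)"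
      by (intro sum.cong refl sum.swap)
    finally show ?thesis .
  qed
  also have "\<dots> = (\<Sum>r<2*n. \<Sum>s<2*n. scal (x $$ (s, r)) * shift_tensor n \<mu> s r js)"
  proof (intro sum.cong refl)
    fix r s
    show "(\<Sum>ps\<in>arrangements \<mu>. \<Sum>l | l < length ps \<and> ps ! l = r. scal (x $$ (s, r)) * prod_quads n (ps[l := s]) js)
      = scal (x $$ (s, r)) * shift_tensor n \<mu> s r js"
    proof (cases "r \<in># \<mu>")
      case True
      then show ?thesis
        by (simp add: shift_tensor_def sym_tensor_def sum_arrangements_update[OF True, of "\<lambda>ps. prod_quads n ps js"] flip: sum_distrib_left)
    next
      case False
      then have e: "{l. l < length ps \<and> ps ! l = r} = {}" if "ps \<in> arrangements \<mu>" for ps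
        using that by (auto simp: arrangements_def)
      have "(\<Sum>ps\<in>arrangements \<mu>. \<Sum>l | l < length ps \<and> ps ! l = r. scal (x $$ (s, r)) * prod_quads n (ps[l := s]) js) = 0"
        by (rule sum.neutral, rule ballI, subst e) auto
      then show ?thesis using False by (simp add: shift_tensor_def)
    qed
  qed
  finally show ?thesis .
qed

text \<open>\<open>quad n a b\<close> is a signed sum of two matrix units, one replacing
  \<open>dual n b\<close> by \<open>a\<close>, the other replacing \<open>dual n a\<close> by
  \<open>b\<close>.\<close>

lemma ad0_quad_sym_tensor:
  assumes "a < 2 * n" "b < 2 * n" "set_mset \<mu> \<subseteq> {..<2*n}" "size \<mu> = 2 * length js"
  shows "aff_eq n k (ad0 (quad n a b) (sym_tensor n \<mu> js))
    (scal (sgn_pos n b) * shift_tensor n \<mu> a (dual n b) js + scal (sgn_pos n a) * shift_tensor n \<mu> b (dual n a) js)"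
proof -
  have "(\<Sum>r<2*n. \<Sum>s<2*n. scal (quad n a b $$ (s, r)) * shift_tensor n \<mu> s r js)
     = (\<Sum>r<2*n. \<Sum>s<2*n. (if r = dual n b then if s = a then scal (sgn_pos n b) * shift_tensor n \<mu> a (dual n b) js else 0 else 0)
      + (if r = dual n a then if s = b then scal (sgn_pos n a) * shift_tensor n \<mu> b (dual n a) js else 0 else 0))"
    by (intro sum.cong refl) (simp add: quad_entry scal_add distrib_right)
  also have "\<dots> = scal (sgn_pos n b) * shift_tensor n \<mu> a (dual n b) js + scal (sgn_pos n a) * shift_tensor n \<mu> b (dual n a) js"
  proof -
    have "(\<Sum>s\<in>I. if Q then f s else 0) = (if Q then \<Sum>s\<in>I. f s else 0)" for Q and f :: "nat \<Rightarrow> aff_alg" and I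
      by simp
    then show ?thesis
      unfolding sum.distrib using assms by (simp add: dual_less)
  qed
  finally show ?thesis
    using ad0_sym_tensor[OF quad_sp[OF assms(1,2)] assms(3,4)] by simp
qed

section \<open>Reaching all symmetric tensors\<close>

lemma env_act_lin_ext: "env_act u f = lin_ext (\<lambda>w. foldr ad0 (letters w) f) u"
  by (simp add: env_act_def lin_ext_def scal_def)

lemma env_act_add: "env_act (u + v) f = env_act u f + env_act v f"
  by (simp add: env_act_lin_ext lin_ext_add)

lemma env_act_scal: "env_act (scal c * u) f = scal c * env_act u f"
  by (simp add: env_act_lin_ext lin_ext_scale scal_def)

lemma env_act_one: "env_act (1 :: complex mat fmon \<Rightarrow>\<^sub>0 complex) f = f"
proof -
  have "letters (0 :: complex mat fmon) = []" by (simp add: zero_fmon_def)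
  then show ?thesis unfolding env_act_lin_ext single_one[symmetric] lin_ext_single by simp
qed

lemma env_act_gen_mult: "env_act (gen x * u) f = ad0 x (env_act u f)"
proof (induction u rule: poly_mapping_linear_induct)
  case (single w c)
  have "ad0 x (Poly_Mapping.single 0 c * h) = Poly_Mapping.single 0 c * ad0 x h" for h
    using ad0_scal[of x c h] by (simp add: scal_def)
  then show ?case
    by (simp add: env_act_lin_ext gen_def mult_single plus_fmon_def)
qed (simp add: distrib_left env_act_add ad0_add)

text \<open>A single \<open>u\<close> has to serve all degree lists of length \<open>d\<close>; this
  uniformity allows summing over the lists of a relation.\<close>

definition reachable :: "nat \<Rightarrow> nat \<Rightarrow> nat \<Rightarrow> (int list \<Rightarrow> aff_alg) \<Rightarrow> (int list \<Rightarrow> aff_alg) \<Rightarrow> bool" where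
  "reachable n k d G F \<longleftrightarrow> (\<exists>u\<in>free_alg (sp n). \<forall>js. length js = d \<longrightarrow> aff_eq n k (env_act u (G js)) (F js))"

lemma reachable_refl: "reachable n k d G G"
  unfolding reachable_def by (rule bexI[of _ 1]) (simp_all add: env_act_one)

lemma reachable_add: "reachable n k d G F \<Longrightarrow> reachable n k d G H \<Longrightarrow> reachable n k d G (\<lambda>js. F js + H js)"
  unfolding reachable_def
proof (elim bexE)
  fix u v assume "u \<in> free_alg (sp n)" "v \<in> free_alg (sp n)"
    "\<forall>js. length js = d \<longrightarrow> aff_eq n k (env_act u (G js)) (F js)" "\<forall>js. length js = d \<longrightarrow> aff_eq n k (env_act v (G js)) (H js)"
  then show "\<exists>u\<in>free_alg (sp n). \<forall>js. length js = d \<longrightarrow> aff_eq n k (env_act u (G js)) (F js + H js)"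
    by (intro bexI[of _ "u + v"]) (auto simp: env_act_add aff_eq_add free_alg_add)
qed

lemma reachable_scal: "reachable n k d G F \<Longrightarrow> reachable n k d G (\<lambda>js. scal c * F js)"
  unfolding reachable_def
proof (elim bexE)
  fix u assume "u \<in> free_alg (sp n)" "\<forall>js. length js = d \<longrightarrow> aff_eq n k (env_act u (G js)) (F js)"
  then show "\<exists>u\<in>free_alg (sp n). \<forall>js. length js = d \<longrightarrow> aff_eq n k (env_act u (G js)) (scal c * F js)"
    by (intro bexI[of _ "scal c * u"]) (auto simp: env_act_scal aff_eq_scal free_alg_mult)
qed

lemma reachable_ad0: "reachable n k d G F \<Longrightarrow> x \<in> sp n \<Longrightarrow> reachable n k d G (\<lambda>js. ad0 x (F js))"
  unfolding reachable_def
proof (elim bexE)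
  fix u assume "x \<in> sp n" "u \<in> free_alg (sp n)" "\<forall>js. length js = d \<longrightarrow> aff_eq n k (env_act u (G js)) (F js)"
  then show "\<exists>u\<in>free_alg (sp n). \<forall>js. length js = d \<longrightarrow> aff_eq n k (env_act u (G js)) (ad0 x (F js))"
    by (intro bexI[of _ "gen x * u"]) (auto simp: env_act_gen_mult ad0_aff_eq free_alg_mult free_alg_gen)
qed

lemma reachable_aff_eq:
  "reachable n k d G F \<Longrightarrow> (\<And>js. length js = d \<Longrightarrow> aff_eq n k (F js) (H js)) \<Longrightarrow> reachable n k d G H"
  unfolding reachable_def by (meson aff_eq_trans)

lemma arrangements_replicate: "arrangements (replicate_mset m a) = {replicate m a}"
proof -
  have "ps = replicate m a" if "mset ps = replicate_mset m a" for ps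
  proof -
    have "set ps \<subseteq> {a}" using arg_cong[OF that, of set_mset] by (auto split: if_splits)
    moreover have "length ps = m" using arg_cong[OF that, of size] by simp
    ultimately show ?thesis by (metis in_mono replicate_length_same singletonD)
  qed
  then show ?thesis by (auto simp: arrangements_def)
qed

lemma prod_quads_replicate:
  "prod_quads n (replicate (2 * length js) a) js = prod_list (map (\<lambda>j. gen (Loop (quad n a a) j)) js)"
  by (induction js) auto

lemma sym_tensor_replicate:
  "sym_tensor n (replicate_mset (2 * length js) a) js = prod_list (map (\<lambda>j. gen (Loop (quad n a a) j)) js)"
  by (simp add: sym_tensor_def arrangements_replicate prod_quads_replicate)

lemma size_filter_eq_0: "size (filter_mset (\<lambda>c. c \<noteq> a) \<mu>) = 0 \<Longrightarrow> \<mu> = replicate_mset (size \<mu>) a"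
  by (induction \<mu>) (auto split: if_splits)

lemma shift_tensor_member:
  "r \<in># \<mu> \<Longrightarrow> shift_tensor n \<mu> s r js = scal (of_nat (Suc (count (\<mu> - {#r#}) s))) * sym_tensor n (add_mset s (\<mu> - {#r#})) js"
  by (simp only: shift_tensor_def if_True count_add_mset if_P)

text \<open>The operator of \<open>quad n a n\<close> sends \<open>e\<^sub>1\<close> to a multiple of \<open>e\<^sub>a\<close>; the second term it produces has again more
  factors \<open>e\<^sub>1\<close> than the target.\<close>

lemma reachable_sym_tensor:
  assumes "1 \<le> n" "set_mset \<mu> \<subseteq> {..<2*n}" "size \<mu> = 2 * d"
  shows "reachable n k d (\<lambda>js. prod_list (map (\<lambda>j. gen (Loop (quad n 0 0) j)) js)) (sym_tensor n \<mu>)"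
  using assms(2,3)
proof (induction "size (filter_mset (\<lambda>c. c \<noteq> 0) \<mu>)" arbitrary: \<mu> rule: less_induct)
  case (less \<mu>)
  let ?G = "\<lambda>js. prod_list (map (\<lambda>j. gen (Loop (quad n 0 0) j)) js)"
  show ?case
  proof (cases "size (filter_mset (\<lambda>c. c \<noteq> 0) \<mu>) = 0")
    case True
    have "\<mu> = replicate_mset (2 * d) 0" using size_filter_eq_0[OF True] unfolding less.prems(2) .
    then show ?thesis by (intro reachable_aff_eq[OF reachable_refl]) (auto simp: sym_tensor_replicate)
  next
    case False
    then obtain a where a: "a \<in># \<mu>" "a \<noteq> 0" by auto
    obtain \<nu> where \<mu>: "\<mu> = add_mset a \<nu>" using multi_member_split[OF a(1)] by blast
    let ?\<mu>0 = "add_mset 0 \<nu>"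
    have an: "a < 2 * n" "n < 2 * n" using less.prems a(1) assms(1) by auto
    have dn: "dual n n = 0" by (simp add: dual_def)
    have 0: "set_mset ?\<mu>0 \<subseteq> {..<2*n}" "size ?\<mu>0 = 2 * d" using less.prems \<mu> an by auto
    have r0: "reachable n k d ?G (sym_tensor n ?\<mu>0)"
      by (rule less.hyps[OF _ 0]) (simp add: \<mu> a(2))
    define c :: complex where "c = of_nat (Suc (count \<nu> a))"
    have c: "c \<noteq> 0" unfolding c_def of_nat_eq_0_iff by simp
    have st: "shift_tensor n ?\<mu>0 a 0 js = scal c * sym_tensor n \<mu> js" for js
      unfolding c_def by (subst shift_tensor_member) (simp_all add: \<mu> del: of_nat_Suc)
    have sn: "sgn_pos n n = - 1" by (simp add: sgn_pos_def)
    have eq: "aff_eq n k (ad0 (quad n a n) (sym_tensor n ?\<mu>0 js))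
      (scal (- c) * sym_tensor n \<mu> js + scal (sgn_pos n a) * shift_tensor n ?\<mu>0 n (dual n a) js)" if "length js = d" for js
    proof -
      have "scal (sgn_pos n n) * shift_tensor n ?\<mu>0 a (dual n n) js = scal (- c) * sym_tensor n \<mu> js"
        by (simp add: dn sn st scal_mult_scal)
      then show ?thesis using ad0_quad_sym_tensor[OF an 0(1), of js k] 0(2) that by simp
    qed
    show ?thesis
    proof (cases "dual n a \<in># ?\<mu>0")
      case True
      show ?thesis
      proof (cases "a = n")
        case True
        \<comment> \<open>Here \<open>dual n a\<close> is 0 and the two terms of the operator
          coincide; they add up to the factor \<open>- 2 * c\<close> instead of cancelling.\<close>
        have "aff_eq n k (ad0 (quad n a n) (sym_tensor n ?\<mu>0 js)) (scal (- 2 * c) * sym_tensor n \<mu> js)" if "length js = d" for js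
        proof -
          have "scal (sgn_pos n a) * shift_tensor n ?\<mu>0 n (dual n a) js = scal (- c) * sym_tensor n \<mu> js"
            using st[of js] by (simp add: True dn sn scal_mult_scal)
          moreover have "scal (- 2 * c) * sym_tensor n \<mu> js = scal (- c) * sym_tensor n \<mu> js + scal (- c) * sym_tensor n \<mu> js"
            by (simp flip: distrib_right scal_add)
          ultimately show ?thesis using eq[OF that] by simp
        qed
        then have "reachable n k d ?G (\<lambda>js. scal (- 2 * c) * sym_tensor n \<mu> js)"
          by (intro reachable_aff_eq[OF reachable_ad0[OF r0 quad_sp[OF an]]])
        then show ?thesis
          by (rule reachable_aff_eq[OF reachable_scal[of n k d _ _ "1 / (- 2 * c)"]]) (use c in \<open>simp add: scal_mult_scal\<close>)
      next
        case False
        have da: "dual n a \<noteq> 0" using an False by (auto simp: dual_def)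
        let ?\<mu>1 = "add_mset n (?\<mu>0 - {#dual n a#})"
        have "dual n a \<in># \<nu>" using True da by auto
        then obtain \<rho> where \<rho>: "\<nu> = add_mset (dual n a) \<rho>" by (blast dest: multi_member_split)
        have e: "?\<mu>1 = add_mset n (add_mset 0 \<rho>)" by (simp add: \<rho>)
        have r1: "reachable n k d ?G (sym_tensor n ?\<mu>1)"
          unfolding e
        proof (rule less.hyps)
          show "set_mset (add_mset n (add_mset 0 \<rho>)) \<subseteq> {..<2*n}" using 0 an by (simp add: \<rho>)
          show "size (add_mset n (add_mset 0 \<rho>)) = 2 * d" using 0 by (simp add: \<rho>)
          show "size {#c \<in># add_mset n (add_mset 0 \<rho>). c \<noteq> 0#} < size {#c \<in># \<mu>. c \<noteq> 0#}"
            using assms(1) a(2) da by (simp add: \<mu> \<rho>)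
        qed
        then obtain c1 where c1: "\<And>js. shift_tensor n ?\<mu>0 n (dual n a) js = scal c1 * sym_tensor n ?\<mu>1 js"
          using shift_tensor_member[OF True] by blast
        have "reachable n k d ?G (\<lambda>js. ad0 (quad n a n) (sym_tensor n ?\<mu>0 js) + scal (- sgn_pos n a) * (scal c1 * sym_tensor n ?\<mu>1 js))"
          by (intro reachable_add reachable_ad0 reachable_scal r0 r1 quad_sp an)
        then have "reachable n k d ?G (\<lambda>js. scal (- c) * sym_tensor n \<mu> js)"
        proof (rule reachable_aff_eq)
          fix js :: "int list" assume "length js = d"
          from aff_eq_add[OF eq[OF this] aff_eq_refl[of n k "scal (- sgn_pos n a) * (scal c1 * sym_tensor n ?\<mu>1 js)"]]
          show "aff_eq n k (ad0 (quad n a n) (sym_tensor n ?\<mu>0 js) + scal (- sgn_pos n a) * (scal c1 * sym_tensor n ?\<mu>1 js)) (scal (- c) * sym_tensor n \<mu> js)"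
            unfolding c1 by (simp add: scal_uminus)
        qed
        then show ?thesis
          by (rule reachable_aff_eq[OF reachable_scal[of n k d _ _ "1 / (- c)"]]) (use c in \<open>simp add: scal_mult_scal\<close>)
      qed
    next
      case False
      then have "aff_eq n k (ad0 (quad n a n) (sym_tensor n ?\<mu>0 js)) (scal (- c) * sym_tensor n \<mu> js)" if "length js = d" for js
        using eq[OF that] by (simp add: shift_tensor_def)
      then have "reachable n k d ?G (\<lambda>js. scal (- c) * sym_tensor n \<mu> js)"
        by (intro reachable_aff_eq[OF reachable_ad0[OF r0 quad_sp[OF an]]])
      then show ?thesis
        by (rule reachable_aff_eq[OF reachable_scal[of n k d _ _ "1 / (- c)"]]) (use c in \<open>simp add: scal_mult_scal\<close>)
    qed
  qed
qed

section \<open>Vanishing sums\<close>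

definition vanishing :: "nat \<Rightarrow> nat \<Rightarrow> 'i set \<Rightarrow> ('i \<Rightarrow> aff_alg) \<Rightarrow> bool" where
  "vanishing n k I F \<longleftrightarrow> (\<forall>N. \<exists>I0. finite I0 \<and> I0 \<subseteq> I \<and>
     (\<forall>I1. finite I1 \<and> I0 \<subseteq> I1 \<and> I1 \<subseteq> I \<longrightarrow> (\<Sum>i\<in>I1. F i) \<in> aff_nbhd n k N))"

lemma vanishing_same_sum: "same_sum n k I F J (\<lambda>_. 0) \<Longrightarrow> vanishing n k I F"
  unfolding same_sum_def vanishing_def sum.neutral_const diff_zero
proof
  fix N
  assume "\<forall>N. \<exists>I0 J0. finite I0 \<and> I0 \<subseteq> I \<and> finite J0 \<and> J0 \<subseteq> J \<and>
    (\<forall>I1 J1. finite I1 \<and> I0 \<subseteq> I1 \<and> I1 \<subseteq> I \<and> finite J1 \<and> J0 \<subseteq> J1 \<and> J1 \<subseteq> J \<longrightarrow> (\<Sum>i\<in>I1. F i) \<in> aff_nbhd n k N)"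
  from spec[OF this, of N] show "\<exists>I0. finite I0 \<and> I0 \<subseteq> I \<and> (\<forall>I1. finite I1 \<and> I0 \<subseteq> I1 \<and> I1 \<subseteq> I \<longrightarrow> (\<Sum>i\<in>I1. F i) \<in> aff_nbhd n k N)"
  proof (elim exE conjE)
    fix I0 J0 assume a: "finite I0" "I0 \<subseteq> I" "finite J0" "J0 \<subseteq> J" and
      *: "\<forall>I1 J1. finite I1 \<and> I0 \<subseteq> I1 \<and> I1 \<subseteq> I \<and> finite J1 \<and> J0 \<subseteq> J1 \<and> J1 \<subseteq> J \<longrightarrow> (\<Sum>i\<in>I1. F i) \<in> aff_nbhd n k N"
    show ?thesis
    proof (intro exI[of _ I0] conjI allI impI a)
      fix I1 assume "finite I1 \<and> I0 \<subseteq> I1 \<and> I1 \<subseteq> I"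
      then show "(\<Sum>i\<in>I1. F i) \<in> aff_nbhd n k N" using a by (intro *[rule_format, of I1 J0]) simp
    qed
  qed
qed

lemma vanishing_map:
  assumes "vanishing n k I F" "\<And>N f. f \<in> aff_nbhd n k N \<Longrightarrow> L f \<in> aff_nbhd n k N"
    "\<And>J. L (\<Sum>i\<in>J. F i) = (\<Sum>i\<in>J. L (F i))" "\<And>i. i \<in> I \<Longrightarrow> aff_eq n k (L (F i)) (H i)"
  shows "vanishing n k I H"
  unfolding vanishing_def
proof
  fix N
  from spec[OF assms(1)[unfolded vanishing_def], of N]
  obtain I0 where I0: "finite I0" "I0 \<subseteq> I"
    and N: "\<forall>I1. finite I1 \<and> I0 \<subseteq> I1 \<and> I1 \<subseteq> I \<longrightarrow> (\<Sum>i\<in>I1. F i) \<in> aff_nbhd n k N"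
    by (elim exE conjE)
  have "(\<Sum>i\<in>I1. H i) \<in> aff_nbhd n k N" if "finite I1" "I0 \<subseteq> I1" "I1 \<subseteq> I" for I1
  proof (rule nbhd_aff_eq)
    show "L (\<Sum>i\<in>I1. F i) \<in> aff_nbhd n k N" by (intro assms(2) N[rule_format] conjI that)
    show "aff_eq n k (L (\<Sum>i\<in>I1. F i)) (\<Sum>i\<in>I1. H i)"
      unfolding assms(3) by (intro aff_eq_sum assms(4)) (use that in auto)
  qed
  then show "\<exists>I0. finite I0 \<and> I0 \<subseteq> I \<and> (\<forall>I1. finite I1 \<and> I0 \<subseteq> I1 \<and> I1 \<subseteq> I \<longrightarrow> (\<Sum>i\<in>I1. H i) \<in> aff_nbhd n k N)"
    using I0 by (intro exI[of _ I0]) simp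
qed

lemma vanishing_ad0:
  assumes "vanishing n k I F" "x \<in> sp n" "\<And>i. i \<in> I \<Longrightarrow> aff_eq n k (ad0 x (F i)) (scal c * H i)" "c \<noteq> 0"
  shows "vanishing n k I H"
proof (rule vanishing_map[OF assms(1), of "\<lambda>f. scal (1 / c) * ad0 x f"])
  show "aff_eq n k (scal (1 / c) * ad0 x (F i)) (H i)" if "i \<in> I" for i
    using aff_eq_scal[OF assms(3)[OF that], of "1 / c"] assms(4) by (simp add: scal_mult_scal)
  show "scal (1 / c) * ad0 x f \<in> aff_nbhd n k N" if "f \<in> aff_nbhd n k N" for f N
    by (intro nbhd_lmult nbhd_ad0 that assms free_alg_scal)
qed (simp add: ad0_sum sum_distrib_left)

text \<open>Positions are raised to 0 one at a time. As long as \<open>n\<close> occurs,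
  \<open>quad n 0 0\<close> removes it; once \<open>n\<close> is absent, the second term of
  \<open>quad n 0 (dual n r)\<close>, which would replace \<open>n\<close>, is zero. Each operator
  thus gives one nonzero multiple of a single tensor.\<close>

lemma vanishing_sym_tensor_top:
  assumes "1 \<le> n" "set_mset \<mu> \<subseteq> {..<2*n}" "size \<mu> = 2 * d" "\<And>js. js \<in> I \<Longrightarrow> length js = d"
    "vanishing n k I (sym_tensor n \<mu>)"
  shows "vanishing n k I (sym_tensor n (replicate_mset (2 * d) 0))"
  using assms(2,3,5)
proof (induction "size (filter_mset (\<lambda>c. c \<noteq> 0) \<mu>)" arbitrary: \<mu> rule: less_induct)
  case (less \<mu>)
  have n: "0 < 2 * n" "n < 2 * n" using assms(1) by auto
  have d0: "dual n 0 = n" using assms(1) by (simp add: dual_def)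
  have s0: "sgn_pos n 0 = 1" using assms(1) by (simp add: sgn_pos_def)
  show ?case
  proof (cases "size (filter_mset (\<lambda>c. c \<noteq> 0) \<mu>) = 0")
    case True
    have "\<mu> = replicate_mset (2 * d) 0" using size_filter_eq_0[OF True] unfolding less.prems(2) .
    then show ?thesis using less.prems(3) by (simp only:)
  next
    case False
    have "\<exists>r c. r \<in># \<mu> \<and> r \<noteq> 0 \<and> c \<noteq> 0 \<and> (\<exists>x\<in>sp n. \<forall>js\<in>I. aff_eq n k (ad0 x (sym_tensor n \<mu> js)) (scal c * sym_tensor n (add_mset 0 (\<mu> - {#r#})) js))"
    proof (cases "n \<in># \<mu>")
      case True
      define c :: complex where "c = of_nat (Suc (count (\<mu> - {#n#}) 0))"
      have c: "c \<noteq> 0" unfolding c_def of_nat_eq_0_iff by simp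
      have st: "shift_tensor n \<mu> 0 n js = scal c * sym_tensor n (add_mset 0 (\<mu> - {#n#})) js" for js
        unfolding c_def by (rule shift_tensor_member[OF True])
      have A: "aff_eq n k (ad0 (quad n 0 0) (sym_tensor n \<mu> js)) (scal (2 * c) * sym_tensor n (add_mset 0 (\<mu> - {#n#})) js)" if "js \<in> I" for js
      proof -
        have "scal (2 * c) * f = scal c * f + scal c * f" for f :: aff_alg
          by (simp only: mult_2 scal_add distrib_right)
        then show ?thesis
          using ad0_quad_sym_tensor[OF n(1) n(1) less.prems(1), of js k] less.prems(2) assms(4)[OF that]
          by (simp add: s0 d0 st)
      qed
      show ?thesis
        by (intro exI[of _ n] exI[of _ "2 * c"] conjI bexI[of _ "quad n 0 0"] ballI A quad_sp True n) (use assms(1) c in simp_all)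
    next
      case nn: False
      from False obtain r where r: "r \<in># \<mu>" "r \<noteq> 0" by auto
      have rn: "r < 2 * n" using r(1) less.prems(1) by auto
      define c :: complex where "c = of_nat (Suc (count (\<mu> - {#r#}) 0))"
      have c: "c \<noteq> 0" unfolding c_def of_nat_eq_0_iff by simp
      let ?s = "sgn_pos n (dual n r)"
      have st: "shift_tensor n \<mu> 0 r js = scal c * sym_tensor n (add_mset 0 (\<mu> - {#r#})) js" for js
        unfolding c_def by (rule shift_tensor_member[OF r(1)])
      have A: "aff_eq n k (ad0 (quad n 0 (dual n r)) (sym_tensor n \<mu> js)) (scal (?s * c) * sym_tensor n (add_mset 0 (\<mu> - {#r#})) js)" if "js \<in> I" for js
      proof -
        have "shift_tensor n \<mu> (dual n r) n js = 0" using nn by (simp add: shift_tensor_def)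
        then show ?thesis
          using ad0_quad_sym_tensor[OF n(1) dual_less[OF rn] less.prems(1), of js k] less.prems(2) assms(4)[OF that]
          by (simp add: d0 dual_dual[OF rn] st scal_mult_scal)
      qed
      show ?thesis
        by (intro exI[of _ r] exI[of _ "?s * c"] conjI bexI[of _ "quad n 0 (dual n r)"] ballI A quad_sp r n dual_less rn)
          (use sgn_pos_nz c in simp)
    qed
    then obtain r c x where r: "r \<in># \<mu>" "r \<noteq> 0" "c \<noteq> 0" "x \<in> sp n"
      and rr: "\<forall>js\<in>I. aff_eq n k (ad0 x (sym_tensor n \<mu> js)) (scal c * sym_tensor n (add_mset 0 (\<mu> - {#r#})) js)"
      by (elim exE conjE bexE)
    obtain \<nu> where \<mu>: "\<mu> = add_mset r \<nu>" using multi_member_split[OF r(1)] by blast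
    show ?thesis
    proof (rule less.hyps)
      show "vanishing n k I (sym_tensor n (add_mset 0 (\<mu> - {#r#})))"
        by (rule vanishing_ad0[OF less.prems(3) r(4) rr[rule_format] r(3)])
    qed (use less.prems(1,2) r(2) n in \<open>simp_all add: \<mu>\<close>)
  qed
qed

section \<open>Ordered monomials\<close>

text \<open>Together with the total degree this bounds every part from both sides, so only finitely
  many partitions of bounded length share both values; a large value forces a part of large
  degree.\<close>

definition pos_deg :: "part multiset \<Rightarrow> int" where
  "pos_deg \<psi> = (\<Sum>p\<in>#\<psi>. max (part_deg p) 0)"

definition bounded_partitions :: "nat \<Rightarrow> nat \<Rightarrow> int \<Rightarrow> int \<Rightarrow> part multiset set" where
  "bounded_partitions n s m D = {\<psi> \<in> colored_partitions n. size \<psi> \<le> s \<and> cp_deg \<psi> = m \<and> pos_deg \<psi> = D}"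

lemma finite_indices: "finite (indices n)"
  by (simp add: indices_def)

lemma finite_basis [simp]: "finite (basis n)"
proof (rule finite_subset)
  show "basis n \<subseteq> case_prod Color ` (indices n \<times> indices n)"
    by (auto simp: basis_def)
qed (simp add: finite_indices)

lemma part_deg_bounds:
  assumes "p \<in># \<psi>"
  shows "part_deg p \<le> pos_deg \<psi>" "cp_deg \<psi> - pos_deg \<psi> \<le> part_deg p"
proof -
  obtain \<phi> where \<psi>: "\<psi> = add_mset p \<phi>" using multi_member_split[OF assms] by blast
  have "0 \<le> pos_deg \<phi>" unfolding pos_deg_def by (induction \<phi>) auto
  moreover have "cp_deg \<phi> \<le> pos_deg \<phi>" unfolding pos_deg_def cp_deg_def by (induction \<phi>) auto
  ultimately show "part_deg p \<le> pos_deg \<psi>" "cp_deg \<psi> - pos_deg \<psi> \<le> part_deg p"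
    by (simp_all add: \<psi> pos_deg_def cp_deg_def)
qed

lemma finite_msets_le: "finite A \<Longrightarrow> finite {M. set_mset M \<subseteq> A \<and> size M \<le> s}"
proof (rule finite_subset)
  show "{M. set_mset M \<subseteq> A \<and> size M \<le> s} \<subseteq> mset ` {xs. set xs \<subseteq> A \<and> length xs \<le> s}"
  proof
    fix M assume M: "M \<in> {M. set_mset M \<subseteq> A \<and> size M \<le> s}"
    obtain xs where "mset xs = M" using ex_mset by blast
    then show "M \<in> mset ` {xs. set xs \<subseteq> A \<and> length xs \<le> s}" using M by (intro image_eqI[of _ _ xs]) auto
  qed
qed (simp add: finite_lists_length_le)

lemma finite_colored_partitions:
  assumes "\<And>\<psi> p. \<psi> \<in> S \<Longrightarrow> p \<in># \<psi> \<Longrightarrow> part_color p \<in> basis n \<and> part_deg p \<in> {lo..hi}" "\<And>\<psi>. \<psi> \<in> S \<Longrightarrow> size \<psi> \<le> s"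
  shows "finite S"
proof (rule finite_subset)
  have "p \<in> case_prod Part ` (basis n \<times> {lo..hi})" if "\<psi> \<in> S" "p \<in># \<psi>" for p \<psi>
    using assms(1)[OF that] by (intro image_eqI[of _ _ "(part_color p, part_deg p)"]) auto
  then show "S \<subseteq> {M. set_mset M \<subseteq> case_prod Part ` (basis n \<times> {lo..hi}) \<and> size M \<le> s}"
    using assms(2) by blast
qed (simp add: finite_msets_le)

lemma finite_bounded_partitions [simp]: "finite (bounded_partitions n s m D)"
  by (rule finite_colored_partitions[of _ n "m - D" D s])
    (use part_deg_bounds in \<open>fastforce simp: bounded_partitions_def colored_partitions_def\<close>)+

section \<open>Reordering words into ordered monomials\<close>

definition spanned :: "nat \<Rightarrow> nat \<Rightarrow> (weight \<Rightarrow> complex mat) \<Rightarrow> part multiset set \<Rightarrow> aff_alg \<Rightarrow> bool" where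
  "spanned n k xr S f \<longleftrightarrow> (\<exists>C. aff_eq n k f (\<Sum>\<psi>\<in>S. scal (C \<psi>) * cp_elem n xr \<psi>))"

lemma spanned_zero: "spanned n k xr S 0"
  unfolding spanned_def by (rule exI[of _ "\<lambda>_. 0"]) simp

lemma spanned_add:
  assumes "spanned n k xr S f" "spanned n k xr S g" shows "spanned n k xr S (f + g)"
proof -
  obtain C E where "aff_eq n k f (\<Sum>\<psi>\<in>S. scal (C \<psi>) * cp_elem n xr \<psi>)" "aff_eq n k g (\<Sum>\<psi>\<in>S. scal (E \<psi>) * cp_elem n xr \<psi>)"
    using assms unfolding spanned_def by blast
  from aff_eq_add[OF this] show ?thesis
    unfolding spanned_def by (intro exI[of _ "\<lambda>\<psi>. C \<psi> + E \<psi>"]) (simp add: scal_add distrib_right sum.distrib)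
qed

lemma spanned_scal:
  assumes "spanned n k xr S f" shows "spanned n k xr S (scal c * f)"
proof -
  obtain C where "aff_eq n k f (\<Sum>\<psi>\<in>S. scal (C \<psi>) * cp_elem n xr \<psi>)"
    using assms unfolding spanned_def by blast
  from aff_eq_scal[OF this, of c] show ?thesis
    unfolding spanned_def by (intro exI[of _ "\<lambda>\<psi>. c * C \<psi>"]) (simp add: sum_distrib_left scal_mult_scal)
qed

lemma spanned_sum: "(\<And>i. i \<in> I \<Longrightarrow> spanned n k xr S (f i)) \<Longrightarrow> spanned n k xr S (\<Sum>i\<in>I. f i)"
  by (induction I rule: infinite_finite_induct) (auto simp: spanned_zero spanned_add)

lemma spanned_aff_eq: "spanned n k xr S f \<Longrightarrow> aff_eq n k g f \<Longrightarrow> spanned n k xr S g"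
  unfolding spanned_def by (elim exE, intro exI) (rule aff_eq_trans)

lemma spanned_mono:
  assumes "spanned n k xr S f" "S \<subseteq> S'" "finite S'" shows "spanned n k xr S' f"
proof -
  obtain C where C: "aff_eq n k f (\<Sum>\<psi>\<in>S. scal (C \<psi>) * cp_elem n xr \<psi>)"
    using assms unfolding spanned_def by blast
  have "(\<Sum>\<psi>\<in>S. scal (C \<psi>) * cp_elem n xr \<psi>) = (\<Sum>\<psi>\<in>S'. scal (if \<psi> \<in> S then C \<psi> else 0) * cp_elem n xr \<psi>)"
    using assms by (intro sum.mono_neutral_cong_left) auto
  then show ?thesis using C unfolding spanned_def by (intro exI[of _ "\<lambda>\<psi>. if \<psi> \<in> S then C \<psi> else 0"]) simp
qed

lemma spanned_cp_elem: "\<psi> \<in> S \<Longrightarrow> finite S \<Longrightarrow> spanned n k xr S (cp_elem n xr \<psi>)"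
  unfolding spanned_def
proof (intro exI[of _ "\<lambda>\<phi>. if \<phi> = \<psi> then 1 else 0"])
  assume S: "\<psi> \<in> S" "finite S"
  have "(\<Sum>\<phi>\<in>S. scal (if \<phi> = \<psi> then 1 else 0) * cp_elem n xr \<phi>) = (\<Sum>\<phi>\<in>S. if \<phi> = \<psi> then cp_elem n xr \<psi> else 0)"
    by (rule sum.cong) auto
  then show "aff_eq n k (cp_elem n xr \<psi>) (\<Sum>\<phi>\<in>S. scal (if \<phi> = \<psi> then 1 else 0) * cp_elem n xr \<phi>)"
    using S by simp
qed

definition part_gen :: "nat \<Rightarrow> (weight \<Rightarrow> complex mat) \<Rightarrow> part \<Rightarrow> aff_alg" where
  "part_gen n xr p = gen (Loop (basis_elem n xr (part_color p)) (part_deg p))"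

definition word :: "nat \<Rightarrow> (weight \<Rightarrow> complex mat) \<Rightarrow> part list \<Rightarrow> aff_alg" where
  "word n xr ps = prod_list (map (part_gen n xr) ps)"

lemma cp_elem_word: "cp_elem n xr \<psi> = word n xr (sorted_list_of_multiset \<psi>)"
  by (simp add: cp_elem_def word_def part_gen_def[abs_def])

lemma word_append: "word n xr (ps @ qs) = word n xr ps * word n xr qs"
  by (simp add: word_def)

text \<open>Commuting two adjacent parts whose degrees have the same sign produces no central term and preserves \<open>pos_deg\<close>;
  the latter keeps the sums in a relation locally finite.\<close>

definition sign_sorted :: "part list \<Rightarrow> bool" where
  "sign_sorted ps \<longleftrightarrow> sorted (map (\<lambda>p. sgn (part_deg p)) ps)"

locale spanning_basis =
  fixes n k :: nat and xr :: "weight \<Rightarrow> complex mat"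
  assumes basis_sp: "\<And>c. c \<in> basis n \<Longrightarrow> basis_elem n xr c \<in> sp n"
    and basis_span: "\<And>x. x \<in> sp n \<Longrightarrow> \<exists>\<kappa>. \<forall>i. aff_eq n k (gen (Loop x i)) (\<Sum>c\<in>basis n. scal (\<kappa> c) * gen (Loop (basis_elem n xr c) i))"
begin

lemma word_free: "(\<And>p. p \<in> set ps \<Longrightarrow> part_color p \<in> basis n) \<Longrightarrow> word n xr ps \<in> free_alg (aff_gens n)"
  unfolding word_def by (intro free_alg_prod_list) (auto simp: part_gen_def basis_sp)

abbreviation lower :: "part list \<Rightarrow> part multiset set" where
  "lower ps \<equiv> bounded_partitions n (length ps - 1) (cp_deg (mset ps)) (pos_deg (mset ps))"

text \<open>The bracket merges the two parts into one of degree \<open>?d\<close>. The resulting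
  words are shorter, with the same degree and the same positive degree, and the induction hypothesis
  turns them into shorter ordered monomials.\<close>

lemma swap_adjacent:
  assumes IH: "\<And>ws. length ws < length (u @ p # q # v) \<Longrightarrow> (\<And>p. p \<in> set ws \<Longrightarrow> part_color p \<in> basis n) \<Longrightarrow> sign_sorted ws \<Longrightarrow>
      spanned n k xr (lower ws) (word n xr ws - cp_elem n xr (mset ws))"
    and col: "\<And>x. x \<in> set (u @ p # q # v) \<Longrightarrow> part_color x \<in> basis n"
    and ss: "sign_sorted (u @ p # q # v)" and sg: "sgn (part_deg p) = sgn (part_deg q)"
  shows "spanned n k xr (lower (u @ p # q # v)) (word n xr (u @ p # q # v) - word n xr (u @ q # p # v))"
proof -
  let ?U = "word n xr u" and ?V = "word n xr v" and ?d = "part_deg p + part_deg q"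
  let ?X = "\<lambda>c. basis_elem n xr c"
  have f: "?U \<in> free_alg (aff_gens n)" "?V \<in> free_alg (aff_gens n)" using col by (auto intro!: word_free)
  have pq: "part_color p \<in> basis n" "part_color q \<in> basis n" using col by auto
  obtain \<kappa> where \<kappa>: "\<And>i. aff_eq n k (gen (Loop (bracket (?X (part_color p)) (?X (part_color q))) i))
      (\<Sum>c\<in>basis n. scal (\<kappa> c) * gen (Loop (?X c) i))"
    using basis_span[OF bracket_sp[OF basis_sp[OF pq(1)] basis_sp[OF pq(2)]]] by blast
  \<comment> \<open>Two degrees of equal sign have sum zero only if both are zero, and then the
    central term has coefficient zero.\<close>
  have d: "?d \<noteq> 0 \<or> part_deg p = 0" using sg by (auto simp: sgn_if split: if_splits)
  have "aff_eq n k (part_gen n xr p * part_gen n xr q)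
     (part_gen n xr q * part_gen n xr p + gen (Loop (bracket (?X (part_color p)) (?X (part_color q))) ?d))"
    unfolding part_gen_def using d by (intro aff_eq_comm basis_sp pq) auto
  also have "aff_eq n k \<dots> (part_gen n xr q * part_gen n xr p + (\<Sum>c\<in>basis n. scal (\<kappa> c) * gen (Loop (?X c) ?d)))"
    by (intro aff_eq_add aff_eq_refl \<kappa>)
  finally have "aff_eq n k (?U * (part_gen n xr p * part_gen n xr q) * ?V)
     (?U * (part_gen n xr q * part_gen n xr p + (\<Sum>c\<in>basis n. scal (\<kappa> c) * gen (Loop (?X c) ?d))) * ?V)"
    by (intro aff_eq_rmult aff_eq_lmult f)
  moreover have "?U * (\<Sum>c\<in>basis n. scal (\<kappa> c) * gen (Loop (?X c) ?d)) * ?V = (\<Sum>c\<in>basis n. scal (\<kappa> c) * word n xr (u @ Part c ?d # v))"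
    by (simp add: sum_distrib_left sum_distrib_right word_def part_gen_def scal_left_comm mult.assoc)
  moreover have "word n xr (u @ p # q # v) = ?U * (part_gen n xr p * part_gen n xr q) * ?V"
    "word n xr (u @ q # p # v) = ?U * (part_gen n xr q * part_gen n xr p) * ?V"
    by (simp_all add: word_def mult.assoc)
  ultimately have "aff_eq n k (word n xr (u @ p # q # v))
     (word n xr (u @ q # p # v) + (\<Sum>c\<in>basis n. scal (\<kappa> c) * word n xr (u @ Part c ?d # v)))"
    by (simp only: distrib_left distrib_right)
  then have A: "aff_eq n k (word n xr (u @ p # q # v) - word n xr (u @ q # p # v)) (\<Sum>c\<in>basis n. scal (\<kappa> c) * word n xr (u @ Part c ?d # v))"
    unfolding aff_eq_def by (simp only: diff_diff_eq)
  have W: "spanned n k xr (lower (u @ p # q # v)) (word n xr (u @ Part c ?d # v))" if c: "c \<in> basis n" for c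
  proof -
    let ?w = "u @ Part c ?d # v"
    have m: "max ?d 0 = max (part_deg p) 0 + max (part_deg q) 0"
      using sg by (auto simp: sgn_if max_def split: if_splits)
    have sd: "sgn ?d = sgn (part_deg p)" using sg by (auto simp: sgn_if split: if_splits)
    have "sign_sorted ?w" using ss sd by (simp add: sign_sorted_def sorted_append)
    then have sp: "spanned n k xr (lower ?w) (word n xr ?w - cp_elem n xr (mset ?w))"
      by (intro IH) (use col c in auto)
    have eq: "cp_deg (mset ?w) = cp_deg (mset (u @ p # q # v))" "pos_deg (mset ?w) = pos_deg (mset (u @ p # q # v))"
      using m by (simp_all add: cp_deg_def pos_deg_def)
    have "lower ?w \<subseteq> lower (u @ p # q # v)" unfolding eq by (auto simp: bounded_partitions_def)
    with sp have "spanned n k xr (lower (u @ p # q # v)) (word n xr ?w - cp_elem n xr (mset ?w))"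
      by (rule spanned_mono) (rule finite_bounded_partitions)
    moreover have "spanned n k xr (lower (u @ p # q # v)) (cp_elem n xr (mset ?w))"
    proof (rule spanned_cp_elem[OF _ finite_bounded_partitions])
      have "mset ?w \<in> colored_partitions n" using col c by (auto simp: colored_partitions_def)
      moreover have "size (mset ?w) \<le> length (u @ p # q # v) - 1" by simp
      ultimately show "mset ?w \<in> lower (u @ p # q # v)" unfolding bounded_partitions_def mem_Collect_eq
        by (intro conjI eq)
    qed
    ultimately have "spanned n k xr (lower (u @ p # q # v)) ((word n xr ?w - cp_elem n xr (mset ?w)) + cp_elem n xr (mset ?w))"
      by (intro spanned_add)
    then show ?thesis by (simp only: diff_add_cancel)
  qed
  have "spanned n k xr (lower (u @ p # q # v)) (\<Sum>c\<in>basis n. scal (\<kappa> c) * word n xr (u @ Part c ?d # v))"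
    by (rule spanned_sum, rule spanned_scal, rule W)
  then show ?thesis using A by (rule spanned_aff_eq)
qed

text \<open>Insertion sort by adjacent exchanges. An inversion has nonincreasing degrees while the
  signs are nondecreasing, so only parts of equal sign are ever exchanged.\<close>

lemma reorder:
  assumes "\<And>p. p \<in> set ws \<Longrightarrow> part_color p \<in> basis n" "sign_sorted ws"
  shows "spanned n k xr (lower ws) (word n xr ws - cp_elem n xr (mset ws))"
  using assms
proof (induction "length ws" arbitrary: ws rule: less_induct)
  case (less ws)
  let ?ok = "\<lambda>xs. mset xs = mset ws \<and> sign_sorted xs"
  let ?R = "\<lambda>xs ys. spanned n k xr (lower ws) (word n xr xs - word n xr ys)"
  have trans: "?R xs zs" if "?R xs ys" "?R ys zs" for xs ys zs
    using spanned_add[OF that] by simp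
  have refl: "?R xs xs" for xs by (simp add: spanned_zero)
  have swap: "?R (u @ p # q # v) (u @ q # p # v)" if ok: "?ok (u @ p # q # v)" and sg: "sgn (part_deg p) = sgn (part_deg q)" for u v p q
  proof -
    have l: "length (u @ p # q # v) = length ws" using ok by (metis size_mset)
    have s: "set (u @ p # q # v) = set ws" using ok by (metis set_mset_mset)
    have "spanned n k xr (lower (u @ p # q # v)) (word n xr (u @ p # q # v) - word n xr (u @ q # p # v))"
    proof (rule swap_adjacent)
      show "spanned n k xr (lower ws') (word n xr ws' - cp_elem n xr (mset ws'))"
        if "length ws' < length (u @ p # q # v)" "\<And>p. p \<in> set ws' \<Longrightarrow> part_color p \<in> basis n" "sign_sorted ws'" for ws'
        using that unfolding l by (rule less.hyps)
      show "part_color x \<in> basis n" if "x \<in> set (u @ p # q # v)" for x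
        using that less.prems(1) unfolding s by blast
    qed (use ok sg in auto)
    then show ?thesis using ok unfolding l by simp
  qed
  have insort: "?R (u @ x # ys @ v) (u @ insort x ys @ v) \<and> ?ok (u @ insort x ys @ v)"
    if "?ok (u @ x # ys @ v)" for u x ys v
    using that
  proof (induction ys arbitrary: u)
    case Nil
    then show ?case by (simp add: spanned_zero)
  next
    case (Cons y ys)
    show ?case
    proof (cases "x \<le> y")
      case True
      then show ?thesis using Cons.prems by (simp add: spanned_zero)
    next
      case False
      then have "y < x" by simp
      then have "part_deg y \<le> part_deg x" by (auto simp: less_part_def)
      moreover have "sgn (part_deg x) \<le> sgn (part_deg y)" using Cons.prems by (auto simp: sign_sorted_def sorted_append)
      ultimately have sg: "sgn (part_deg x) = sgn (part_deg y)" by (auto simp: sgn_if split: if_splits)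
      have ok: "?ok (u @ y # x # ys @ v)" using Cons.prems sg by (auto simp: sign_sorted_def add_mset_commute)
      have "?R (u @ x # y # ys @ v) (u @ y # x # ys @ v)"
        by (rule swap) (use Cons.prems sg in auto)
      moreover have "?R ((u @ [y]) @ x # ys @ v) ((u @ [y]) @ insort x ys @ v) \<and> ?ok ((u @ [y]) @ insort x ys @ v)"
        by (rule Cons.IH) (use ok in simp)
      ultimately show ?thesis using False trans by simp
    qed
  qed
  have sort: "?R (u @ xs) (u @ sort xs) \<and> ?ok (u @ sort xs)" if "?ok (u @ xs)" for u xs
    using that
  proof (induction xs arbitrary: u)
    case Nil
    then show ?case by (simp add: spanned_zero)
  next
    case (Cons x xs)
    have 1: "?R ((u @ [x]) @ xs) ((u @ [x]) @ sort xs) \<and> ?ok ((u @ [x]) @ sort xs)"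
      by (rule Cons.IH) (use Cons.prems in simp)
    then have 2: "?R (u @ x # sort xs @ []) (u @ insort x (sort xs) @ []) \<and> ?ok (u @ insort x (sort xs) @ [])"
      by (intro insort) simp
    have "?R (u @ x # xs) (u @ insort x (sort xs))"
      by (rule trans[of _ "u @ x # sort xs"]) (use 1 2 in simp_all)
    then show ?case using 2 by simp
  qed
  have "?R ([] @ ws) ([] @ sort ws)" by (rule conjunct1, rule sort) (use less.prems(2) in simp)
  then show ?case unfolding cp_elem_word append_Nil sorted_list_of_multiset_mset .
qed

end

section \<open>Orders on colored partitions\<close>

text \<open>At the first difference from the right, \<open>y\<close> exceeds everything that is left
  of \<open>xs\<close>, which decides the multiset order. That order is compatible with unions, so
  the comparisons are carried out in it.\<close>

lemma rev_lex_less_imp_mset_less: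
  fixes xs ys :: "'a::linorder list"
  assumes "rev_lex_less xs ys" "sorted xs" "sorted ys"
  shows "mset xs < mset ys"
proof -
  from assms(1) obtain us x xs' y ys' where r: "rev xs = us @ x # xs'" "rev ys = us @ y # ys'" "x < y" "length xs = length ys"
    unfolding rev_lex_less_def lex_conv by auto
  have xs: "xs = rev xs' @ [x] @ rev us" using r(1) by (metis append.assoc append_Cons append_Nil rev.simps(2) rev_append rev_rev_ident)
  have ys: "ys = rev ys' @ [y] @ rev us" using r(2) by (metis append.assoc append_Cons append_Nil rev.simps(2) rev_append rev_rev_ident)
  have le: "z < y" if "z \<in># mset (x # xs')" for z
    using that assms(2) r(3) unfolding xs by (auto simp: sorted_append)
  have "mset (x # xs') < mset (y # ys')"
    unfolding less_multiset\<^sub>H\<^sub>O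
  proof (intro conjI allI impI)
    show "mset (x # xs') \<noteq> mset (y # ys')" using le[of y] by (metis less_irrefl list.set_intros(1) set_mset_mset)
    fix z assume "count (mset (y # ys')) z < count (mset (x # xs')) z"
    then have "z \<in># mset (x # xs')" by (metis count_eq_zero_iff not_less_zero)
    moreover have "y \<notin># mset (x # xs')" using le[of y] by blast
    then have "count (mset (x # xs')) y = 0" by (simp only: not_in_iff)
    moreover have "0 < count (mset (y # ys')) y" by simp
    ultimately show "\<exists>w>z. count (mset (x # xs')) w < count (mset (y # ys')) w"
      using le by (intro exI[of _ y]) auto
  qed
  then have "mset us + mset (x # xs') < mset us + mset (y # ys')" by simp
  then show ?thesis unfolding xs ys by (simp add: add_ac)
qed

lemma rev_lex_less_total:
  fixes xs ys :: "'a::linorder list"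
  assumes "length xs = length ys" "xs \<noteq> ys"
  shows "rev_lex_less xs ys \<or> rev_lex_less ys xs"
proof -
  have "rev xs \<noteq> rev ys" using assms(2) by simp
  then have "\<exists>us x xs' y ys'. x \<noteq> y \<and> rev xs = us @ x # xs' \<and> rev ys = us @ y # ys'"
    using same_length_different[of "rev xs" "rev ys"] assms(1) by (auto simp: append_Cons)
  then obtain us x xs' y ys' where r: "x \<noteq> y" "rev xs = us @ x # xs'" "rev ys = us @ y # ys'" by blast
  have l: "length (rev xs) = length (rev ys)" using assms(1) by simp
  from r(1) consider "x < y" | "y < x" by (metis linorder_less_linear)
  then show ?thesis
  proof cases
    case 1
    then show ?thesis using l unfolding rev_lex_less_def lex_conv r(2,3) by blast
  next
    case 2
    then show ?thesis using l unfolding rev_lex_less_def lex_conv r(2,3) by (intro disjI2) (simp, blast)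
  qed
qed

section \<open>Nested families of intervals\<close>

definition contents :: "color multiset \<Rightarrow> index multiset" where
  "contents M = image_mset row M + image_mset col M"

lemma contents_union [simp]: "contents (M + N) = contents M + contents N"
  by (simp add: contents_def)

lemma contents_add_mset [simp]: "contents (add_mset x M) = add_mset (row x) (add_mset (col x) (contents M))"
  by (simp add: contents_def)

text \<open>The counting function of a multiset. For equal sizes, smaller counts at every
  \<open>x\<close> mean larger elements; endpoint families are compared in this sense.\<close>

definition below :: "'a::linorder \<Rightarrow> 'a multiset \<Rightarrow> nat" where
  "below x M = size (filter_mset (\<lambda>c. c < x) M)"

lemma below_union [simp]: "below x (M + N) = below x M + below x N"
  by (simp add: below_def)

lemma below_contents: "below x (contents M) = size (filter_mset (\<lambda>c. row c < x) M) + size (filter_mset (\<lambda>c. col c < x) M)"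
  by (simp add: contents_def below_def filter_mset_image_mset comp_def)

definition nested :: "color multiset \<Rightarrow> bool" where
  "nested M \<longleftrightarrow> (\<forall>x\<in>#M. \<forall>y\<in>#M. (row x \<le> row y \<and> col y \<le> col x) \<or> (row y \<le> row x \<and> col x \<le> col y))"

lemma size_filter_mono: "(\<And>x. x \<in># M \<Longrightarrow> P x \<Longrightarrow> Q x) \<Longrightarrow> size (filter_mset P M) \<le> size (filter_mset Q M)"
  by (induction M) (auto simp: le_SucI)

lemma size_filter_all: "(\<And>x. x \<in># M \<Longrightarrow> P x) \<Longrightarrow> size (filter_mset P M) = size M"
  by (induction M) auto

lemma size_filter_none: "(\<And>x. x \<in># M \<Longrightarrow> \<not> P x) \<Longrightarrow> size (filter_mset P M) = 0"
  by (induction M) auto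

lemma size_filter_split: "size M = size (filter_mset P M) + size (filter_mset (\<lambda>c. \<not> P c) M)"
  by (induction M) auto

text \<open>Among all families of intervals with at least the same endpoints, a nested family is minimal. At the largest color
  in which the two families differ, counting the endpoints below its row and below its column gives a contradiction.\<close>

lemma nested_minimal:
  assumes nested: "nested M" and iv: "\<And>x. x \<in># M \<Longrightarrow> row x \<le> col x" "\<And>x. x \<in># M' \<Longrightarrow> row x \<le> col x"
    and size: "size M = size M'" and dom: "\<And>x. below x (contents M') \<le> below x (contents M)"
  shows "M \<le> M'"
proof (rule ccontr)
  assume "\<not> M \<le> M'"
  then have lt: "M' < M" by (rule not_le_imp_less)
  have neq: "M' \<noteq> M" using lt by (rule less_imp_neq)
  have HO: "\<forall>z. count M z < count M' z \<longrightarrow> (\<exists>w>z. count M' w < count M w)"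
    using lt unfolding less_multiset\<^sub>H\<^sub>O by (rule conjunct2)
  define S where "S = {z \<in> set_mset M \<union> set_mset M'. count M z \<noteq> count M' z}"
  have "finite S" unfolding S_def by (rule finite_subset[of _ "set_mset M \<union> set_mset M'"]) auto
  have S: "z \<in> S \<longleftrightarrow> count M z \<noteq> count M' z" for z
  proof -
    have "z \<in># M \<or> z \<in># M'" if "count M z \<noteq> count M' z"
      by (rule ccontr) (use that in \<open>simp add: not_in_iff\<close>)
    then show ?thesis by (auto simp: S_def)
  qed
  obtain z0 where "count M' z0 \<noteq> count M z0" using neq by (auto simp: multiset_eq_iff)
  then have "z0 \<in> S" using S[of z0] by simp
  then have "S \<noteq> {}" by auto
  define y where "y = Max S"
  have yS: "y \<in> S" unfolding y_def by (rule Max_in) fact+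
  have ymax: "count M z = count M' z" if "y < z" for z
  proof (rule ccontr)
    assume "count M z \<noteq> count M' z"
    then have "z \<le> y" unfolding y_def using S \<open>finite S\<close> by (intro Max_ge) auto
    then show False using that by simp
  qed
  have cy: "count M' y < count M y"
  proof (rule ccontr)
    assume "\<not> count M' y < count M y"
    then have "count M y < count M' y" using yS S by force
    then have "\<exists>w>y. count M' w < count M w" by (rule HO[rule_format])
    then show False using ymax by auto
  qed
  define K where "K = M \<inter># M'"
  define A where "A = M - K"
  define A' where "A' = M' - K"
  have MA: "M = K + A" "M' = K + A'" by (rule multiset_eqI, simp add: A_def A'_def K_def)+
  have sz: "size A = size A'" using size unfolding MA by simp
  have yA: "y \<in># A" using cy by (simp add: A_def K_def in_diff_count)
  have A: "z \<le> y" if "z \<in># A" for z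
  proof (rule ccontr)
    assume "\<not> z \<le> y"
    then have "count M z = count M' z" by (intro ymax) simp
    then show False using that by (simp add: A_def K_def in_diff_count)
  qed
  have A': "z < y" if "z \<in># A'" for z
  proof (rule ccontr)
    assume "\<not> z < y"
    then consider "z = y" | "y < z" by fastforce
    then have "count M' z \<le> count M z" by cases (use cy ymax[of z] in simp_all)
    then show False using that by (simp add: A'_def K_def in_diff_count)
  qed
  have dom': "below x (contents A') \<le> below x (contents A)" for x
    using dom[of x] unfolding MA by simp
  let ?p = "row y" and ?q = "col y"
  let ?f = "\<lambda>P N. size (filter_mset P N)"
  have pq: "?p \<le> ?q" using iv(1) yA MA by simp
  \<comment> \<open>As \<open>y\<close> is the largest color left in \<open>A\<close>, an interval
    comparable with it either starts strictly lower and contains it, or starts at the same row and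
    lies inside it.\<close>
  have nest: "(row z < ?p \<and> ?q \<le> col z) \<or> (row z = ?p \<and> col z \<le> ?q)" if "z \<in># A" for z
  proof -
    have "z \<le> y" using A that by blast
    moreover have "(row z \<le> ?p \<and> ?q \<le> col z) \<or> (?p \<le> row z \<and> col z \<le> ?q)"
      using nested[unfolded nested_def, rule_format, of z y] that yA MA(1) by auto
    ultimately show ?thesis by (auto simp: less_eq_color_def)
  qed
  have A'2: "row z < ?p \<or> (row z = ?p \<and> col z < ?q)" "row z \<le> col z" if "z \<in># A'" for z
    using A'[OF that] iv(2)[of z] that unfolding MA by (auto simp: less_color_def)
  define s where "s = ?f (\<lambda>c. row c = ?p) A"
  define s' where "s' = ?f (\<lambda>c. row c = ?p) A'"
  have sA: "?f (\<lambda>c. row c < ?p) A = size A - s" "s \<le> size A"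
  proof -
    have "filter_mset (\<lambda>c. row c < ?p) A = filter_mset (\<lambda>c. \<not> row c = ?p) A"
      by (rule filter_mset_cong[OF refl]) (use nest in auto)
    then show "?f (\<lambda>c. row c < ?p) A = size A - s" "s \<le> size A" using size_filter_split[of A "\<lambda>c. row c = ?p"] by (simp_all add: s_def)
  qed
  have sA': "?f (\<lambda>c. row c < ?p) A' = size A' - s'" "s' \<le> size A'"
  proof -
    have "filter_mset (\<lambda>c. row c < ?p) A' = filter_mset (\<lambda>c. \<not> row c = ?p) A'"
      by (rule filter_mset_cong[OF refl]) (use A'2(1) in auto)
    then show "?f (\<lambda>c. row c < ?p) A' = size A' - s'" "s' \<le> size A'" using size_filter_split[of A' "\<lambda>c. row c = ?p"] by (simp_all add: s'_def)
  qed
  have "?f (\<lambda>c. col c < ?p) A = 0"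
  proof (rule size_filter_none)
    fix z assume z: "z \<in># A"
    then have "row z \<le> col z" using iv(1) MA by simp
    then show "\<not> col z < ?p" using nest[OF z] pq by auto
  qed
  \<comment> \<open>No column of \<open>A\<close> lies below \<open>?p\<close>, so only the rows
    different from \<open>?p\<close> count there; the bound then leaves \<open>A'\<close> at least
    as many intervals with row \<open>?p\<close> as \<open>A\<close> has.\<close>
  with dom'[of ?p] sA sA' sz have ss: "s \<le> s'"
    unfolding below_contents by linarith
  have "s \<noteq> 0" using yA by (auto simp: s_def)
  then have "s' \<noteq> 0" using ss by linarith
  obtain z where z: "z \<in># A'" "row z = ?p"
  proof (rule ccontr)
    assume "\<not> thesis"
    have "s' = 0" unfolding s'_def
    proof (rule size_filter_none)
      fix z assume "z \<in># A'"
      from that[OF this] \<open>\<not> thesis\<close> show "row z \<noteq> ?p" by fast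
    qed
    then show False using \<open>s' \<noteq> 0\<close> by contradiction
  qed
  then have "?p < ?q" using A'2[OF z(1)] by auto
  have "?f (\<lambda>c. row c < ?q) A' = size A'"
  proof (rule size_filter_all)
    fix c assume "c \<in># A'"
    from A'2(1)[OF this] have "row c \<le> ?p" by auto
    then show "row c < ?q" using \<open>?p < ?q\<close> by (rule le_less_trans)
  qed
  moreover have "s' \<le> ?f (\<lambda>c. col c < ?q) A'"
    unfolding s'_def
  proof (rule size_filter_mono)
    fix c assume "c \<in># A'" "row c = ?p"
    from A'2(1)[OF this(1)] this(2) show "col c < ?q" by auto
  qed
  moreover have "?f (\<lambda>c. row c < ?q) A \<le> size A" by (rule size_filter_mset_lesseq)
  \<comment> \<open>In \<open>A\<close> only intervals with row \<open>?p\<close> can end below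
    \<open>?q\<close>, and \<open>y\<close> itself does not; in \<open>A'\<close> all
    \<open>s'\<close> of them do. This strict gain is the contradiction.\<close>
  moreover have "?f (\<lambda>c. col c < ?q) A < s"
  proof -
    obtain N where N: "A = add_mset y N" using multi_member_split[OF yA] by blast
    have "?f (\<lambda>c. col c < ?q) A = ?f (\<lambda>c. col c < ?q) N" by (simp add: N)
    also have "\<dots> \<le> ?f (\<lambda>c. row c = ?p) N"
    proof (rule size_filter_mono)
      fix c assume "c \<in># N" and c: "col c < ?q"
      then have "c \<in># A" by (simp add: N)
      from nest[OF this] c show "row c = ?p" by (elim disjE conjE) simp_all
    qed
    also have "\<dots> < s" by (simp add: s_def N)
    finally show ?thesis .
  qed
  ultimately show False using dom'[of ?q] ss sz unfolding below_contents by linarith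
qed

section \<open>Root vectors in the defining representation\<close>

definition idx :: "nat \<Rightarrow> nat \<Rightarrow> index" where
  "idx n a = (if a < n then Plain (a + 1) else Under (a - n + 1))"

definition wt :: "nat \<Rightarrow> nat \<Rightarrow> weight" where
  "wt n a = (if a < n then eps (a + 1) else - eps (a - n + 1))"

definition color_of :: "nat \<Rightarrow> nat \<Rightarrow> nat \<Rightarrow> color" where
  "color_of n a b = Color (max (idx n a) (idx n b)) (min (idx n a) (idx n b))"

lemma idx_in: "a < 2 * n \<Longrightarrow> idx n a \<in> indices n"
  by (auto simp: idx_def indices_def)

lemma idx_inj: "a < 2 * n \<Longrightarrow> b < 2 * n \<Longrightarrow> idx n a = idx n b \<longleftrightarrow> a = b"
  by (auto simp: idx_def split: if_splits)

lemma idx_surj: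
  assumes "i \<in> indices n" obtains a where "a < 2 * n" "i = idx n a"
proof (cases i)
  case (Plain j)
  then show ?thesis using assms that[of "j - 1"] by (auto simp: indices_def idx_def)
next
  case (Under j)
  then show ?thesis using assms that[of "n + j - 1"] by (auto simp: indices_def idx_def)
qed

lemma color_of_basis: "a < 2 * n \<Longrightarrow> b < 2 * n \<Longrightarrow> color_of n a b \<in> basis n"
  by (auto simp: color_of_def basis_def max_def min_def idx_in)

lemma color_of_commute: "color_of n a b = color_of n b a"
  by (simp add: color_of_def max.commute min.commute)

lemma basis_color_of:
  assumes "c \<in> basis n" obtains a b where "a < 2 * n" "b < 2 * n" "c = color_of n a b" "col c = idx n a" "row c = idx n b"
proof -
  obtain i j where c: "c = Color i j" "i \<in> indices n" "j \<in> indices n" "j \<le> i" using assms by (auto simp: basis_def)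
  obtain a where a: "a < 2 * n" "i = idx n a" using c idx_surj by metis
  obtain b where b: "b < 2 * n" "j = idx n b" using c idx_surj by metis
  show thesis by (rule that[OF a(1) b(1)]) (use a b c in \<open>auto simp: color_of_def max_def min_def\<close>)
qed

lemma color_of_eq_iff:
  assumes "a < 2 * n" "b < 2 * n" "c < 2 * n" "d < 2 * n"
  shows "color_of n a b = color_of n c d \<longleftrightarrow> (a = c \<and> b = d) \<or> (a = d \<and> b = c)"
  using assms by (auto simp: color_of_def max_def min_def idx_inj split: if_splits)

text \<open>The eigenvalue of the diagonal generator number \<open>m\<close> on basis vector
  \<open>a\<close>, that is, the coefficient of \<epsilon> with index \<open>m + 1\<close> in its
  weight.\<close>

definition charge :: "nat \<Rightarrow> nat \<Rightarrow> nat \<Rightarrow> int" where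
  "charge n a m = (if a = m then 1 else if a = m + n then - 1 else 0)"

lemma lookup_wt: "a < 2 * n \<Longrightarrow> m < n \<Longrightarrow> Poly_Mapping.lookup (wt n a) (m + 1) = charge n a m"
  by (auto simp: wt_def eps_def charge_def lookup_single when_def)

lemma charge_dual: "a < 2 * n \<Longrightarrow> m < n \<Longrightarrow> charge n (dual n a) m = - charge n a m"
  by (auto simp: charge_def dual_def)

text \<open>A signed unit vector is a coordinate number \<open>v\<close> with a sign
  \<open>g\<close>. Two sums of such vectors are compared at the two coordinates of the second sum
  only.\<close>

lemma sign_sum_cancel:
  fixes gs gt ga gb :: int and vs vt va vb :: nat
  assumes g: "gs = 1 \<or> gs = -1" "gt = 1 \<or> gt = -1" "ga = 1 \<or> ga = -1" "gb = 1 \<or> gb = -1"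
  and opp: "\<not> (va = vb \<and> ga = - gb)"
  and e: "(if vs = va then gs else 0) + (if vt = va then gt else 0) = (if va = va then ga else 0) + (if vb = va then gb else 0)"
     "(if vs = vb then gs else 0) + (if vt = vb then gt else 0) = (if va = vb then ga else 0) + (if vb = vb then gb else 0)"
  shows "(vs = va \<and> gs = ga \<and> vt = vb \<and> gt = gb) \<or> (vs = vb \<and> gs = gb \<and> vt = va \<and> gt = ga)"
  using g
proof (elim disjE)
qed (use opp e in \<open>simp_all split: if_splits\<close>)

text \<open>A nonzero sum of two signed unit vectors determines both of them. This makes the root
  spaces one-dimensional; \<open>b \<noteq> dual n a\<close> excludes weight zero.\<close>

lemma charge_pair:
  assumes "s < 2 * n" "t < 2 * n" "a < 2 * n" "b < 2 * n" "b \<noteq> dual n a"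
    and eq: "\<And>m. m < n \<Longrightarrow> charge n s m + charge n t m = charge n a m + charge n b m"
  shows "(s = a \<and> t = b) \<or> (s = b \<and> t = a)"
proof -
  define v where "v a = (if a < n then a else a - n)" for a
  define g :: "nat \<Rightarrow> int" where "g a = (if a < n then 1 else - 1)" for a
  have ch: "charge n c m = (if v c = m then g c else 0)" if "c < 2 * n" "m < n" for c m
    using that by (auto simp: charge_def v_def g_def)
  have v: "v s < n" "v t < n" "v a < n" "v b < n" using assms by (auto simp: v_def)
  have g: "g c = 1 \<or> g c = - 1" for c by (simp add: g_def)
  have same: "c = d" if "c < 2 * n" "d < 2 * n" "v c = v d" "g c = g d" for c d
    using that by (auto simp: v_def g_def split: if_splits)
  have opp: "\<not> (v a = v b \<and> g a = - g b)"
    using assms(3-5) by (auto simp: v_def g_def dual_def split: if_splits)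
  have "(v s = v a \<and> g s = g a \<and> v t = v b \<and> g t = g b) \<or> (v s = v b \<and> g s = g b \<and> v t = v a \<and> g t = g a)"
  proof (rule sign_sum_cancel[OF g g g g opp])
    show "(if v s = v a then g s else 0) + (if v t = v a then g t else 0) = (if v a = v a then g a else 0) + (if v b = v a then g b else 0)"
      using eq[OF v(3)] unfolding ch[OF assms(1) v(3)] ch[OF assms(2) v(3)] ch[OF assms(3) v(3)] ch[OF assms(4) v(3)] .
    show "(if v s = v b then g s else 0) + (if v t = v b then g t else 0) = (if v a = v b then g a else 0) + (if v b = v b then g b else 0)"
      using eq[OF v(4)] unfolding ch[OF assms(1) v(4)] ch[OF assms(2) v(4)] ch[OF assms(3) v(4)] ch[OF assms(4) v(4)] .
  qed
  then show ?thesis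
    using same[OF assms(1,3)] same[OF assms(2,4)] same[OF assms(1,4)] same[OF assms(2,3)] by argo
qed

definition unit_cartan :: "nat \<Rightarrow> nat \<Rightarrow> complex mat" where
  "unit_cartan n m = mat (2 * n) (2 * n) (\<lambda>(p, q). if p = q then of_int (charge n p m) else 0)"

lemma unit_cartan_in: "m < n \<Longrightarrow> unit_cartan n m \<in> cartan n"
  unfolding cartan_def sp_iff
  by (auto simp: unit_cartan_def diagonal_mat_def dual_less dual_eq_iff charge_dual dual_dual sgn_pos_dual)

lemma weight_eval_unit_cartan:
  assumes "m < n" shows "weight_eval n \<alpha> (unit_cartan n m) = of_int (Poly_Mapping.lookup \<alpha> (m + 1))"
proof -
  have "weight_eval n \<alpha> (unit_cartan n m) = (\<Sum>i = 1..n. if i = m + 1 then of_int (Poly_Mapping.lookup \<alpha> (m + 1)) else 0)"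
    unfolding weight_eval_def by (rule sum.cong) (auto simp: unit_cartan_def charge_def split: if_splits)
  then show ?thesis using assms by simp
qed

lemma bracket_unit_cartan:
  assumes "x \<in> carrier_mat (2 * n) (2 * n)" "s < 2 * n" "r < 2 * n"
  shows "bracket (unit_cartan n m) x $$ (s, r) = of_int (charge n s m - charge n r m) * x $$ (s, r)"
proof -
  have h: "unit_cartan n m \<in> carrier_mat (2 * n) (2 * n)" by (simp add: unit_cartan_def)
  have "(\<Sum>c<2*n. unit_cartan n m $$ (s, c) * x $$ (c, r)) = (\<Sum>c<2*n. if c = s then of_int (charge n s m) * x $$ (s, r) else 0)"
    by (rule sum.cong) (use assms in \<open>auto simp: unit_cartan_def\<close>)
  moreover have "(\<Sum>c<2*n. x $$ (s, c) * unit_cartan n m $$ (c, r)) = (\<Sum>c<2*n. if c = r then of_int (charge n r m) * x $$ (s, r) else 0)"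
    by (rule sum.cong) (use assms in \<open>auto simp: unit_cartan_def\<close>)
  ultimately show ?thesis using assms by (simp add: bracket_entry[OF h assms(1)] algebra_simps)
qed

text \<open>The diagonal generators force every nonzero entry of \<open>x\<close> onto the entries
  of \<open>quad n a b\<close>, and the symplectic condition ties the two entries together.\<close>

lemma root_space_quad:
  assumes x: "x \<in> root_space n (wt n a + wt n b)" and ab: "a < 2 * n" "b < 2 * n" "b \<noteq> dual n a"
  shows "\<exists>c. \<forall>i<2*n. \<forall>j<2*n. x $$ (i, j) = c * quad n a b $$ (i, j)"
proof -
  have sp: "x \<in> sp n" and c: "x \<in> carrier_mat (2 * n) (2 * n)" using x spD by (auto simp: root_space_def)
  have z: "(i = a \<and> dual n j = b) \<or> (i = b \<and> dual n j = a)" if "i < 2 * n" "j < 2 * n" "x $$ (i, j) \<noteq> 0" for i j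
  proof (rule charge_pair[OF that(1) dual_less[OF that(2)] ab])
    fix m assume m: "m < n"
    have "bracket (unit_cartan n m) x = weight_eval n (wt n a + wt n b) (unit_cartan n m) \<cdot>\<^sub>m x"
      using x unit_cartan_in[OF m] by (auto simp: root_space_def)
    then have "of_int (charge n i m - charge n j m) * x $$ (i, j) = of_int (charge n a m + charge n b m) * x $$ (i, j)"
      using bracket_unit_cartan[OF c that(1,2), of m] c that ab m
      by (simp only: weight_eval_unit_cartan[OF m] lookup_add lookup_wt index_smult_mat carrier_matD)
    then have "(of_int (charge n i m - charge n j m) :: complex) = of_int (charge n a m + charge n b m)"
      using that(3) by simp
    then have "charge n i m - charge n j m = charge n a m + charge n b m"
      by (simp only: of_int_eq_iff)
    then show "charge n i m + charge n (dual n j) m = charge n a m + charge n b m"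
      using charge_dual[OF that(2) m] by simp
  qed
  have sym: "sgn_pos n (dual n a) * x $$ (a, dual n b) = sgn_pos n (dual n b) * x $$ (b, dual n a)"
  proof -
    have "sgn_pos n (dual n a) * x $$ (dual n (dual n a), dual n b) = sgn_pos n (dual n b) * x $$ (dual n (dual n b), dual n a)"
      using sp dual_less[OF ab(1)] dual_less[OF ab(2)] unfolding sp_iff by blast
    then show ?thesis using ab by (simp add: dual_dual)
  qed
  then have sym': "sgn_pos n a * x $$ (a, dual n b) = sgn_pos n b * x $$ (b, dual n a)" using ab by (simp add: sgn_pos_dual)
  have zz: "x $$ (i, j) = 0" if "i < 2*n" "j < 2*n" "\<not> (i = a \<and> j = dual n b)" "\<not> (i = b \<and> j = dual n a)" for i j
    using z[OF that(1,2)] that dual_dual by metis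
  have q: "quad n a b $$ (i, j) = 0" if "i < 2*n" "j < 2*n" "\<not> (i = a \<and> j = dual n b)" "\<not> (i = b \<and> j = dual n a)" for i j
    using that(3,4) by (simp only: quad_entry[OF that(1,2)] if_False add_0)
  show ?thesis
  proof (cases "a = b")
    case True
    \<comment> \<open>For \<open>a = b\<close> both summands of \<open>quad\<close> fall on the same
      entry, whence the factor 2.\<close>
    have "quad n a b $$ (a, dual n b) = 2 * sgn_pos n b" using ab True by (simp add: quad_entry dual_less)
    then have v: "x $$ (a, dual n b) = (x $$ (a, dual n b) / (2 * sgn_pos n b)) * quad n a b $$ (a, dual n b)"
      using sgn_pos_nz[of n b] by simp
    show ?thesis
    proof (intro exI[of _ "x $$ (a, dual n b) / (2 * sgn_pos n b)"] allI impI)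
      fix i j assume ij: "i < 2*n" "j < 2*n"
      show "x $$ (i, j) = x $$ (a, dual n b) / (2 * sgn_pos n b) * quad n a b $$ (i, j)"
      proof (cases "i = a \<and> j = dual n b")
        case True
        then show ?thesis using v by simp
      next
        case False
        then show ?thesis using zz[OF ij] q[OF ij] \<open>a = b\<close> by simp
      qed
    qed
  next
    case False
    have dn: "dual n a \<noteq> dual n b" using False ab dual_inj by simp
    have q1: "quad n a b $$ (a, dual n b) = sgn_pos n b" using ab False dn by (simp add: quad_entry dual_less)
    have q2: "quad n a b $$ (b, dual n a) = sgn_pos n a" using ab False dn by (simp add: quad_entry dual_less)
    let ?c = "x $$ (a, dual n b) * sgn_pos n b"
    have v1: "x $$ (a, dual n b) = ?c * quad n a b $$ (a, dual n b)"
      using sgn_pos_sq[of n b] by (simp add: q1 mult.assoc)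
    have "x $$ (b, dual n a) = sgn_pos n b * (sgn_pos n b * x $$ (b, dual n a))"
      using sgn_pos_sq[of n b] by (simp flip: mult.assoc)
    also have "\<dots> = ?c * quad n a b $$ (b, dual n a)" unfolding sym'[symmetric] q2 by (simp only: ac_simps)
    finally have v2: "x $$ (b, dual n a) = ?c * quad n a b $$ (b, dual n a)" .
    show ?thesis
    proof (intro exI[of _ ?c] allI impI)
      fix i j assume ij: "i < 2*n" "j < 2*n"
      consider "i = a \<and> j = dual n b" | "i = b \<and> j = dual n a" | "\<not> (i = a \<and> j = dual n b)" "\<not> (i = b \<and> j = dual n a)" by blast
      then show "x $$ (i, j) = ?c * quad n a b $$ (i, j)"
      proof cases
        case 1
        then show ?thesis using v1 by simp
      next
        case 2
        then show ?thesis using v2 by simp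
      next
        case 3
        then show ?thesis using zz[OF ij] q[OF ij] by simp
      qed
    qed
  qed
qed

lemma wt_root:
  assumes "a < 2 * n" "b < 2 * n" "b \<noteq> dual n a"
  shows "wt n a + wt n b \<in> roots n" "\<exists>m<n. Poly_Mapping.lookup (wt n a + wt n b) (m + 1) \<noteq> 0"
proof -
  show nz: "\<exists>m<n. Poly_Mapping.lookup (wt n a + wt n b) (m + 1) \<noteq> 0"
  proof (rule ccontr)
    assume "\<not> ?thesis"
    then have z: "charge n a m + charge n b m = 0" if "m < n" for m
      using that assms lookup_wt by (simp add: lookup_add)
    define m where "m = (if a < n then a else a - n)"
    have "m < n" using assms by (auto simp: m_def)
    from z[OF this] show False using assms unfolding m_def charge_def dual_def by (auto split: if_splits)
  qed
  define i where "i = (if a < n then a + 1 else a - n + 1)"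
  define j where "j = (if b < n then b + 1 else b - n + 1)"
  have ij: "i \<in> {1..n}" "j \<in> {1..n}" using assms by (auto simp: i_def j_def)
  have "wt n a + wt n b \<in> {eps i + eps j, eps i - eps j, - (eps i + eps j), - (eps i - eps j)}"
    by (simp add: wt_def i_def j_def)
  moreover have "wt n a + wt n b \<noteq> 0" using nz by auto
  ultimately show "wt n a + wt n b \<in> roots n" unfolding roots_def using ij by blast
qed

text \<open>A zero vector would have zero bracket with its opposite, but that bracket is a coroot,
  with a nonzero diagonal entry.\<close>

lemma root_vector_nonzero:
  assumes rv: "root_vectors n xr" and \<alpha>: "\<alpha> \<in> roots n" and m: "m < n" "Poly_Mapping.lookup \<alpha> (m + 1) \<noteq> 0"
  shows "\<exists>i<2*n. \<exists>j<2*n. xr \<alpha> $$ (i, j) \<noteq> 0"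
proof (rule ccontr)
  assume z: "\<not> ?thesis"
  have neg: "- \<alpha> \<in> roots n"
  proof -
    obtain i j where ij: "i \<in> {1..n}" "j \<in> {1..n}" "\<alpha> \<in> {eps i + eps j, eps i - eps j, - (eps i + eps j), - (eps i - eps j)}" "\<alpha> \<noteq> 0"
      using \<alpha> unfolding roots_def by blast
    then have "- \<alpha> \<in> {eps i + eps j, eps i - eps j, - (eps i + eps j), - (eps i - eps j)}" "- \<alpha> \<noteq> 0" by auto
    then show ?thesis unfolding roots_def using ij by blast
  qed
  have x: "xr \<alpha> \<in> carrier_mat (2*n) (2*n)" "xr (- \<alpha>) \<in> carrier_mat (2*n) (2*n)" and br: "bracket (xr \<alpha>) (xr (- \<alpha>)) = coroot n \<alpha>"
    using rv \<alpha> neg spD unfolding root_vectors_def root_space_def by blast+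
  have "bracket (xr \<alpha>) (xr (- \<alpha>)) $$ (m, m) = 0"
    using m z by (subst bracket_entry[OF x]) (auto intro!: sum.neutral)
  moreover have "coroot n \<alpha> $$ (m, m) = coroot_coeff n \<alpha> (m + 1)" using m by (simp add: coroot_def)
  moreover have "coroot_coeff n \<alpha> (m + 1) \<noteq> 0"
  proof -
    have "0 < (\<Sum>l = 1..n. (Poly_Mapping.lookup \<alpha> l)\<^sup>2)"
      by (rule sum_pos2[of _ "m + 1"]) (use m in auto)
    then show ?thesis using m(2) unfolding coroot_coeff_def by (simp only: divide_eq_0_iff mult_eq_0_iff of_int_eq_0_iff) simp
  qed
  ultimately show False unfolding br by simp
qed

lemma basis_elem_root:
  assumes "idx n b \<le> idx n a" "a < 2 * n" "b < 2 * n" "b \<noteq> dual n a"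
  shows "basis_elem n xr (Color (idx n a) (idx n b)) = xr (wt n a + wt n b)"
  using assms by (auto simp: idx_def wt_def dual_def)

section \<open>Coroots and the triangular change of basis\<close>

lemma lookup_simple_root: "Poly_Mapping.lookup (simple_root n l) i =
    (if l < n then of_bool (i = l) - of_bool (i = l + 1) else 2 * of_bool (i = n))"
  by (cases "l < n") (simp_all only: simple_root_def if_True if_False lookup_add lookup_minus eps_def lookup_single when_def, auto)

text \<open>The sum of squares is 2 for the simple roots with \<open>l < n\<close> and 4 for the
  long one, so the coroot has the coefficients 1 and -1 in the first case and the single coefficient
  1 in the second.\<close>

lemma coroot_entry:
  assumes l: "l \<in> {1..n}" and pq: "p < 2 * n" "q < 2 * n"
  shows "coroot n (simple_root n l) $$ (p, q) = (if p \<noteq> q then 0 else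
    if p < n then of_bool (p + 1 = l) - of_bool (p = l) else of_bool (p - n = l) - of_bool (p - n + 1 = l))"
proof -
  have c: "coroot_coeff n (simple_root n l) (p + 1) = of_bool (p + 1 = l) - of_bool (p = l)" if "p < n" for p
  proof (cases "l < n")
    case True
    have "(\<Sum>i = 1..n. (Poly_Mapping.lookup (simple_root n l) i)\<^sup>2) = (\<Sum>i = 1..n. (if i = l then 1 else 0) + (if i = l + 1 then 1 else 0))"
      by (rule sum.cong) (use True in \<open>auto simp: lookup_simple_root\<close>)
    also have "\<dots> = 2" using l True by (simp add: sum.distrib)
    finally show ?thesis using True by (auto simp: coroot_coeff_def lookup_simple_root)
  next
    case False
    then have ln: "l = n" using l by auto
    have "(\<Sum>i = 1..n. (Poly_Mapping.lookup (simple_root n l) i)\<^sup>2) = (\<Sum>i = 1..n. (if i = n then 4 else 0))"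
      by (rule sum.cong) (use ln in \<open>auto simp: lookup_simple_root\<close>)
    also have "\<dots> = 4" using l ln by simp
    finally show ?thesis using ln that by (auto simp: coroot_coeff_def lookup_simple_root)
  qed
  show ?thesis using pq c[of p] c[of "p - n"] by (cases "p = q"; cases "p < n") (simp_all add: coroot_def)
qed

lemma coroot_sp:
  assumes "l \<in> {1..n}" shows "coroot n (simple_root n l) \<in> sp n"
  unfolding sp_iff
proof (intro conjI allI impI)
  show "coroot n (simple_root n l) \<in> carrier_mat (2 * n) (2 * n)" by (simp add: coroot_def)
  fix a b assume ab: "a < 2 * n" "b < 2 * n"
  show "sgn_pos n a * coroot n (simple_root n l) $$ (dual n a, b) = sgn_pos n b * coroot n (simple_root n l) $$ (dual n b, a)"
  proof (cases "b = dual n a")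
    case True
    then show ?thesis using ab unfolding coroot_entry[OF assms dual_less[OF ab(1)] ab(2)] coroot_entry[OF assms dual_less[OF ab(2)] ab(1)]
      by (auto simp: dual_def sgn_pos_def)
  next
    case False
    then show ?thesis using ab dual_dual[OF ab(1)] dual_dual[OF ab(2)]
      unfolding coroot_entry[OF assms dual_less[OF ab(1)] ab(2)] coroot_entry[OF assms dual_less[OF ab(2)] ab(1)] by auto
  qed
qed

lemma basis_elem_noncartan:
  assumes rv: "root_vectors n xr" and ab: "a < 2 * n" "b < 2 * n" "b \<noteq> dual n a"
  shows "basis_elem n xr (color_of n a b) \<in> sp n"
    and "\<exists>c. c \<noteq> 0 \<and> (\<forall>i<2*n. \<forall>j<2*n. quad n a b $$ (i, j) = c * basis_elem n xr (color_of n a b) $$ (i, j))"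
proof -
  have *: "basis_elem n xr (color_of n a b) = xr (wt n a + wt n b)"
  proof (cases "idx n b \<le> idx n a")
    case True
    then show ?thesis using basis_elem_root[OF True ab] by (simp add: color_of_def max_def min_def split: if_splits) (metis antisym)
  next
    case False
    then have le: "idx n a \<le> idx n b" by simp
    have "a \<noteq> dual n b" using ab dual_dual by metis
    from basis_elem_root[OF le ab(2,1) this] le False show ?thesis
      by (simp add: color_of_def max_def min_def add.commute)
  qed
  have rs: "xr (wt n a + wt n b) \<in> root_space n (wt n a + wt n b)"
    using rv wt_root(1)[OF ab] by (simp add: root_vectors_def)
  then show "basis_elem n xr (color_of n a b) \<in> sp n" unfolding * by (simp add: root_space_def)
  obtain c where c: "\<forall>i<2*n. \<forall>j<2*n. xr (wt n a + wt n b) $$ (i, j) = c * quad n a b $$ (i, j)"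
    using root_space_quad[OF rs ab] by blast
  obtain m where "m < n" "Poly_Mapping.lookup (wt n a + wt n b) (m + 1) \<noteq> 0" using wt_root(2)[OF ab] by blast
  from root_vector_nonzero[OF rv wt_root(1)[OF ab] this] have "c \<noteq> 0" using c by auto
  then show "\<exists>c. c \<noteq> 0 \<and> (\<forall>i<2*n. \<forall>j<2*n. quad n a b $$ (i, j) = c * basis_elem n xr (color_of n a b) $$ (i, j))"
    unfolding * using c by (intro exI[of _ "1 / c"]) simp
qed

lemma color_of_dual:
  assumes "a < n" shows "color_of n a (dual n a) = Color (Plain (a + 1)) (Under (a + 1))"
  using assms by (simp add: color_of_def idx_def dual_def max_def min_def)

text \<open>The simple coroots from \<open>a + 1\<close> to \<open>n\<close> telescope to the coroot
  of twice \<epsilon> with index \<open>a + 1\<close>. The minus sign is that of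
  \<open>sgn_pos n (dual n a)\<close>.\<close>

lemma quad_dual_coroots:
  assumes a: "a < n" and ij: "i < 2 * n" "j < 2 * n"
  shows "quad n a (dual n a) $$ (i, j) = (\<Sum>l\<in>{a + 1..n}. - coroot n (simple_root n l) $$ (i, j))"
proof (cases "i = j")
  case True
  have s: "(\<Sum>l\<in>{a + 1..n}. of_bool (p + 1 = l) - of_bool (p = l)) = (of_bool (p = a) :: complex)" if "p < n" for p
    using that a by (auto simp: sum_subtractf of_bool_def)
  have "(\<Sum>l\<in>{a + 1..n}. coroot n (simple_root n l) $$ (i, j)) = (if i < n then of_bool (i = a) else - of_bool (i - n = a))"
  proof (cases "i < n")
    case True
    have "(\<Sum>l\<in>{a + 1..n}. coroot n (simple_root n l) $$ (i, j)) = (\<Sum>l\<in>{a + 1..n}. of_bool (i + 1 = l) - of_bool (i = l))"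
      by (rule sum.cong[OF refl]) (use coroot_entry ij True \<open>i = j\<close> in auto)
    then show ?thesis using s[OF True] True by simp
  next
    case False
    have "(\<Sum>l\<in>{a + 1..n}. coroot n (simple_root n l) $$ (i, j)) = (\<Sum>l\<in>{a + 1..n}. - (of_bool (i - n + 1 = l) - of_bool (i - n = l)))"
      by (rule sum.cong[OF refl]) (use coroot_entry ij False \<open>i = j\<close> in auto)
    also have "\<dots> = - of_bool (i - n = a)" using s[of "i - n"] ij False by (simp only: sum_negf)
    finally show ?thesis using False by simp
  qed
  then show ?thesis using ij a True by (auto simp: quad_entry sum_negf dual_def sgn_pos_def)
next
  case False
  have "(\<Sum>l\<in>{a + 1..n}. - coroot n (simple_root n l) $$ (i, j)) = 0"
    by (rule sum.neutral) (use coroot_entry ij False in auto)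
  then show ?thesis using False ij a by (auto simp: quad_entry dual_def)
qed

lemma basis_elem_in_sp:
  assumes "root_vectors n xr" "c \<in> basis n" shows "basis_elem n xr c \<in> sp n"
proof -
  obtain a b where ab: "a < 2 * n" "b < 2 * n" "c = color_of n a b" using basis_color_of[OF assms(2)] by metis
  show ?thesis
  proof (cases "b = dual n a")
    case True
    define m where "m = (if a < n then a else dual n a)"
    have m: "m < n" using ab by (auto simp: m_def dual_def)
    have "c = color_of n m (dual n m)" using ab True dual_dual[OF ab(1)] color_of_commute by (auto simp: m_def)
    then show ?thesis using m coroot_sp[of "m + 1" n] by (simp add: color_of_dual)
  next
    case False
    then show ?thesis using basis_elem_noncartan(1)[OF assms(1) ab(1,2)] ab(3) by simp
  qed
qed

text \<open>In root directions a single color occurs. In Cartan directions coroots of larger number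
  occur too, but their rows \<open>Under l\<close> are larger, so the color of the pair is the
  smallest one.\<close>

lemma quad_expansion:
  assumes rv: "root_vectors n xr" and ab: "a < 2 * n" "b < 2 * n"
  shows "\<exists>\<kappa>. (\<forall>i<2*n. \<forall>j<2*n. quad n a b $$ (i, j) = (\<Sum>c\<in>basis n. \<kappa> c * basis_elem n xr c $$ (i, j)))
    \<and> \<kappa> (color_of n a b) \<noteq> 0 \<and> (\<forall>c. \<kappa> c \<noteq> 0 \<longrightarrow> color_of n a b \<le> c)"
proof (cases "b = dual n a")
  case False
  obtain d where d: "d \<noteq> 0" "\<forall>i<2*n. \<forall>j<2*n. quad n a b $$ (i, j) = d * basis_elem n xr (color_of n a b) $$ (i, j)"
    using basis_elem_noncartan(2)[OF rv ab False] by blast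
  have "(\<Sum>c\<in>basis n. (if c = color_of n a b then d else 0) * basis_elem n xr c $$ (i, j)) = d * basis_elem n xr (color_of n a b) $$ (i, j)" for i j
  proof -
    have "(\<Sum>c\<in>basis n. (if c = color_of n a b then d else 0) * basis_elem n xr c $$ (i, j))
       = (\<Sum>c\<in>basis n. if c = color_of n a b then d * basis_elem n xr (color_of n a b) $$ (i, j) else 0)"
      by (rule sum.cong) auto
    then show ?thesis using color_of_basis[OF ab] by simp
  qed
  then show ?thesis using d by (intro exI[of _ "\<lambda>c. if c = color_of n a b then d else 0"]) auto
next
  case True
  define m where "m = (if a < n then a else dual n a)"
  have m: "m < n" using ab by (auto simp: m_def dual_def)
  have cm: "color_of n a b = color_of n m (dual n m)" "quad n a b = quad n m (dual n m)"
    using ab True dual_dual[OF ab(1)] color_of_commute quad_commute by (auto simp: m_def)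
  define L where "L = (\<lambda>l. Color (Plain l) (Under l)) ` {m + 1..n}"
  have L: "L \<subseteq> basis n" by (auto simp: L_def basis_def indices_def)
  have inj: "inj_on (\<lambda>l. Color (Plain l) (Under l)) {m + 1..n}" by (auto simp: inj_on_def)
  have mL: "color_of n a b \<in> L" using m by (auto simp: cm color_of_dual L_def)
  show ?thesis
  proof (intro exI[of _ "\<lambda>c. if c \<in> L then - 1 else 0"] conjI allI impI)
    fix i j assume ij: "i < 2 * n" "j < 2 * n"
    have "(\<Sum>c\<in>basis n. (if c \<in> L then - 1 else 0) * basis_elem n xr c $$ (i, j)) = (\<Sum>c\<in>L. - basis_elem n xr c $$ (i, j))"
      using L by (intro sum.mono_neutral_cong_right) auto
    also have "\<dots> = (\<Sum>l\<in>{m + 1..n}. - coroot n (simple_root n l) $$ (i, j))"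
      unfolding L_def by (subst sum.reindex[OF inj]) simp
    finally show "quad n a b $$ (i, j) = (\<Sum>c\<in>basis n. (if c \<in> L then - 1 else 0) * basis_elem n xr c $$ (i, j))"
      unfolding cm quad_dual_coroots[OF m ij] by simp
  next
    show "(if color_of n a b \<in> L then - 1 else 0) \<noteq> (0::complex)" using mL by simp
  next
    fix c assume "(if c \<in> L then - 1 else 0) \<noteq> (0::complex)"
    then have "c \<in> L" by (simp split: if_splits)
    then show "color_of n a b \<le> c" unfolding cm color_of_dual[OF m] L_def by (auto simp: less_eq_color_def less_index_def)
  qed
qed

text \<open>The coefficients can be indexed by the color: it determines the pair up to order, and
  \<open>quad\<close> is symmetric.\<close>

lemma quad_expansions:
  assumes rv: "root_vectors n xr"
  obtains \<kappa> :: "color \<Rightarrow> color \<Rightarrow> complex" where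
    "\<And>a b i j. a < 2 * n \<Longrightarrow> b < 2 * n \<Longrightarrow> i < 2 * n \<Longrightarrow> j < 2 * n \<Longrightarrow>
      quad n a b $$ (i, j) = (\<Sum>c\<in>basis n. \<kappa> (color_of n a b) c * basis_elem n xr c $$ (i, j))"
    "\<And>c. c \<in> basis n \<Longrightarrow> \<kappa> c c \<noteq> 0" "\<And>c d. c \<in> basis n \<Longrightarrow> \<kappa> c d \<noteq> 0 \<Longrightarrow> c \<le> d"
proof -
  define Q where "Q c \<kappa> \<longleftrightarrow> (\<forall>a<2*n. \<forall>b<2*n. color_of n a b = c \<longrightarrow> (\<forall>i<2*n. \<forall>j<2*n. quad n a b $$ (i, j) = (\<Sum>d\<in>basis n. \<kappa> d * basis_elem n xr d $$ (i, j))))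
      \<and> \<kappa> c \<noteq> 0 \<and> (\<forall>d. \<kappa> d \<noteq> 0 \<longrightarrow> c \<le> d)" for c and \<kappa> :: "color \<Rightarrow> complex"
  have "\<exists>\<kappa>. Q c \<kappa>" if c: "c \<in> basis n" for c
  proof -
    obtain a b where ab: "a < 2 * n" "b < 2 * n" "c = color_of n a b" using basis_color_of[OF c] by metis
    from quad_expansion[OF rv ab(1,2)]
    obtain k where k: "\<forall>i<2*n. \<forall>j<2*n. quad n a b $$ (i, j) = (\<Sum>c\<in>basis n. k c * basis_elem n xr c $$ (i, j))"
      "k (color_of n a b) \<noteq> 0" "\<forall>c. k c \<noteq> 0 \<longrightarrow> color_of n a b \<le> c"
      by (elim exE conjE)
    have "quad n a' b' = quad n a b" if "a' < 2*n" "b' < 2*n" "color_of n a' b' = c" for a' b'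
      using that ab color_of_eq_iff[of a' n b' a b] quad_commute by auto
    then show ?thesis using k ab(3) by (intro exI[of _ k]) (simp add: Q_def)
  qed
  then have "\<forall>c\<in>basis n. \<exists>\<kappa>. Q c \<kappa>" by (intro ballI)
  from bchoice[OF this] obtain K where K: "\<forall>c\<in>basis n. Q c (K c)" by (elim exE)
  show thesis
  proof (rule that[of K])
    show "quad n a b $$ (i, j) = (\<Sum>c\<in>basis n. K (color_of n a b) c * basis_elem n xr c $$ (i, j))"
      if "a < 2 * n" "b < 2 * n" "i < 2 * n" "j < 2 * n" for a b i j
      using bspec[OF K color_of_basis[OF that(1,2)]] that by (simp add: Q_def)
    show "K c c \<noteq> 0" if "c \<in> basis n" for c using bspec[OF K that] by (simp add: Q_def)
    show "c \<le> d" if "c \<in> basis n" "K c d \<noteq> 0" for c d using bspec[OF K that(1)] that(2) by (simp add: Q_def)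
  qed
qed

text \<open>The numbers \<open>sgn_pos n b * x $$ (a, dual n b)\<close> are the symmetric
  coordinates of \<open>x\<close>; the half compensates for running over ordered pairs.\<close>

lemma gen_span_quads:
  assumes x: "x \<in> sp n"
  shows "aff_eq n k (gen (Loop x i)) (\<Sum>(a, b)\<in>{..<2*n} \<times> {..<2*n}. scal (sgn_pos n b * x $$ (a, dual n b) / 2) * gen (Loop (quad n a b) i))"
proof -
  have c: "x \<in> carrier_mat (2*n) (2*n)" using x by (rule spD)
  have "aff_eq n k (gen (Loop x i)) (\<Sum>t\<in>{..<2*n} \<times> {..<2*n}. scal (sgn_pos n (snd t) * x $$ (fst t, dual n (snd t)) / 2) * gen (Loop (quad n (fst t) (snd t)) i))"
  proof (rule conjunct2[OF aff_eq_gen_lincomb])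
    fix p q assume pq: "p < 2 * n" "q < 2 * n"
    let ?S = "\<lambda>a b. sgn_pos n b * x $$ (a, dual n b)"
    have sym: "?S a b = ?S b a" if "a < 2*n" "b < 2*n" for a b
    proof -
      have "sgn_pos n (dual n b) * x $$ (dual n (dual n b), dual n a) = sgn_pos n (dual n a) * x $$ (dual n (dual n a), dual n b)"
        using x dual_less[OF that(1)] dual_less[OF that(2)] unfolding sp_iff by blast
      then have "sgn_pos n b * x $$ (b, dual n a) = sgn_pos n a * x $$ (a, dual n b)" using that by (simp add: dual_dual sgn_pos_dual)
      then have "sgn_pos n a * sgn_pos n a * (sgn_pos n b * x $$ (a, dual n b)) = sgn_pos n b * sgn_pos n b * (sgn_pos n a * x $$ (b, dual n a))"
        by (simp add: mult.left_commute mult.assoc)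
      then show ?thesis by (simp add: sgn_pos_sq)
    qed
    have x1: "?S p (dual n q) * sgn_pos n (dual n q) = x $$ (p, q)"
      using pq sgn_pos_sq[of n "dual n q"] by (simp add: dual_dual mult.assoc mult.left_commute)
    have "(\<Sum>t\<in>{..<2*n} \<times> {..<2*n}. ?S (fst t) (snd t) / 2 * quad n (fst t) (snd t) $$ (p, q))
       = (\<Sum>a<2*n. \<Sum>b<2*n. ?S a b / 2 * quad n a b $$ (p, q))"
      by (simp add: sum.cartesian_product split_beta)
    also have "\<dots> = (\<Sum>a<2*n. \<Sum>b<2*n. (if b = dual n q then if a = p then x $$ (p, q) / 2 else 0 else 0)
        + (if b = p then if a = dual n q then x $$ (p, q) / 2 else 0 else 0))"
    proof (intro sum.cong refl)
      fix a b assume "a \<in> {..<2*n}" "b \<in> {..<2*n}"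
      then have ab: "a < 2*n" "b < 2*n" by auto
      have e: "q = dual n b \<longleftrightarrow> b = dual n q" "q = dual n a \<longleftrightarrow> a = dual n q" using dual_eq_iff[OF pq(2) ab(1)] dual_eq_iff[OF pq(2) ab(2)] by auto
      have x2: "?S (dual n q) p * sgn_pos n (dual n q) = x $$ (p, q)" using x1 sym[OF pq(1) dual_less[OF pq(2)]] by simp
      show "?S a b / 2 * quad n a b $$ (p, q) = (if b = dual n q then if a = p then x $$ (p, q) / 2 else 0 else 0)
        + (if b = p then if a = dual n q then x $$ (p, q) / 2 else 0 else 0)"
        unfolding quad_entry[OF pq] e using x1 x2 by (auto simp: distrib_left mult.commute mult.left_commute)
    qed
    also have "\<dots> = x $$ (p, q)" using pq by (simp add: sum.distrib dual_less)
    finally show "x $$ (p, q) = (\<Sum>t\<in>{..<2*n} \<times> {..<2*n}. ?S (fst t) (snd t) / 2 * quad n (fst t) (snd t) $$ (p, q))" ..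
  qed (use c in \<open>auto intro: quad_sp\<close>)
  then show ?thesis by (simp add: split_beta)
qed

lemma spanning_basis_root_vectors:
  assumes rv: "root_vectors n xr" shows "spanning_basis n k xr"
proof
  show sp: "basis_elem n xr c \<in> sp n" if "c \<in> basis n" for c using basis_elem_in_sp[OF rv that] .
  fix x assume x: "x \<in> sp n"
  obtain \<kappa> :: "color \<Rightarrow> color \<Rightarrow> complex" where \<kappa>: "\<And>a b i j. a < 2 * n \<Longrightarrow> b < 2 * n \<Longrightarrow> i < 2 * n \<Longrightarrow> j < 2 * n \<Longrightarrow>
      quad n a b $$ (i, j) = (\<Sum>c\<in>basis n. \<kappa> (color_of n a b) c * basis_elem n xr c $$ (i, j))"
    "\<And>c. c \<in> basis n \<Longrightarrow> \<kappa> c c \<noteq> 0" "\<And>c d. c \<in> basis n \<Longrightarrow> \<kappa> c d \<noteq> 0 \<Longrightarrow> c \<le> d"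
    by (rule quad_expansions[OF rv], rule that) assumption+
  let ?s = "\<lambda>a b. sgn_pos n b * x $$ (a, dual n b) / 2"
  show "\<exists>\<kappa>. \<forall>i. aff_eq n k (gen (Loop x i)) (\<Sum>c\<in>basis n. scal (\<kappa> c) * gen (Loop (basis_elem n xr c) i))"
  proof (intro exI allI)
    fix i
    have "aff_eq n k (gen (Loop x i)) (\<Sum>(a, b)\<in>{..<2*n} \<times> {..<2*n}. scal (?s a b) * gen (Loop (quad n a b) i))"
      by (rule gen_span_quads[OF x])
    also have "aff_eq n k \<dots> (\<Sum>(a, b)\<in>{..<2*n} \<times> {..<2*n}. scal (?s a b) * (\<Sum>c\<in>basis n. scal (\<kappa> (color_of n a b) c) * gen (Loop (basis_elem n xr c) i)))"
    proof (intro aff_eq_sum, clarify)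
      fix a b assume ab: "a < 2 * n" "b < 2 * n"
      show "aff_eq n k (scal (?s a b) * gen (Loop (quad n a b) i)) (scal (?s a b) * (\<Sum>c\<in>basis n. scal (\<kappa> (color_of n a b) c) * gen (Loop (basis_elem n xr c) i)))"
        by (intro aff_eq_scal conjunct2[OF aff_eq_gen_lincomb]) (use \<kappa>(1) ab sp in auto)
    qed
    also have "\<dots> = (\<Sum>c\<in>basis n. scal (\<Sum>(a, b)\<in>{..<2*n} \<times> {..<2*n}. ?s a b * \<kappa> (color_of n a b) c) * gen (Loop (basis_elem n xr c) i))"
      by (simp add: sum_distrib_left sum_distrib_right scal_sum scal_mult_scal split_beta) (rule sum.swap)
    finally show "aff_eq n k (gen (Loop x i)) \<dots>" .
  qed
qed

section \<open>Expansion of symmetric tensors in colored partitions\<close>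

fun pair_colors :: "nat \<Rightarrow> nat list \<Rightarrow> color list" where
  "pair_colors n (a # b # ps) = color_of n a b # pair_colors n ps"
| "pair_colors n _ = []"

definition color_lists :: "nat \<Rightarrow> nat \<Rightarrow> color list set" where
  "color_lists n d = {cs. set cs \<subseteq> basis n \<and> length cs = d}"

lemma finite_color_lists [simp]: "finite (color_lists n d)"
  by (simp add: color_lists_def finite_lists_length_eq)

lemma color_lists_0: "color_lists n 0 = {[]}"
  by (auto simp: color_lists_def)

lemma sum_color_lists_Suc: "(\<Sum>cs\<in>color_lists n (Suc d). F cs) = (\<Sum>c\<in>basis n. \<Sum>cs\<in>color_lists n d. F (c # cs))"
proof -
  have e: "color_lists n (Suc d) = case_prod (#) ` (basis n \<times> color_lists n d)"
    by (auto simp: color_lists_def length_Suc_conv)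
  have i: "inj_on (case_prod (#)) (basis n \<times> color_lists n d)" by (auto simp: inj_on_def)
  show ?thesis unfolding e sum.reindex[OF i] by (simp add: sum.cartesian_product split_beta)
qed

definition kappa_weight :: "(color \<Rightarrow> color \<Rightarrow> complex) \<Rightarrow> color list \<Rightarrow> color list \<Rightarrow> complex" where
  "kappa_weight \<kappa> ds cs = prod_list (map2 \<kappa> ds cs)"

text \<open>Only colors enter, so the same coefficients serve all degree lists.\<close>

definition tensor_coeff :: "nat \<Rightarrow> (color \<Rightarrow> color \<Rightarrow> complex) \<Rightarrow> nat multiset \<Rightarrow> color list \<Rightarrow> complex" where
  "tensor_coeff n \<kappa> \<mu> cs = (\<Sum>ps\<in>arrangements \<mu>. kappa_weight \<kappa> (pair_colors n ps) cs)"

definition quad_coeffs :: "nat \<Rightarrow> (weight \<Rightarrow> complex mat) \<Rightarrow> (color \<Rightarrow> color \<Rightarrow> complex) \<Rightarrow> bool" where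
  "quad_coeffs n xr \<kappa> \<longleftrightarrow> (\<forall>a<2*n. \<forall>b<2*n. \<forall>i<2*n. \<forall>j<2*n.
      quad n a b $$ (i, j) = (\<Sum>c\<in>basis n. \<kappa> (color_of n a b) c * basis_elem n xr c $$ (i, j)))"

lemma map2_Part_props:
  assumes "length cs = length js"
  shows "map part_deg (map2 Part cs js) = js" "map part_color (map2 Part cs js) = cs" "length (map2 Part cs js) = length js"
  using assms by (induction cs js rule: list_induct2) auto

context spanning_basis
begin

lemma prod_quads_expansion:
  assumes \<kappa>: "quad_coeffs n xr \<kappa>"
    and ps: "set ps \<subseteq> {..<2*n}" "length ps = 2 * length js"
  shows "aff_eq n k (prod_quads n ps js)
    (\<Sum>cs\<in>color_lists n (length js). scal (kappa_weight \<kappa> (pair_colors n ps) cs) * word n xr (map2 Part cs js))"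
  using ps
proof (induction js arbitrary: ps)
  case Nil
  then show ?case by (simp add: color_lists_0 kappa_weight_def word_def)
next
  case (Cons j js)
  then obtain a b qs where ps: "ps = a # b # qs" by (cases ps; cases "tl ps") auto
  have ab: "a < 2 * n" "b < 2 * n" and qs: "set qs \<subseteq> {..<2*n}" "length qs = 2 * length js" using Cons.prems ps by auto
  let ?X = "\<lambda>c. gen (Loop (basis_elem n xr c) j)"
  let ?K = "\<kappa> (color_of n a b)"
  have 1: "aff_eq n k (gen (Loop (quad n a b) j)) (\<Sum>c\<in>basis n. scal (?K c) * ?X c)"
    by (rule conjunct2[OF aff_eq_gen_lincomb]) (use \<kappa> ab basis_sp in \<open>auto simp: quad_coeffs_def\<close>)
  have "aff_eq n k (gen (Loop (quad n a b) j) * prod_quads n qs js)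
     ((\<Sum>c\<in>basis n. scal (?K c) * ?X c) * (\<Sum>cs\<in>color_lists n (length js). scal (kappa_weight \<kappa> (pair_colors n qs) cs) * word n xr (map2 Part cs js)))"
  proof (rule aff_eq_mult[OF 1 Cons.IH[OF qs]])
    show "prod_quads n qs js \<in> free_alg (aff_gens n)" using qs(1) by (rule prod_quads_free)
    show "(\<Sum>c\<in>basis n. scal (?K c) * ?X c) \<in> free_alg (aff_gens n)"
      by (intro free_alg_sum free_alg_mult free_alg_scal loop_gen_free basis_sp)
  qed
  also have "(\<Sum>c\<in>basis n. scal (?K c) * ?X c) * (\<Sum>cs\<in>color_lists n (length js). scal (kappa_weight \<kappa> (pair_colors n qs) cs) * word n xr (map2 Part cs js))
     = (\<Sum>cs\<in>color_lists n (length (j # js)). scal (kappa_weight \<kappa> (pair_colors n ps) cs) * word n xr (map2 Part cs (j # js)))"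
    unfolding length_Cons sum_color_lists_Suc sum_distrib_left sum_distrib_right
  proof (subst sum.swap, intro sum.cong refl)
    fix c cs
    have K: "kappa_weight \<kappa> (pair_colors n ps) (c # cs) = ?K c * kappa_weight \<kappa> (pair_colors n qs) cs"
      by (simp add: ps kappa_weight_def)
    have W: "word n xr (map2 Part (c # cs) (j # js)) = ?X c * word n xr (map2 Part cs js)"
      by (simp add: word_def part_gen_def)
    show "scal (?K c) * ?X c * (scal (kappa_weight \<kappa> (pair_colors n qs) cs) * word n xr (map2 Part cs js))
      = scal (kappa_weight \<kappa> (pair_colors n ps) (c # cs)) * word n xr (map2 Part (c # cs) (j # js))"
      unfolding K W by (simp only: mult.assoc scal_left_comm[of "?X c"] scal_mult_scal)
  qed
  finally show ?case by (simp add: ps)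
qed

lemma sym_tensor_expansion:
  assumes \<kappa>: "quad_coeffs n xr \<kappa>"
    and \<mu>: "set_mset \<mu> \<subseteq> {..<2*n}" "size \<mu> = 2 * length js"
  shows "aff_eq n k (sym_tensor n \<mu> js)
    (\<Sum>cs\<in>color_lists n (length js). scal (tensor_coeff n \<kappa> \<mu> cs) * word n xr (map2 Part cs js))"
proof -
  have "aff_eq n k (sym_tensor n \<mu> js) (\<Sum>ps\<in>arrangements \<mu>. \<Sum>cs\<in>color_lists n (length js).
      scal (kappa_weight \<kappa> (pair_colors n ps) cs) * word n xr (map2 Part cs js))"
    unfolding sym_tensor_def
  proof (rule aff_eq_sum)
    fix ps assume "ps \<in> arrangements \<mu>"
    then have m: "mset ps = \<mu>" by (simp add: arrangements_def)
    have "set ps \<subseteq> {..<2*n}" using \<mu>(1) by (simp flip: m)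
    moreover have "length ps = 2 * length js" using \<mu>(2) by (simp flip: m)
    ultimately show "aff_eq n k (prod_quads n ps js) (\<Sum>cs\<in>color_lists n (length js).
      scal (kappa_weight \<kappa> (pair_colors n ps) cs) * word n xr (map2 Part cs js))"
      by (rule prod_quads_expansion[OF \<kappa>])
  qed
  also have "(\<Sum>ps\<in>arrangements \<mu>. \<Sum>cs\<in>color_lists n (length js).
      scal (kappa_weight \<kappa> (pair_colors n ps) cs) * word n xr (map2 Part cs js))
    = (\<Sum>cs\<in>color_lists n (length js). scal (tensor_coeff n \<kappa> \<mu> cs) * word n xr (map2 Part cs js))"
    by (subst sum.swap) (simp add: tensor_coeff_def scal_sum sum_distrib_right)
  finally show ?thesis .
qed

text \<open>Sorted degrees make all words \<open>sign_sorted\<close>. Reordering then alters them by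
  shorter partitions only, and the coefficients at full length can be read off from the
  words.\<close>

lemma sym_tensor_partitions:
  assumes \<kappa>: "quad_coeffs n xr \<kappa>"
    and \<mu>: "set_mset \<mu> \<subseteq> {..<2*n}" "size \<mu> = 2 * length js" and s: "sorted js" "js \<noteq> []"
  defines "P \<equiv> bounded_partitions n (length js) (sum_list js) (sum_list (map (\<lambda>i. max i 0) js))"
  shows "\<exists>C. aff_eq n k (sym_tensor n \<mu> js) (\<Sum>\<psi>\<in>P. scal (C \<psi>) * cp_elem n xr \<psi>) \<and>
    (\<forall>\<psi>. size \<psi> = length js \<longrightarrow> C \<psi> = (\<Sum>cs | cs \<in> color_lists n (length js) \<and> mset (map2 Part cs js) = \<psi>. tensor_coeff n \<kappa> \<mu> cs))"
proof -
  let ?d = "length js" and ?w = "\<lambda>cs. map2 Part cs js"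
  \<comment> \<open>The corrections from reordering have length at most \<open>?d - 1\<close>. As
    \<open>js\<close> is nonempty, this is strictly below \<open>?d\<close> despite truncated
    subtraction.\<close>
  define P' where "P' = bounded_partitions n (?d - 1) (sum_list js) (sum_list (map (\<lambda>i. max i 0) js))"
  have P': "P' \<subseteq> P" by (auto simp: P'_def P_def bounded_partitions_def)
  have fin: "finite P" "finite P'" by (simp_all add: P_def P'_def)
  have w: "length (?w cs) = ?d" "cp_deg (mset (?w cs)) = sum_list js" "pos_deg (mset (?w cs)) = sum_list (map (\<lambda>i. max i 0) js)"
    "sign_sorted (?w cs)" "\<And>p. p \<in> set (?w cs) \<Longrightarrow> part_color p \<in> basis n" if cs: "cs \<in> color_lists n ?d" for cs
  proof -
    have l: "length cs = length js" using cs by (simp add: color_lists_def)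
    show "length (?w cs) = ?d" using l by simp
    have "cp_deg (mset (?w cs)) = sum_list (map part_deg (?w cs))" by (simp add: cp_deg_def sum_mset_sum_list flip: mset_map)
    then show "cp_deg (mset (?w cs)) = sum_list js" by (simp only: map2_Part_props[OF l])
    have "pos_deg (mset (?w cs)) = sum_list (map (\<lambda>i. max i 0) (map part_deg (?w cs)))" by (simp add: pos_deg_def sum_mset_sum_list o_def flip: mset_map)
    then show "pos_deg (mset (?w cs)) = sum_list (map (\<lambda>i. max i 0) js)" by (simp only: map2_Part_props[OF l])
    have "map (\<lambda>p. sgn (part_deg p)) (?w cs) = map sgn (map part_deg (?w cs))" by simp
    then have "map (\<lambda>p. sgn (part_deg p)) (?w cs) = map sgn js" by (simp only: map2_Part_props[OF l])
    moreover have "sorted (map sgn js)" using s(1) by (induction js) (auto simp: sgn_if)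
    ultimately show "sign_sorted (?w cs)" by (simp only: sign_sorted_def)
    show "part_color p \<in> basis n" if "p \<in> set (?w cs)" for p
    proof -
      have "part_color p \<in> set (map part_color (?w cs))" using that by (simp only: set_map image_eqI)
      then show ?thesis using cs by (simp only: map2_Part_props[OF l]) (auto simp: color_lists_def)
    qed
  qed
  have "\<forall>cs\<in>color_lists n ?d. \<exists>L. aff_eq n k (word n xr (?w cs) - cp_elem n xr (mset (?w cs))) (\<Sum>\<psi>\<in>P'. scal (L \<psi>) * cp_elem n xr \<psi>)"
  proof
    fix cs assume cs: "cs \<in> color_lists n ?d"
    from reorder[OF w(5)[OF cs] w(4)[OF cs]]
    show "\<exists>L. aff_eq n k (word n xr (?w cs) - cp_elem n xr (mset (?w cs))) (\<Sum>\<psi>\<in>P'. scal (L \<psi>) * cp_elem n xr \<psi>)"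
      unfolding w(1,2,3)[OF cs] spanned_def P'_def .
  qed
  from bchoice[OF this] obtain L where L: "\<forall>cs\<in>color_lists n ?d. aff_eq n k (word n xr (?w cs) - cp_elem n xr (mset (?w cs))) (\<Sum>\<psi>\<in>P'. scal (L cs \<psi>) * cp_elem n xr \<psi>)"
    by (elim exE)
  define M where "M cs \<psi> = of_bool (mset (?w cs) = \<psi>) + (if \<psi> \<in> P' then L cs \<psi> else 0)" for cs \<psi>
  have M: "aff_eq n k (word n xr (?w cs)) (\<Sum>\<psi>\<in>P. scal (M cs \<psi>) * cp_elem n xr \<psi>)" if cs: "cs \<in> color_lists n ?d" for cs
  proof -
    have in_P: "mset (?w cs) \<in> P" unfolding P_def bounded_partitions_def mem_Collect_eq
      using w[OF cs] by (simp add: colored_partitions_def)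
    have "(\<Sum>\<psi>\<in>P. scal (of_bool (mset (?w cs) = \<psi>)) * cp_elem n xr \<psi>) = (\<Sum>\<psi>\<in>P. if mset (?w cs) = \<psi> then cp_elem n xr (mset (?w cs)) else 0)"
      by (rule sum.cong) auto
    also have "\<dots> = cp_elem n xr (mset (?w cs))" using in_P fin by simp
    finally have 1: "(\<Sum>\<psi>\<in>P. scal (of_bool (mset (?w cs) = \<psi>)) * cp_elem n xr \<psi>) = cp_elem n xr (mset (?w cs))" .
    have 2: "(\<Sum>\<psi>\<in>P. scal (if \<psi> \<in> P' then L cs \<psi> else 0) * cp_elem n xr \<psi>) = (\<Sum>\<psi>\<in>P'. scal (L cs \<psi>) * cp_elem n xr \<psi>)"
      using P' fin by (intro sum.mono_neutral_cong_right) auto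
    have "aff_eq n k (word n xr (?w cs)) (cp_elem n xr (mset (?w cs)) + (\<Sum>\<psi>\<in>P'. scal (L cs \<psi>) * cp_elem n xr \<psi>))"
      using bspec[OF L cs] unfolding aff_eq_def by (simp only: diff_diff_eq)
    then show ?thesis
      by (simp only: M_def scal_add distrib_right sum.distrib 1 2)
  qed
  define C where "C \<psi> = (\<Sum>cs\<in>color_lists n ?d. tensor_coeff n \<kappa> \<mu> cs * M cs \<psi>)" for \<psi>
  show ?thesis
  proof (intro exI[of _ C] conjI allI impI)
    have "aff_eq n k (sym_tensor n \<mu> js) (\<Sum>cs\<in>color_lists n ?d. scal (tensor_coeff n \<kappa> \<mu> cs) * (\<Sum>\<psi>\<in>P. scal (M cs \<psi>) * cp_elem n xr \<psi>))"
      by (rule aff_eq_trans[OF sym_tensor_expansion[OF \<kappa> \<mu>]]) (intro aff_eq_sum aff_eq_scal M)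
    also have "(\<Sum>cs\<in>color_lists n ?d. scal (tensor_coeff n \<kappa> \<mu> cs) * (\<Sum>\<psi>\<in>P. scal (M cs \<psi>) * cp_elem n xr \<psi>)) = (\<Sum>\<psi>\<in>P. scal (C \<psi>) * cp_elem n xr \<psi>)"
      by (simp add: C_def scal_sum sum_distrib_left sum_distrib_right scal_mult_scal) (rule sum.swap)
    finally show "aff_eq n k (sym_tensor n \<mu> js) (\<Sum>\<psi>\<in>P. scal (C \<psi>) * cp_elem n xr \<psi>)" .
    fix \<psi> :: "part multiset" assume sz: "size \<psi> = ?d"
    have "\<psi> \<notin> P'" using sz s(2) by (cases js) (simp_all add: P'_def bounded_partitions_def)
    then have "C \<psi> = (\<Sum>cs\<in>color_lists n ?d. if mset (?w cs) = \<psi> then tensor_coeff n \<kappa> \<mu> cs else 0)"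
      unfolding C_def M_def by (intro sum.cong refl) simp
    also have "\<dots> = (\<Sum>cs | cs \<in> color_lists n ?d \<and> mset (?w cs) = \<psi>. tensor_coeff n \<kappa> \<mu> cs)"
      by (rule sum.inter_filter[symmetric]) simp
    finally show "C \<psi> = \<dots>" .
  qed
qed

end

section \<open>Convergence\<close>

text \<open>Pigeonhole: at most \<open>d\<close> parts share the positive degree, so the largest has
  degree at least \<open>N\<close>, and it is the rightmost factor. Using \<open>max N 1\<close>
  keeps the bound positive for every \<open>N\<close>, which rules out the empty partition.\<close>

lemma cp_elem_nbhd:
  assumes sp: "\<And>c. c \<in> basis n \<Longrightarrow> basis_elem n xr c \<in> sp n" and \<psi>: "\<psi> \<in> colored_partitions n" "size \<psi> \<le> d"
    and D: "int d * max N 1 \<le> pos_deg \<psi>" "0 < d"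
  shows "cp_elem n xr \<psi> \<in> aff_nbhd n k N"
proof -
  let ?l = "sorted_list_of_multiset \<psi>"
  have "\<psi> \<noteq> {#}"
  proof
    assume "\<psi> = {#}"
    then have "int d * max N 1 \<le> 0" using D(1) by (simp add: pos_deg_def)
    moreover have "0 < int d * max N 1" using D(2) by (intro mult_pos_pos) auto
    ultimately show False by linarith
  qed
  have ne: "?l \<noteq> []"
  proof
    assume "?l = []"
    then have "mset ?l = {#}" by simp
    then show False using \<open>\<psi> \<noteq> {#}\<close> by simp
  qed
  define p where "p = last ?l"
  have l: "?l = butlast ?l @ [p]" using ne by (simp add: p_def)
  have col: "part_color q \<in> basis n" if "q \<in> set ?l" for q using that \<psi>(1) by (simp add: colored_partitions_def)
  have le: "part_deg q \<le> part_deg p" if "q \<in># \<psi>" for q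
  proof -
    have "sorted (butlast ?l @ [p])" unfolding l[symmetric] by (rule sorted_sorted_list_of_multiset)
    moreover have "q \<in> set (butlast ?l @ [p])" unfolding l[symmetric] using that by simp
    ultimately have "q \<le> p" by (auto simp: sorted_append)
    then show ?thesis by (auto simp: less_eq_part_def)
  qed
  have "N \<le> part_deg p"
  proof (rule ccontr)
    assume "\<not> N \<le> part_deg p"
    then have "max (part_deg q) 0 \<le> max N 1 - 1" if "q \<in># \<psi>" for q using le[OF that] by auto
    then have "(\<Sum>q\<in>#\<psi>. max (part_deg q) 0) \<le> (\<Sum>q\<in>#\<psi>. max N 1 - 1)" by (rule sum_mset_mono)
    then have "pos_deg \<psi> \<le> int (size \<psi>) * (max N 1 - 1)" by (simp add: pos_deg_def)
    also have "\<dots> \<le> int d * (max N 1 - 1)" using \<psi>(2) by (intro mult_right_mono) auto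
    also have "\<dots> < int d * max N 1" using D(2) by simp
    finally show False using D(1) by simp
  qed
  moreover have "cp_elem n xr \<psi> = word n xr (butlast ?l) * gen (Loop (basis_elem n xr (part_color p)) (part_deg p))"
    unfolding cp_elem_word by (subst l) (simp add: word_append word_def part_gen_def)
  moreover have "word n xr (butlast ?l) \<in> free_alg (aff_gens n)"
    unfolding word_def by (rule free_alg_prod_list) (auto simp: part_gen_def intro!: loop_gen_free sp col dest: in_set_butlastD)
  moreover have "basis_elem n xr (part_color p) \<in> sp n"
    unfolding p_def by (intro sp col last_in_set ne)
  ultimately show ?thesis by (simp add: nbhd_gen)
qed

lemma sum_list_pos_bounds:
  fixes js :: "int list"
  assumes "i \<in> set js"
  shows "i \<le> sum_list (map (\<lambda>i. max i 0) js)" "sum_list js - sum_list (map (\<lambda>i. max i 0) js) \<le> i"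
proof -
  have h: "0 \<le> sum_list (map (\<lambda>i. max i 0) xs) \<and> sum_list xs \<le> sum_list (map (\<lambda>i. max i 0) xs)" for xs :: "int list"
    by (induction xs) auto
  obtain us vs where js: "js = us @ i # vs" using split_list[OF assms] by (elim exE)
  show "i \<le> sum_list (map (\<lambda>i. max i 0) js)" "sum_list js - sum_list (map (\<lambda>i. max i 0) js) \<le> i"
    using h[of us] h[of vs] by (auto simp: js)
qed

lemma finite_rel_index_bounded: "finite {js \<in> rel_index k m. sum_list (map (\<lambda>i. max i 0) js) < D}"
proof (rule finite_subset)
  show "{js \<in> rel_index k m. sum_list (map (\<lambda>i. max i 0) js) < D} \<subseteq> {js. set js \<subseteq> {m - D..D} \<and> length js = k + 1}"
    using sum_list_pos_bounds by (fastforce simp: rel_index_def)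
qed (rule finite_lists_length_eq, simp)

text \<open>Degree lists and partitions are matched by their positive degree. Below the threshold
  \<open>D\<close> the two partial sums agree modulo the ideal; from \<open>D\<close> on, each
  single term lies in the neighbourhood.\<close>

lemma rel_expansion_from_terms:
  assumes sp: "\<And>c. c \<in> basis n \<Longrightarrow> basis_elem n xr c \<in> sp n"
    and C: "\<And>js. js \<in> rel_index k m \<Longrightarrow> aff_eq n k (rel_term n xr u js)
      (\<Sum>\<psi>\<in>bounded_partitions n (k + 1) m (sum_list (map (\<lambda>i. max i 0) js)). scal (C js \<psi>) * cp_elem n xr \<psi>)"
  shows "rel_expansion n k xr u m (\<lambda>\<psi>. \<Sum>js | js \<in> rel_index k m \<and> sum_list (map (\<lambda>i. max i 0) js) = pos_deg \<psi>. C js \<psi>)"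
  unfolding rel_expansion_def same_sum_def
proof
  fix N
  let ?pd = "\<lambda>js. sum_list (map (\<lambda>i. max i 0) js)"
  let ?c = "\<lambda>\<psi>. \<Sum>js | js \<in> rel_index k m \<and> ?pd js = pos_deg \<psi>. C js \<psi>"
  let ?I = "rel_index k m" and ?J = "rel_support n k m"
  let ?f = "rel_term n xr u" and ?g = "\<lambda>\<psi>. scal (?c \<psi>) * cp_elem n xr \<psi>"
  define D where "D = int (k + 1) * max N 1"
  define I0 where "I0 = {js \<in> ?I. ?pd js < D}"
  define J0 where "J0 = {\<psi> \<in> ?J. pos_deg \<psi> < D}"
  have fI: "finite I0" unfolding I0_def by (rule finite_rel_index_bounded)
  have fJ: "finite J0"
    by (rule finite_colored_partitions[of _ n "m - D" D "k + 1"])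
      (use part_deg_bounds in \<open>fastforce simp: J0_def rel_support_def colored_partitions_def\<close>)+
  have cpN: "cp_elem n xr \<psi> \<in> aff_nbhd n k N" if "\<psi> \<in> colored_partitions n" "size \<psi> \<le> k + 1" "D \<le> pos_deg \<psi>" for \<psi>
    by (rule cp_elem_nbhd[OF sp that(1,2)]) (use that(3) in \<open>simp_all add: D_def\<close>)
  have fN: "?f js \<in> aff_nbhd n k N" if "js \<in> ?I" "js \<notin> I0" for js
  proof (rule nbhd_aff_eq[OF _ aff_eq_sym[OF C[OF that(1)]]], rule nbhd_sum, rule nbhd_lmult[OF _ free_alg_scal], rule cpN)
    fix \<psi> assume "\<psi> \<in> bounded_partitions n (k + 1) m (?pd js)"
    then show "\<psi> \<in> colored_partitions n" "size \<psi> \<le> k + 1" "D \<le> pos_deg \<psi>"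
      using that by (auto simp: bounded_partitions_def I0_def)
  qed
  have gN: "?g \<psi> \<in> aff_nbhd n k N" if "\<psi> \<in> ?J" "\<psi> \<notin> J0" for \<psi>
    by (rule nbhd_lmult[OF cpN free_alg_scal]) (use that in \<open>auto simp: J0_def rel_support_def\<close>)
  have main: "aff_eq n k (\<Sum>js\<in>I0. ?f js) (\<Sum>\<psi>\<in>J0. ?g \<psi>)"
  proof -
    have "aff_eq n k (\<Sum>js\<in>I0. ?f js) (\<Sum>js\<in>I0. \<Sum>\<psi>\<in>bounded_partitions n (k + 1) m (?pd js). scal (C js \<psi>) * cp_elem n xr \<psi>)"
      by (rule aff_eq_sum, rule C) (simp add: I0_def)
    also have "(\<Sum>js\<in>I0. \<Sum>\<psi>\<in>bounded_partitions n (k + 1) m (?pd js). scal (C js \<psi>) * cp_elem n xr \<psi>)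
      = (\<Sum>js\<in>I0. \<Sum>\<psi>\<in>J0. if ?pd js = pos_deg \<psi> then scal (C js \<psi>) * cp_elem n xr \<psi> else 0)"
    proof (rule sum.cong[OF refl])
      fix js assume js: "js \<in> I0"
      have "bounded_partitions n (k + 1) m (?pd js) = {\<psi> \<in> J0. ?pd js = pos_deg \<psi>}"
        using js by (auto simp: bounded_partitions_def J0_def I0_def rel_support_def)
      then show "(\<Sum>\<psi>\<in>bounded_partitions n (k + 1) m (?pd js). scal (C js \<psi>) * cp_elem n xr \<psi>)
        = (\<Sum>\<psi>\<in>J0. if ?pd js = pos_deg \<psi> then scal (C js \<psi>) * cp_elem n xr \<psi> else 0)"
        using fJ by (simp only: sum.inter_filter)
    qed
    also have "\<dots> = (\<Sum>\<psi>\<in>J0. \<Sum>js\<in>I0. if ?pd js = pos_deg \<psi> then scal (C js \<psi>) * cp_elem n xr \<psi> else 0)"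
      by (rule sum.swap)
    also have "\<dots> = (\<Sum>\<psi>\<in>J0. ?g \<psi>)"
    proof (rule sum.cong[OF refl])
      fix \<psi> assume \<psi>: "\<psi> \<in> J0"
      have "{js \<in> I0. ?pd js = pos_deg \<psi>} = {js. js \<in> ?I \<and> ?pd js = pos_deg \<psi>}"
        using \<psi> by (auto simp: J0_def I0_def)
      then show "(\<Sum>js\<in>I0. if ?pd js = pos_deg \<psi> then scal (C js \<psi>) * cp_elem n xr \<psi> else 0) = ?g \<psi>"
        using fI by (simp only: sum.inter_filter[symmetric] scal_sum sum_distrib_right)
    qed
    finally show ?thesis .
  qed
  show "\<exists>I0 J0. finite I0 \<and> I0 \<subseteq> ?I \<and> finite J0 \<and> J0 \<subseteq> ?J \<and>
    (\<forall>I1 J1. finite I1 \<and> I0 \<subseteq> I1 \<and> I1 \<subseteq> ?I \<and> finite J1 \<and> J0 \<subseteq> J1 \<and> J1 \<subseteq> ?J \<longrightarrow>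
      (\<Sum>i\<in>I1. ?f i) - (\<Sum>\<psi>\<in>J1. ?g \<psi>) \<in> aff_nbhd n k N)"
  proof (intro exI[of _ I0] exI[of _ J0] conjI allI impI fI fJ)
    show "I0 \<subseteq> ?I" "J0 \<subseteq> ?J" by (auto simp: I0_def J0_def)
    fix I1 J1 assume a: "finite I1 \<and> I0 \<subseteq> I1 \<and> I1 \<subseteq> ?I \<and> finite J1 \<and> J0 \<subseteq> J1 \<and> J1 \<subseteq> ?J"
    have s: "(\<Sum>i\<in>I1. ?f i) = (\<Sum>i\<in>I1 - I0. ?f i) + (\<Sum>i\<in>I0. ?f i)" "(\<Sum>\<psi>\<in>J1. ?g \<psi>) = (\<Sum>\<psi>\<in>J1 - J0. ?g \<psi>) + (\<Sum>\<psi>\<in>J0. ?g \<psi>)"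
      using a by (simp_all only: sum.subset_diff)
    have "((\<Sum>i\<in>I1 - I0. ?f i) - (\<Sum>\<psi>\<in>J1 - J0. ?g \<psi>)) + ((\<Sum>i\<in>I0. ?f i) - (\<Sum>\<psi>\<in>J0. ?g \<psi>)) \<in> aff_nbhd n k N"
    proof (rule nbhd_add)
      show "(\<Sum>i\<in>I1 - I0. ?f i) - (\<Sum>\<psi>\<in>J1 - J0. ?g \<psi>) \<in> aff_nbhd n k N"
      proof (rule nbhd_minus; rule nbhd_sum)
        show "?f i \<in> aff_nbhd n k N" if "i \<in> I1 - I0" for i using that a by (intro fN) auto
        show "?g \<psi> \<in> aff_nbhd n k N" if "\<psi> \<in> J1 - J0" for \<psi> using that a by (intro gN) auto
      qed
      show "(\<Sum>i\<in>I0. ?f i) - (\<Sum>\<psi>\<in>J0. ?g \<psi>) \<in> aff_nbhd n k N"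
        using main unfolding aff_eq_def by (rule aff_nbhd.ideal)
    qed
    then show "(\<Sum>i\<in>I1. ?f i) - (\<Sum>\<psi>\<in>J1. ?g \<psi>) \<in> aff_nbhd n k N"
      unfolding s by (simp only: add_diff_add)
  qed
qed

section \<open>The relation attached to a symmetric tensor\<close>

lemma foldr_ad0_aff_eq:
  "set ws \<subseteq> sp n \<Longrightarrow> aff_eq n k f g \<Longrightarrow> aff_eq n k (foldr ad0 ws f) (foldr ad0 ws g)"
  by (induction ws) (auto intro: ad0_aff_eq)

lemma env_act_aff_eq:
  assumes "u \<in> free_alg (sp n)" "aff_eq n k f g"
  shows "aff_eq n k (env_act u f) (env_act u g)"
  unfolding env_act_def
  by (intro aff_eq_sum aff_eq_scal foldr_ad0_aff_eq assms(2)) (use assms(1) in \<open>auto simp: free_alg_def\<close>)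

lemma env_act_scal_arg: "env_act u (scal c * f) = scal c * env_act u f"
proof -
  have "foldr ad0 ws (scal c * f) = scal c * foldr ad0 ws f" for ws
    by (induction ws) (simp_all add: ad0_scal)
  then show ?thesis
    unfolding env_act_def sum_distrib_left
    by (intro sum.cong refl) (simp only: scal_mult_scal mult.commute)
qed

lemma prod_gens_free: "x \<in> sp n \<Longrightarrow> prod_list (map (\<lambda>j. gen (Loop x j)) js) \<in> free_alg (aff_gens n)"
  by (rule free_alg_prod_list) auto

lemma aff_eq_prod_gens_scal:
  assumes x: "x \<in> sp n" and y: "y \<in> sp n" and xy: "\<And>j. aff_eq n k (gen (Loop x j)) (scal c * gen (Loop y j))"
  shows "aff_eq n k (prod_list (map (\<lambda>j. gen (Loop x j)) js)) (scal (c ^ length js) * prod_list (map (\<lambda>j. gen (Loop y j)) js))"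
proof (induction js)
  case (Cons j js)
  let ?X = "prod_list (map (\<lambda>j. gen (Loop x j)) js)" and ?Y = "prod_list (map (\<lambda>j. gen (Loop y j)) js)"
  have "aff_eq n k (gen (Loop x j) * ?X) ((scal c * gen (Loop y j)) * (scal (c ^ length js) * ?Y))"
    by (rule aff_eq_mult[OF xy Cons.IH]) (use x y in \<open>auto intro: prod_gens_free free_alg_mult\<close>)
  also have "(scal c * gen (Loop y j)) * (scal (c ^ length js) * ?Y) = scal (c ^ length (j # js)) * (gen (Loop y j) * ?Y)"
    by (simp only: mult.assoc scal_left_comm[of "gen (Loop y j)"] scal_mult_scal power_Suc length_Cons)
  finally show ?case by simp
qed simp

lemma quad_0_sq: "1 \<le> n \<Longrightarrow> i < 2 * n \<Longrightarrow> j < 2 * n \<Longrightarrow> (quad n 0 0 * quad n 0 0) $$ (i, j) = 0"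
  by (auto simp: mult_entry[OF quad_carrier quad_carrier] quad_entry dual_def intro!: sum.neutral)

text \<open>The matrix has square zero, so its bracket and its form with itself both vanish, and no
  central term appears even in opposite degrees.\<close>

lemma quad_0_commute:
  assumes n: "1 \<le> n"
  shows "aff_eq n k (gen (Loop (quad n 0 0) i) * gen (Loop (quad n 0 0) j)) (gen (Loop (quad n 0 0) j) * gen (Loop (quad n 0 0) i))"
proof -
  let ?x = "quad n 0 0"
  have x: "?x \<in> sp n" using n by (intro quad_sp) auto
  have "inv_form n ?x ?x = 0" unfolding inv_form_def by (rule sum.neutral) (use n quad_0_sq in auto)
  then have 1: "aff_eq n k (gen (Loop ?x i) * gen (Loop ?x j)) (gen (Loop ?x j) * gen (Loop ?x i) + gen (Loop (bracket ?x ?x) (i + j)))"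
    by (intro aff_eq_comm x) auto
  have "aff_eq n k (gen (Loop (bracket ?x ?x) (i + j))) (\<Sum>t\<in>({} :: nat set). scal 0 * gen (Loop ?x (i + j)))"
    by (rule conjunct2[OF aff_eq_gen_lincomb]) (use spD[OF bracket_sp[OF x x]] in \<open>auto simp: bracket_entry[OF quad_carrier quad_carrier]\<close>)
  then have 2: "aff_eq n k (gen (Loop (bracket ?x ?x) (i + j))) 0" by simp
  from aff_eq_trans[OF 1 aff_eq_add[OF aff_eq_refl 2]] show ?thesis by simp
qed

lemma prod_quad_0_sort:
  assumes n: "1 \<le> n"
  shows "aff_eq n k (prod_list (map (\<lambda>j. gen (Loop (quad n 0 0) j)) js)) (prod_list (map (\<lambda>j. gen (Loop (quad n 0 0) j)) (sort js)))"
proof (induction js)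
  case (Cons i js)
  let ?P = "\<lambda>js. prod_list (map (\<lambda>j. gen (Loop (quad n 0 0) j)) js)" and ?g = "\<lambda>j. gen (Loop (quad n 0 0) j)"
  have x: "quad n 0 0 \<in> sp n" using n by (intro quad_sp) auto
  have ins: "aff_eq n k (?g i * ?P ls) (?P (insort i ls))" for ls
  proof (induction ls)
    case (Cons l ls)
    show ?case
    proof (cases "i \<le> l")
      case False
      have "aff_eq n k (?g i * ?g l * ?P ls) (?g l * ?g i * ?P ls)"
        by (rule aff_eq_rmult[OF quad_0_commute[OF n] prod_gens_free[OF x]])
      moreover have "aff_eq n k (?g l * (?g i * ?P ls)) (?g l * ?P (insort i ls))"
        by (rule aff_eq_lmult[OF Cons.IH]) (use x in simp)
      ultimately show ?thesis using False by (auto simp: mult.assoc intro: aff_eq_trans)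
    qed simp
  qed simp
  have "aff_eq n k (?g i * ?P js) (?g i * ?P (sort js))"
    by (rule aff_eq_lmult[OF Cons.IH]) (use x in simp)
  from aff_eq_trans[OF this ins] show ?case by simp
qed simp

text \<open>The factors of a general tensor need not commute. The symmetry in the degrees is
  inherited, through the operator \<open>u\<close>, from the product of commuting modes at the
  top.\<close>

lemma sym_tensor_sort:
  assumes n: "1 \<le> n" and \<mu>: "set_mset \<mu> \<subseteq> {..<2*n}" "size \<mu> = 2 * length js"
  shows "aff_eq n k (sym_tensor n \<mu> js) (sym_tensor n \<mu> (sort js))"
proof -
  let ?P = "\<lambda>js. prod_list (map (\<lambda>j. gen (Loop (quad n 0 0) j)) js)"
  from reachable_sym_tensor[OF n \<mu>, of k, unfolded reachable_def]
  obtain u where u: "u \<in> free_alg (sp n)" and U: "\<forall>ls. length ls = length js \<longrightarrow> aff_eq n k (env_act u (?P ls)) (sym_tensor n \<mu> ls)"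
    by (elim bexE)
  have "aff_eq n k (sym_tensor n \<mu> js) (env_act u (?P js))" by (rule aff_eq_sym) (use U in simp)
  moreover have "aff_eq n k (env_act u (?P js)) (env_act u (?P (sort js)))" by (rule env_act_aff_eq[OF u prod_quad_0_sort[OF n]])
  moreover have "aff_eq n k (env_act u (?P (sort js))) (sym_tensor n \<mu> (sort js))" using U by simp
  ultimately show ?thesis by (meson aff_eq_trans)
qed

lemma exists_relation:
  assumes n: "1 \<le> n" and rv: "root_vectors n xr" and \<mu>: "set_mset \<mu> \<subseteq> {..<2*n}" "size \<mu> = 2 * d"
  shows "\<exists>u\<in>free_alg (sp n). \<forall>js. length js = d \<longrightarrow> aff_eq n k (rel_term n xr u js) (sym_tensor n \<mu> js)"
proof -
  let ?P = "\<lambda>js. prod_list (map (\<lambda>j. gen (Loop (quad n 0 0) j)) js)"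
  let ?E = "basis_elem n xr (Color (Plain 1) (Plain 1))"
  let ?PE = "\<lambda>js. prod_list (map (\<lambda>j. gen (Loop ?E j)) js)"
  have n0: "0 < 2 * n" "0 \<noteq> dual n 0" using n by (auto simp: dual_def)
  have E: "color_of n 0 0 = Color (Plain 1) (Plain 1)" using n by (simp add: color_of_def idx_def)
  from basis_elem_noncartan[OF rv n0(1,1,2)] obtain c where e: "?E \<in> sp n"
    and c: "\<forall>i<2*n. \<forall>j<2*n. quad n 0 0 $$ (i, j) = c * ?E $$ (i, j)"
    unfolding E by (elim exE conjE)
  have "quad n 0 0 \<in> sp n \<and> aff_eq n k (gen (Loop (quad n 0 0) j)) (\<Sum>t\<in>{()}. scal c * gen (Loop ?E j))" for j
    by (rule aff_eq_gen_lincomb) (use e c in auto)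
  then have q: "quad n 0 0 \<in> sp n" "aff_eq n k (gen (Loop (quad n 0 0) j)) (scal c * gen (Loop ?E j))" for j
    by auto
  from reachable_sym_tensor[OF n \<mu>, of k, unfolded reachable_def]
  obtain u where u: "u \<in> free_alg (sp n)" and U: "\<forall>js. length js = d \<longrightarrow> aff_eq n k (env_act u (?P js)) (sym_tensor n \<mu> js)"
    by (elim bexE)
  \<comment> \<open>Relations are built from the given root vector, while
    \<open>reachable_sym_tensor\<close> starts from \<open>quad n 0 0\<close>; the factor
    \<open>c ^ d\<close> adjusts the normalization of all \<open>d\<close> factors.\<close>
  have "aff_eq n k (rel_term n xr (scal (c ^ d) * u) js) (sym_tensor n \<mu> js)" if "length js = d" for js
  proof -
    have "aff_eq n k (env_act u (?P js)) (env_act u (scal (c ^ length js) * ?PE js))"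
      by (rule env_act_aff_eq[OF u aff_eq_prod_gens_scal[OF q(1) e q(2)]])
    moreover have "env_act u (scal (c ^ length js) * ?PE js) = rel_term n xr (scal (c ^ d) * u) js"
      by (simp only: rel_term_def env_act_scal env_act_scal_arg that)
    ultimately show ?thesis using aff_eq_trans[OF aff_eq_sym] U that by metis
  qed
  then show ?thesis using u by (intro bexI[of _ "scal (c ^ d) * u"]) (auto intro: free_alg_mult)
qed

lemma rel_nonzero_sym_tensor:
  assumes n: "1 \<le> n" and \<mu>: "set_mset \<mu> \<subseteq> {..<2*n}" "size \<mu> = 2 * (k + 1)"
    and u: "\<And>js. length js = k + 1 \<Longrightarrow> aff_eq n k (rel_term n xr u js) (sym_tensor n \<mu> js)"
  shows "rel_nonzero n k xr u m"
  unfolding rel_nonzero_def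
proof
  let ?I = "rel_index k m" and ?P = "\<lambda>js. prod_list (map (\<lambda>j. gen (Loop (quad n 0 0) j)) js)"
  assume "same_sum n k ?I (rel_term n xr u) ?I (\<lambda>_. 0)"
  then have "vanishing n k ?I (rel_term n xr u)" by (rule vanishing_same_sum)
  then have "vanishing n k ?I (sym_tensor n \<mu>)"
    by (rule vanishing_map[where L = "\<lambda>f. f"]) (use u in \<open>auto simp: rel_index_def\<close>)
  then have "vanishing n k ?I (sym_tensor n (replicate_mset (2 * (k + 1)) 0))"
    by (rule vanishing_sym_tensor_top[OF n \<mu>, rotated]) (simp add: rel_index_def)
  then have V: "vanishing n k ?I ?P"
  proof (rule vanishing_map[where L = "\<lambda>f. f"])
    fix js assume "js \<in> ?I"
    then have "length js = k + 1" by (simp add: rel_index_def)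
    then show "aff_eq n k (sym_tensor n (replicate_mset (2 * (k + 1)) 0) js) (?P js)"
      using sym_tensor_replicate[of n js 0] by simp
  qed simp_all
  define js0 where "js0 = m # replicate k 0"
  have js0: "js0 \<in> ?I" "length js0 = k + 1" by (simp_all add: js0_def rel_index_def sum_list_replicate)
  have "\<exists>N. \<forall>I. finite I \<and> js0 \<in> I \<and> (\<forall>js\<in>I. length js = length js0) \<longrightarrow> (\<Sum>js\<in>I. ?P js) \<notin> aff_nbhd n k N"
    by (rule positive_sum_not_in_nbhd[where a = 0 and b = n]) (use n in \<open>auto simp: quad_entry dual_def sgn_pos_def\<close>)
  then obtain N where N: "\<forall>I. finite I \<and> js0 \<in> I \<and> (\<forall>js\<in>I. length js = length js0) \<longrightarrow> (\<Sum>js\<in>I. ?P js) \<notin> aff_nbhd n k N"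
    by (elim exE)
  from spec[OF V[unfolded vanishing_def], of N] obtain I0 where I0: "finite I0" "I0 \<subseteq> ?I"
    and van: "\<forall>I1. finite I1 \<and> I0 \<subseteq> I1 \<and> I1 \<subseteq> ?I \<longrightarrow> (\<Sum>js\<in>I1. ?P js) \<in> aff_nbhd n k N"
    by (elim exE conjE)
  have "(\<Sum>js\<in>insert js0 I0. ?P js) \<in> aff_nbhd n k N" using I0 js0 by (intro van[rule_format]) auto
  moreover have "(\<Sum>js\<in>insert js0 I0. ?P js) \<notin> aff_nbhd n k N"
    by (rule N[rule_format]) (use I0 js0 in \<open>auto simp: rel_index_def\<close>)
  ultimately show False by contradiction
qed

section \<open>Pairings of a multiset of positions\<close>

lemma length_pair_colors: "length (pair_colors n ps) = length ps div 2"
  by (induction n ps rule: pair_colors.induct) auto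

lemma pair_colors_basis: "set ps \<subseteq> {..<2*n} \<Longrightarrow> set (pair_colors n ps) \<subseteq> basis n"
  by (induction n ps rule: pair_colors.induct) (auto simp: color_of_basis)

lemma contents_pair_colors:
  "even (length ps) \<Longrightarrow> contents (mset (pair_colors n ps)) = image_mset (idx n) (mset ps)"
proof (induction n ps rule: pair_colors.induct)
  case (1 n a b ps)
  then show ?case by (simp add: color_of_def max_def min_def add_mset_commute)
qed (simp_all add: contents_def)

lemma pair_colors_surj:
  assumes "set cs \<subseteq> basis n"
  shows "\<exists>ps. set ps \<subseteq> {..<2*n} \<and> length ps = 2 * length cs \<and> pair_colors n ps = cs"
  using assms
proof (induction cs)
  case (Cons c cs)
  then obtain ps where "set ps \<subseteq> {..<2*n}" "length ps = 2 * length cs" "pair_colors n ps = cs" by auto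
  moreover from Cons.prems have "c \<in> basis n" by simp
  then obtain a b where "a < 2 * n" "b < 2 * n" "c = color_of n a b" by (elim basis_color_of)
  ultimately show ?case by (intro exI[of _ "a # b # ps"]) auto
qed (intro exI[of _ "[]"], simp)

lemma kappa_weight_nonzero:
  assumes \<kappa>: "\<And>c d. c \<in> basis n \<Longrightarrow> \<kappa> c d \<noteq> 0 \<Longrightarrow> c \<le> d"
    and "length ds = length cs" "set ds \<subseteq> basis n" "kappa_weight \<kappa> ds cs \<noteq> 0"
  shows "list_all2 (\<le>) ds cs"
  using assms(2-) by (induction ds cs rule: list_induct2) (auto simp: kappa_weight_def \<kappa>)

lemma kappa_weight_diag: "kappa_weight \<kappa> cs cs = (\<Prod>c\<in>#mset cs. \<kappa> c c)"
  by (induction cs) (auto simp: kappa_weight_def)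

lemma basis_row_le_col: "c \<in> basis n \<Longrightarrow> row c \<le> col c"
  by (auto simp: basis_def)

section \<open>Comparison of colored partitions\<close>

text \<open>The multiset order is decided by the largest difference, which lies in the upper parts
  \<open>Q\<close> and \<open>Q'\<close>.\<close>

lemma add_less_separated:
  fixes P P' Q Q' :: "'a::linorder multiset"
  assumes sep: "\<And>p q. p \<in># P + P' \<Longrightarrow> q \<in># Q + Q' \<Longrightarrow> p < q" and Q: "Q < Q'"
  shows "P + Q < P' + Q'"
proof -
  have ne: "Q \<noteq> Q'" and dom: "\<And>y. count Q' y < count Q y \<Longrightarrow> \<exists>x>y. count Q x < count Q' x"
    using Q unfolding less_multiset\<^sub>H\<^sub>O by auto
  have z: "count P x = 0 \<and> count P' x = 0" if "x \<in># Q + Q'" for x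
    using sep[of x x] that by (auto simp flip: not_in_iff)
  have in_Q': "x \<in># Q + Q'" if "count Q x < count Q' x" for x
  proof -
    have "0 < count Q' x" using that by linarith
    then show ?thesis by (simp add: count_greater_zero_iff)
  qed
  have up: "count (P + Q) x < count (P' + Q') x" if "count Q x < count Q' x" for x
    using that z[OF in_Q'[OF that]] by simp
  have ex: "\<exists>x. count Q x < count Q' x"
  proof (rule ccontr)
    assume a: "\<nexists>x. count Q x < count Q' x"
    have "count Q y = count Q' y" for y using a dom[of y] by (meson linorder_neqE_nat)
    then show False using ne by (simp add: multiset_eq_iff)
  qed
  show ?thesis
    unfolding less_multiset\<^sub>H\<^sub>O
  proof (intro conjI allI impI)
    from ex obtain x where "count Q x < count Q' x" by (elim exE)
    from up[OF this] show "P + Q \<noteq> P' + Q'" by (metis less_irrefl)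
    fix y assume y: "count (P' + Q') y < count (P + Q) y"
    show "\<exists>x>y. count (P + Q) x < count (P' + Q') x"
    proof (cases "y \<in># Q + Q'")
      case True
      then have "count Q' y < count Q y" using y z[OF True] by simp
      from dom[OF this] obtain x where "x > y" "count Q x < count Q' x" by (elim exE conjE)
      then show ?thesis using up by blast
    next
      case False
      then have "y \<in># P"
        using y by (metis add.right_neutral count_union gr_implies_not0 not_in_iff union_iff)
      moreover from ex obtain x where x: "count Q x < count Q' x" by (elim exE)
      ultimately have "y < x" using sep[of y x] in_Q'[OF x] by simp
      then show ?thesis using up[OF x] by blast
    qed
  qed
qed

lemma map2_Part_mono:
  assumes "list_all2 (\<le>) ds cs" "length js = length cs"
  shows "mset (map2 Part ds js) < mset (map2 Part cs js) \<or> ds = cs"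
  using assms
proof (induction ds cs arbitrary: js rule: list_all2_induct)
  case (Cons d ds c cs)
  then obtain j js' where js: "js = j # js'" "length js' = length cs" by (cases js) auto
  let ?M = "\<lambda>ds. mset (map2 Part ds js')"
  have IH: "?M ds < ?M cs \<or> ds = cs" by (rule Cons.IH[OF js(2)])
  show ?case
  proof (cases "d = c")
    case True
    then show ?thesis using IH by (auto simp: js)
  next
    case False
    then have "Part d j < Part c j" using Cons.hyps by (simp add: less_part_def)
    then have "{#Part d j#} < {#Part c j#}" by simp
    moreover have "?M ds \<le> ?M cs" using IH by auto
    ultimately have "{#Part d j#} + ?M ds < {#Part c j#} + ?M cs" by (rule add_less_le_mono)
    then show ?thesis by (simp add: js)
  qed
qed simp

lemma map2_Part_replicate: "map2 Part ds (replicate (length ds) i) = map (\<lambda>c. Part c i) ds"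
  by (induction ds) auto

lemma sum_list_bounds:
  fixes xs :: "int list"
  shows "(\<And>x. x \<in> set xs \<Longrightarrow> x \<le> t) \<Longrightarrow> sum_list xs \<le> int (length xs) * t"
    and "(\<And>x. x \<in> set xs \<Longrightarrow> t \<le> x) \<Longrightarrow> int (length xs) * t \<le> sum_list xs"
  by (induction xs) (fastforce simp: algebra_simps)+

text \<open>In a smaller list the first differing entry from the right would be at most
  \<open>e - 1\<close>, hence so would all entries before it, while the balanced list has at least
  \<open>e - 1\<close> there: the sum would be too small.\<close>

lemma balanced_shape_minimal:
  assumes js: "sorted js" "length js = b + a" and sum: "sum_list js = int b * (e - 1) + int a * e"
  shows "js = replicate b (e - 1) @ replicate a e \<or> rev_lex_less (replicate b (e - 1) @ replicate a e) js"
proof (rule ccontr)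
  let ?s = "replicate b (e - 1) @ replicate a e"
  assume "\<not> (js = ?s \<or> rev_lex_less ?s js)"
  then have "rev_lex_less js ?s" using rev_lex_less_total[of js ?s] js(2) by auto
  then obtain us x xs y ys where r: "rev js = us @ x # xs" "rev ?s = us @ y # ys" "x < y" "length js = length ?s"
    unfolding rev_lex_less_def lex_conv by auto
  have "set (rev ?s) = set (us @ y # ys)" by (simp only: r(2))
  then have s: "z = e \<or> z = e - 1" if "z \<in> set (y # ys)" for z
  proof -
    have "z \<in> set (rev ?s)" using that \<open>set (rev ?s) = _\<close> by auto
    then show ?thesis by (auto split: if_splits)
  qed
  have "sorted (rev (us @ x # xs))" using js(1) by (simp flip: r(1))
  then have x: "z \<le> x" if "z \<in> set xs" for z using that by (auto simp: sorted_append)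
  have "x \<le> e - 1" using r(3) s[of y] by auto
  then have "z \<le> e - 1" if "z \<in> set xs" for z using x[OF that] by simp
  then have "sum_list xs \<le> int (length xs) * (e - 1)" by (rule sum_list_bounds)
  moreover have "int (length ys) * (e - 1) \<le> sum_list ys" by (rule sum_list_bounds) (use s in fastforce)
  moreover have "length xs = length ys" using r(1,2,4) by (metis add_left_cancel length_Cons length_append length_rev nat.inject)
  ultimately have "sum_list (rev js) < sum_list (rev ?s)" unfolding r(1,2) using r(3) by simp
  then have "sum_list js < sum_list ?s" by simp
  then show False by (simp add: sum sum_list_replicate)
qed

lemma cp_shape_eq_sort:
  assumes "mset (map part_deg ps) = mset js"
  shows "cp_shape (mset ps) = sort js"
  unfolding cp_shape_def
proof (rule properties_for_sort[symmetric])
  show "mset (map part_deg (sorted_list_of_multiset (mset ps))) = mset js" using assms by simp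
  show "sorted (map part_deg (sorted_list_of_multiset (mset ps)))"
    unfolding sorted_map
    by (rule sorted_wrt_mono_rel[OF _ sorted_sorted_list_of_multiset]) (auto simp: less_eq_part_def)
qed

text \<open>Equal shapes put equal degrees at every place, so the first difference between the parts
  is one between their colors.\<close>

lemma rev_lex_less_cp_colors:
  assumes less: "\<pi> < \<psi>" and shape: "cp_shape \<pi> = cp_shape \<psi>"
  shows "rev_lex_less (cp_colors \<pi>) (cp_colors \<psi>)"
proof -
  let ?l = sorted_list_of_multiset
  have len: "length (?l \<pi>) = length (?l \<psi>)"
    using arg_cong[OF shape, of length] by (simp add: cp_shape_def)
  have "?l \<pi> \<noteq> ?l \<psi>" using less by (metis less_irrefl mset_sorted_list_of_multiset)
  moreover have "\<not> rev_lex_less (?l \<psi>) (?l \<pi>)"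
    using rev_lex_less_imp_mset_less[of "?l \<psi>" "?l \<pi>"] less by auto
  ultimately have "rev_lex_less (?l \<pi>) (?l \<psi>)" using rev_lex_less_total[OF len] by blast
  then obtain us x xs y ys where r: "rev (?l \<pi>) = us @ x # xs" "rev (?l \<psi>) = us @ y # ys" "x < y"
    unfolding rev_lex_less_def lex_conv by auto
  have "map part_deg (rev (?l \<pi>)) = map part_deg (rev (?l \<psi>))"
    using arg_cong[OF shape, of rev] by (simp add: cp_shape_def rev_map)
  then have "part_deg x = part_deg y" unfolding r by simp
  then have "part_color x < part_color y" using r(3) by (simp add: less_part_def)
  then have "(map part_color (us @ x # xs), map part_color (us @ y # ys)) \<in> lex {(x, y). x < y}"
    using len arg_cong[OF r(1), of length] arg_cong[OF r(2), of length] unfolding lex_conv by auto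
  then show ?thesis unfolding rev_lex_less_def cp_colors_def rev_map r .
qed

section \<open>Minimality of cascades\<close>

text \<open>Each step of a cascade lowers the row or raises the column, so the intervals grow along
  the sequence.\<close>

lemma cascade_nested:
  assumes "cascade n xs" "set_mset M \<subseteq> set xs"
  shows "nested M"
proof -
  let ?R = "\<lambda>x y. row y \<le> row x \<and> col x \<le> col y"
  have "sorted_wrt ?R xs"
    using assms(1) by (subst sorted_wrt_iff_nth_Suc_transp) (auto simp: cascade_def transp_def)
  then have "?R x y \<or> ?R y x" if "x \<in> set xs" "y \<in> set xs" for x y
    using that by (metis (mono_tags, lifting) in_set_conv_nth linorder_neqE_nat order_refl sorted_wrt_nth_less)
  then show ?thesis using assms(2) unfolding nested_def by (meson subsetD)
qed

text \<open>Cascades with multiplicities are encoded as nested multisets of colors. The degree of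
  \<open>A\<close> is \<open>e\<close>, that of \<open>B\<close> is \<open>e - 1\<close>.\<close>

locale separated_cascades =
  fixes n :: nat and B A :: "color multiset" and r :: index and e :: int
  assumes basis: "set_mset B \<subseteq> basis n" "set_mset A \<subseteq> basis n"
    and nested: "nested B" "nested A"
    and rows: "\<And>x. x \<in># B \<Longrightarrow> r \<le> row x" and cols: "\<And>x. x \<in># A \<Longrightarrow> col x \<le> r"
begin

definition shape :: "int list" where
  "shape = replicate (size B) (e - 1) @ replicate (size A) e"

definition target :: "part multiset" where
  "target = image_mset (\<lambda>c. Part c (e - 1)) B + image_mset (\<lambda>c. Part c e) A"

text \<open>For \<open>x \<le> r\<close> no endpoint of \<open>B\<close> lies below
  \<open>x\<close>, so the equality of contents bounds the count for \<open>A'\<close> by that for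
  \<open>A\<close>. For larger \<open>x\<close> all endpoints of \<open>A\<close> lie below
  \<open>x\<close>, the maximal possible number. If \<open>A = A'\<close>, the endpoints of
  \<open>B\<close> and \<open>B'\<close> agree and nestedness of \<open>B\<close> applies.\<close>

lemma minimal_pair:
  assumes sz: "size B' = size B" "size A' = size A" and iv: "\<And>x. x \<in># B' + A' \<Longrightarrow> row x \<le> col x"
    and cont: "contents B' + contents A' = contents B + contents A"
  shows "A < A' \<or> A = A' \<and> B \<le> B'"
proof -
  have iv': "row x \<le> col x" if "x \<in># B \<or> x \<in># A" for x using that basis basis_row_le_col by blast
  have sub: "below x (contents B') + below x (contents A') = below x (contents B) + below x (contents A)" for x
    using cont by (metis below_union)
  have "A \<le> A'"
  proof (rule nested_minimal[OF nested(2)])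
    fix x
    show "below x (contents A') \<le> below x (contents A)"
    proof (cases "x \<le> r")
      case True
      have "below x (contents B) = 0"
        unfolding below_contents using rows iv' True by (fastforce simp: size_filter_none)
      then show ?thesis using sub[of x] by simp
    next
      case False
      have "below x (contents A) = size A + size A"
        unfolding below_contents using cols iv' False
        by (intro arg_cong2[where f = "(+)"] size_filter_all) fastforce+
      moreover have "below x (contents A') \<le> size A' + size A'"
        unfolding below_contents by (intro add_mono size_filter_mset_lesseq)
      ultimately show ?thesis using sz by simp
    qed
  qed (use iv iv' sz in auto)
  moreover have "B \<le> B'" if "A = A'"
    by (rule nested_minimal[OF nested(1)]) (use iv iv' sz sub that in \<open>auto dest: spec\<close>)
  ultimately show ?thesis by auto
qed

text \<open>The colors in the higher degree \<open>e\<close> decide first, so \<open>A\<close> is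
  compared before \<open>B\<close>.\<close>

lemma target_le:
  assumes ds: "set ds \<subseteq> basis n" "length ds = size B + size A" and cont: "contents (mset ds) = contents (B + A)"
  shows "target \<le> mset (map2 Part ds shape)"
proof -
  define B' A' where "B' = mset (take (size B) ds)" and "A' = mset (drop (size B) ds)"
  have ds': "mset ds = B' + A'" unfolding B'_def A'_def by (simp flip: mset_append)
  have sz: "size B' = size B" "size A' = size A" using ds(2) by (simp_all add: B'_def A'_def)
  have l: "length (take (size B) ds) = size B" "length (drop (size B) ds) = size A" using ds(2) by simp_all
  have "map2 Part (take (size B) ds @ drop (size B) ds) shape
      = map (\<lambda>c. Part c (e - 1)) (take (size B) ds) @ map (\<lambda>c. Part c e) (drop (size B) ds)"
    unfolding shape_def using l
    by (simp only: zip_append length_replicate map_append) (metis l map2_Part_replicate)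
  then have M: "mset (map2 Part ds shape) = image_mset (\<lambda>c. Part c (e - 1)) B' + image_mset (\<lambda>c. Part c e) A'"
    by (simp add: B'_def A'_def)
  have iv: "row x \<le> col x" if "x \<in># B' + A'" for x
  proof -
    have "x \<in> set ds" using that by (simp flip: ds')
    then show ?thesis using ds(1) basis_row_le_col by blast
  qed
  have mono: "Part x i < Part y i" if "x < y" for x y i using that by (simp add: less_part_def)
  from minimal_pair[OF sz iv] cont have "A < A' \<or> A = A' \<and> B \<le> B'"
    by (simp add: ds')
  then show ?thesis
  proof
    assume "A < A'"
    then have "image_mset (\<lambda>c. Part c e) A < image_mset (\<lambda>c. Part c e) A'"
      by (intro image_mset_strict_mono) (use mono in auto)
    then have "target < mset (map2 Part ds shape)"
      unfolding target_def M by (rule add_less_separated[rotated]) (auto simp: less_part_def)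
    then show ?thesis by simp
  next
    assume "A = A' \<and> B \<le> B'"
    then show ?thesis unfolding target_def M by (intro add_mono image_mset_mono) (use mono in auto)
  qed
qed

end

context separated_cascades
begin

definition target_colors :: "color list" where
  "target_colors = sorted_list_of_multiset B @ sorted_list_of_multiset A"

lemma length_shape: "length shape = size B + size A"
  by (simp add: shape_def)

lemma sorted_shape: "sorted shape"
  by (auto simp: shape_def sorted_append)

lemma target_colors:
  shows "set target_colors \<subseteq> basis n" "length target_colors = size B + size A" "mset target_colors = B + A"
    and "mset (map2 Part target_colors shape) = target"
proof -
  let ?l = sorted_list_of_multiset
  have l: "length (?l B) = size B" "length (?l A) = size A" by (metis mset_sorted_list_of_multiset size_mset)+
  show "set target_colors \<subseteq> basis n" using basis by (simp add: target_colors_def)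
  show "length target_colors = size B + size A" by (simp add: target_colors_def l)
  show "mset target_colors = B + A" by (simp add: target_colors_def)
  have "map2 Part target_colors shape = map (\<lambda>c. Part c (e - 1)) (?l B) @ map (\<lambda>c. Part c e) (?l A)"
    unfolding shape_def target_colors_def using l
    by (simp only: zip_append length_replicate map_append) (metis l map2_Part_replicate)
  then show "mset (map2 Part target_colors shape) = target" by (simp add: target_def)
qed

lemma part_colors_target: "image_mset part_color target = B + A"
  by (simp add: target_def image_mset.compositionality o_def)

lemma cp_shape_target: "cp_shape target = shape"
proof -
  have "map part_deg (map2 Part target_colors shape) = shape"
    by (rule map2_Part_props(1)) (simp add: target_colors length_shape)
  then have "cp_shape (mset (map2 Part target_colors shape)) = sort shape"
    by (intro cp_shape_eq_sort) simp
  then show ?thesis by (simp only: target_colors(4) sorted_sort_id[OF sorted_shape])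
qed

lemma target_support:
  assumes "size B + size A = k + 1"
  shows "target \<in> rel_support n k (int (size B) * (e - 1) + int (size A) * e)" "size target = k + 1"
  using assms basis
  by (auto simp: rel_support_def colored_partitions_def target_def cp_deg_def image_mset.compositionality o_def)

context
  fixes \<kappa> :: "color \<Rightarrow> color \<Rightarrow> complex" and \<mu> :: "nat multiset"
  assumes \<kappa>: "\<And>c d. c \<in> basis n \<Longrightarrow> \<kappa> c d \<noteq> 0 \<Longrightarrow> c \<le> d"
    and \<mu>: "set_mset \<mu> \<subseteq> {..<2*n}" "image_mset (idx n) \<mu> = contents (B + A)"
begin

text \<open>The pairing lies above the target because the cascades are nested, and \<open>cs\<close>
  lies above the pairing because \<open>\<kappa>\<close> is triangular.\<close>

lemma pairing_bounds:
  assumes ps: "ps \<in> arrangements \<mu>" and cs: "length cs = size B + size A"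
    and nz: "kappa_weight \<kappa> (pair_colors n ps) cs \<noteq> 0"
  shows "target \<le> mset (map2 Part (pair_colors n ps) shape)"
    and "mset (map2 Part (pair_colors n ps) shape) < mset (map2 Part cs shape) \<or> pair_colors n ps = cs"
proof -
  have m: "mset ps = \<mu>" using ps by (simp add: arrangements_def)
  have "length ps = size (image_mset (idx n) \<mu>)" by (simp flip: m)
  then have l: "length ps = 2 * (size B + size A)" unfolding \<mu>(2) by (simp add: contents_def)
  have in_basis: "set (pair_colors n ps) \<subseteq> basis n"
    by (rule pair_colors_basis) (use \<mu>(1) in \<open>simp flip: m\<close>)
  have len: "length (pair_colors n ps) = size B + size A" by (simp add: length_pair_colors l)
  show "target \<le> mset (map2 Part (pair_colors n ps) shape)"
    by (rule target_le[OF in_basis len]) (simp add: contents_pair_colors l m \<mu>(2) del: contents_union)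
  show "mset (map2 Part (pair_colors n ps) shape) < mset (map2 Part cs shape) \<or> pair_colors n ps = cs"
    by (rule map2_Part_mono[OF kappa_weight_nonzero]) (use \<kappa> len cs in_basis nz length_shape in auto)
qed

lemma tensor_coeff_bound:
  assumes "length cs = size B + size A" "tensor_coeff n \<kappa> \<mu> cs \<noteq> 0"
  shows "target \<le> mset (map2 Part cs shape)"
proof -
  from assms(2) obtain ps where "ps \<in> arrangements \<mu>" "kappa_weight \<kappa> (pair_colors n ps) cs \<noteq> 0"
    unfolding tensor_coeff_def by (rule sum.not_neutral_contains_not_neutral)
  from pairing_bounds[OF this(1) assms(1) this(2)] show ?thesis by auto
qed

text \<open>At the target no strict inequality is left, so exactly the pairings with colors
  \<open>cs\<close> contribute, each with the product of the diagonal coefficients.\<close>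

lemma tensor_coeff_target:
  assumes cs: "length cs = size B + size A" "mset (map2 Part cs shape) = target"
  shows "tensor_coeff n \<kappa> \<mu> cs = of_nat (card {ps \<in> arrangements \<mu>. pair_colors n ps = cs}) * (\<Prod>c\<in>#B + A. \<kappa> c c)"
proof -
  have "map part_color (map2 Part cs shape) = cs" by (rule map2_Part_props(2)) (simp add: cs length_shape)
  then have "mset cs = image_mset part_color (mset (map2 Part cs shape))" by (metis mset_map)
  then have m: "mset cs = B + A" by (simp only: cs part_colors_target)
  have "kappa_weight \<kappa> (pair_colors n ps) cs = (if pair_colors n ps = cs then \<Prod>c\<in>#B + A. \<kappa> c c else 0)"
    if "ps \<in> arrangements \<mu>" for ps
  proof (cases "pair_colors n ps = cs")
    case False
    have "kappa_weight \<kappa> (pair_colors n ps) cs = 0"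
    proof (rule ccontr)
      assume "kappa_weight \<kappa> (pair_colors n ps) cs \<noteq> 0"
      from pairing_bounds[OF that cs(1) this, unfolded cs(2)] False show False by (meson leD)
    qed
    then show ?thesis using False by simp
  qed (simp add: kappa_weight_diag m)
  then have "tensor_coeff n \<kappa> \<mu> cs = (\<Sum>ps\<in>arrangements \<mu>. if pair_colors n ps = cs then \<Prod>c\<in>#B + A. \<kappa> c c else 0)"
    unfolding tensor_coeff_def by (rule sum.cong[OF refl])
  then show ?thesis by (simp add: sum.inter_filter[symmetric])
qed

end

theorem target_is_leading_term:
  assumes n: "1 \<le> n" and rv: "root_vectors n xr" and k: "size B + size A = k + 1"
  defines "m \<equiv> int (size B) * (e - 1) + int (size A) * e"
  shows "\<exists>u\<in>free_alg (sp n). rel_nonzero n k xr u m \<and> is_leading_term n k xr u m target"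
proof -
  interpret S: spanning_basis n k xr by (rule spanning_basis_root_vectors[OF rv])
  obtain \<kappa> :: "color \<Rightarrow> color \<Rightarrow> complex" where ex: "\<And>a b i j. a < 2 * n \<Longrightarrow> b < 2 * n \<Longrightarrow> i < 2 * n \<Longrightarrow> j < 2 * n \<Longrightarrow>
      quad n a b $$ (i, j) = (\<Sum>c\<in>basis n. \<kappa> (color_of n a b) c * basis_elem n xr c $$ (i, j))"
    and \<kappa>: "\<And>c. c \<in> basis n \<Longrightarrow> \<kappa> c c \<noteq> 0" "\<And>c d. c \<in> basis n \<Longrightarrow> \<kappa> c d \<noteq> 0 \<Longrightarrow> c \<le> d"
    by (rule quad_expansions[OF rv]) blast
  have qc: "quad_coeffs n xr \<kappa>" using ex by (simp add: quad_coeffs_def)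
  from pair_colors_surj[OF target_colors(1)] obtain qs where qs: "set qs \<subseteq> {..<2*n}"
    "length qs = 2 * length target_colors" "pair_colors n qs = target_colors"
    by (elim exE conjE)
  define \<mu> where "\<mu> = mset qs"
  have \<mu>: "set_mset \<mu> \<subseteq> {..<2*n}" "size \<mu> = 2 * (k + 1)"
    using qs(1,2) target_colors(2) k by (simp_all add: \<mu>_def)
  have "image_mset (idx n) \<mu> = contents (mset (pair_colors n qs))"
    unfolding \<mu>_def by (rule contents_pair_colors[symmetric]) (simp add: qs(2))
  then have \<mu>_idx: "image_mset (idx n) \<mu> = contents (B + A)" by (simp only: qs(3) target_colors(3))
  have bound: "target \<le> mset (map2 Part cs shape)" if "length cs = size B + size A" "tensor_coeff n \<kappa> \<mu> cs \<noteq> 0" for cs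
    by (rule tensor_coeff_bound[OF _ \<mu>(1) \<mu>_idx that]) (rule \<kappa>(2))
  have coeff: "tensor_coeff n \<kappa> \<mu> cs = of_nat (card {ps \<in> arrangements \<mu>. pair_colors n ps = cs}) * (\<Prod>c\<in>#B + A. \<kappa> c c)"
    if "length cs = size B + size A" "mset (map2 Part cs shape) = target" for cs
    by (rule tensor_coeff_target[OF _ \<mu>(1) \<mu>_idx that]) (rule \<kappa>(2))
  obtain u where u: "u \<in> free_alg (sp n)"
    and U: "\<forall>js. length js = k + 1 \<longrightarrow> aff_eq n k (rel_term n xr u js) (sym_tensor n \<mu> js)"
    using exists_relation[OF n rv \<mu>, of k] by (elim bexE)
  let ?pd = "\<lambda>js. sum_list (map (\<lambda>i. max i 0) js)" and ?I = "rel_index k m"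
  let ?S = "\<lambda>js \<psi>. {cs \<in> color_lists n (k + 1). mset (map2 Part cs (sort js)) = \<psi>}"
  have "\<forall>js\<in>?I. \<exists>C. aff_eq n k (rel_term n xr u js) (\<Sum>\<psi>\<in>bounded_partitions n (k + 1) m (?pd js). scal (C \<psi>) * cp_elem n xr \<psi>)
      \<and> (\<forall>\<psi>. size \<psi> = k + 1 \<longrightarrow> C \<psi> = (\<Sum>cs\<in>?S js \<psi>. tensor_coeff n \<kappa> \<mu> cs))"
  proof
    fix js assume "js \<in> ?I"
    then have js: "length js = k + 1" "sum_list js = m" by (simp_all add: rel_index_def)
    have s: "sum_list (sort js) = m" by (metis js(2) mset_sort sum_mset_sum_list)
    have "mset (map (\<lambda>i. max i 0) (sort js)) = mset (map (\<lambda>i. max i 0) js)" by simp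
    then have pd: "?pd (sort js) = ?pd js" by (metis sum_mset_sum_list)
    have "sort js \<noteq> []" using js(1) by (metis length_0_conv length_sort add_is_0 one_neq_zero)
    from S.sym_tensor_partitions[OF qc \<mu>(1) _ sorted_sort this, unfolded length_sort js(1) s pd, OF \<mu>(2)]
    obtain C where C: "aff_eq n k (sym_tensor n \<mu> (sort js)) (\<Sum>\<psi>\<in>bounded_partitions n (k + 1) m (?pd js). scal (C \<psi>) * cp_elem n xr \<psi>)"
      "\<forall>\<psi>. size \<psi> = k + 1 \<longrightarrow> C \<psi> = (\<Sum>cs\<in>?S js \<psi>. tensor_coeff n \<kappa> \<mu> cs)"
      by (elim exE conjE)
    have "aff_eq n k (rel_term n xr u js) (sym_tensor n \<mu> js)" using U js(1) by simp
    also have "aff_eq n k (sym_tensor n \<mu> js) (sym_tensor n \<mu> (sort js))" by (rule sym_tensor_sort[OF n \<mu>(1)]) (simp add: \<mu>(2) js(1))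
    also note C(1)
    finally show "\<exists>C. aff_eq n k (rel_term n xr u js) (\<Sum>\<psi>\<in>bounded_partitions n (k + 1) m (?pd js). scal (C \<psi>) * cp_elem n xr \<psi>)
      \<and> (\<forall>\<psi>. size \<psi> = k + 1 \<longrightarrow> C \<psi> = (\<Sum>cs\<in>?S js \<psi>. tensor_coeff n \<kappa> \<mu> cs))"
      using C(2) by (intro exI[of _ C] conjI)
  qed
  from bchoice[OF this] obtain C where
    C': "\<forall>js\<in>?I. aff_eq n k (rel_term n xr u js) (\<Sum>\<psi>\<in>bounded_partitions n (k + 1) m (?pd js). scal (C js \<psi>) * cp_elem n xr \<psi>)
      \<and> (\<forall>\<psi>. size \<psi> = k + 1 \<longrightarrow> C js \<psi> = (\<Sum>cs\<in>?S js \<psi>. tensor_coeff n \<kappa> \<mu> cs))"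
    by (elim exE)
  note C = conjunct1[OF bspec[OF C']] and C_top = mp[OF spec[OF conjunct2[OF bspec[OF C']]]]
  let ?J = "\<lambda>\<psi>. {js. js \<in> ?I \<and> ?pd js = pos_deg \<psi>}"
  define c where "c \<psi> = (\<Sum>js\<in>?J \<psi>. C js \<psi>)" for \<psi>
  have c_top: "c \<psi> = (\<Sum>js\<in>?J \<psi>. \<Sum>cs\<in>?S js \<psi>. tensor_coeff n \<kappa> \<mu> cs)" if "size \<psi> = k + 1" for \<psi>
    unfolding c_def by (rule sum.cong) (use C_top that in auto)
  have expansion: "rel_expansion n k xr u m c"
    unfolding c_def by (rule rel_expansion_from_terms[OF S.basis_sp C])
  have shape_of: "cp_shape \<psi> = sort js" if "cs \<in> ?S js \<psi>" "js \<in> ?I" for js cs \<psi>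
  proof -
    have "map part_deg (map2 Part cs (sort js)) = sort js"
      by (rule map2_Part_props(1)) (use that in \<open>simp add: color_lists_def rel_index_def\<close>)
    then have "cp_shape (mset (map2 Part cs (sort js))) = sort (sort js)" by (intro cp_shape_eq_sort) simp
    then show ?thesis using that by (simp add: sorted_sort_id)
  qed
  have len: "length cs = size B + size A" if "cs \<in> ?S js \<psi>" for js cs \<psi> using that k by (simp add: color_lists_def)
  have min: "target \<prec>\<^sub>c\<^sub>p \<psi>" if \<psi>: "\<psi> \<in> rel_support n k m" "size \<psi> = k + 1" "c \<psi> \<noteq> 0" "\<psi> \<noteq> target" for \<psi>
  proof -
    from \<psi>(3) c_top[OF \<psi>(2)] obtain js where js: "js \<in> ?J \<psi>" "(\<Sum>cs\<in>?S js \<psi>. tensor_coeff n \<kappa> \<mu> cs) \<noteq> 0"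
      by (metis (no_types, lifting) sum.neutral)
    from js(2) obtain cs where cs: "cs \<in> ?S js \<psi>" "tensor_coeff n \<kappa> \<mu> cs \<noteq> 0"
      by (rule sum.not_neutral_contains_not_neutral)
    have sh: "cp_shape \<psi> = sort js" by (rule shape_of[OF cs(1)]) (use js(1) in simp)
    have eq: "size target = size \<psi>" "cp_deg target = cp_deg \<psi>"
      using target_support[OF k] \<psi>(1,2) by (simp_all add: rel_support_def m_def)
    \<comment> \<open>Degree lists of any shape with the same sum contribute to \<open>c\<close>; a
      shape other than the balanced one makes the partition larger already.\<close>
    have "sort js = shape \<or> rev_lex_less shape (sort js)"
      unfolding shape_def
    proof (rule balanced_shape_minimal)
      show "sum_list (sort js) = int (size B) * (e - 1) + int (size A) * e"
        using js(1) by (metis (mono_tags, lifting) m_def mem_Collect_eq mset_sort rel_index_def sum_mset_sum_list)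
    qed (use js(1) k in \<open>simp_all add: rel_index_def\<close>)
    then show ?thesis
    proof
      assume sj: "sort js = shape"
      then have m: "mset (map2 Part cs shape) = \<psi>" using cs(1) by simp
      have "target \<le> mset (map2 Part cs shape)" by (rule bound[OF len[OF cs(1)] cs(2)])
      then have "target < \<psi>" using \<psi>(4) m by auto
      then have "rev_lex_less (cp_colors target) (cp_colors \<psi>)"
        by (rule rev_lex_less_cp_colors) (simp add: cp_shape_target sh sj)
      then show ?thesis using eq cp_shape_target sh sj by (simp add: cp_less_def)
    next
      assume "rev_lex_less shape (sort js)"
      then show ?thesis using eq cp_shape_target sh by (simp add: cp_less_def)
    qed
  qed
  have "c target \<noteq> 0"
  proof -
    \<comment> \<open>Every contribution is a natural multiple of the same number \<open>?K\<close>;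
      the arrangement \<open>qs\<close> with the degrees \<open>shape\<close> makes the total
      multiple positive.\<close>
    let ?N = "\<lambda>cs. card {ps \<in> arrangements \<mu>. pair_colors n ps = cs}" and ?K = "\<Prod>c\<in>#B + A. \<kappa> c c"
    have szt: "size target = k + 1" by (rule target_support(2)[OF k])
    have fin: "finite (?J target)"
      by (rule finite_subset[OF _ finite_rel_index_bounded[of k m "pos_deg target + 1"]]) auto
    have fS: "finite (?S js target)" for js by simp
    have "c target = (\<Sum>js\<in>?J target. \<Sum>cs\<in>?S js target. of_nat (?N cs) * ?K)"
      unfolding c_top[OF szt]
    proof (intro sum.cong refl coeff)
      fix js cs assume js: "js \<in> ?J target" and cs: "cs \<in> ?S js target"
      have "sort js = shape" using shape_of[OF cs] js cp_shape_target by simp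
      then show "mset (map2 Part cs shape) = target" using cs by simp
      show "length cs = size B + size A" by (rule len[OF cs])
    qed
    also have "\<dots> = of_nat (\<Sum>js\<in>?J target. \<Sum>cs\<in>?S js target. ?N cs) * ?K"
      by (simp only: of_nat_sum sum_distrib_right)
    finally have 1: "c target = of_nat (\<Sum>js\<in>?J target. \<Sum>cs\<in>?S js target. ?N cs) * ?K" .
    have sum_shape: "sum_list shape = m" by (simp add: shape_def m_def sum_list_replicate)
    have "pos_deg target = sum_mset (image_mset (\<lambda>i. max i 0) (mset (cp_shape target)))"
      by (simp add: pos_deg_def cp_shape_def image_mset.compositionality o_def)
    then have "pos_deg target = ?pd shape" by (simp add: cp_shape_target sum_mset_sum_list flip: mset_map)
    then have J: "shape \<in> ?J target" using k sum_shape by (simp add: rel_index_def length_shape)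
    have S: "target_colors \<in> ?S shape target"
      using target_colors k by (simp add: color_lists_def sorted_sort_id[OF sorted_shape])
    have "qs \<in> {ps \<in> arrangements \<mu>. pair_colors n ps = target_colors}" by (simp add: arrangements_def \<mu>_def qs(3))
    then have "0 < ?N target_colors" by (subst card_gt_0_iff) auto
    then have "0 < (\<Sum>cs\<in>?S shape target. ?N cs)" by (intro sum_pos2[OF fS S]) auto
    then have "0 < (\<Sum>js\<in>?J target. \<Sum>cs\<in>?S js target. ?N cs)" by (intro sum_pos2[OF fin J]) auto
    moreover have "?K \<noteq> 0" using basis \<kappa>(1) by (auto simp: prod_mset_zero_iff)
    ultimately show ?thesis unfolding 1 by (simp only: mult_eq_0_iff of_nat_eq_0_iff) simp
  qed
  then have "is_leading_term n k xr u m target"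
    unfolding is_leading_term_def using expansion min target_support[OF k] by (intro exI[of _ c]) (auto simp: m_def)
  moreover have "rel_nonzero n k xr u m" by (rule rel_nonzero_sym_tensor[OF n \<mu>]) (use U in simp)
  ultimately show ?thesis using u by (intro bexI[of _ u] conjI)
qed

end

section \<open>Cascades with multiplicities\<close>

text \<open>Points of multiplicity zero drop out, so the support is only included in
  \<open>S\<close>; the conditions on cascades pass to subsets.\<close>

lemma weighted_multiset:
  fixes w :: "'a \<Rightarrow> nat" and S :: "'a set"
  assumes "finite S"
  defines "M \<equiv> \<Sum>x\<in>S. replicate_mset (w x) x"
  shows "size M = (\<Sum>x\<in>S. w x)" "set_mset M \<subseteq> S" "image_mset f M = (\<Sum>x\<in>S. replicate_mset (w x) (f x))"
  using assms(1) unfolding M_def by (induction S) (auto split: if_splits)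

theorem theorem6p1:
  fixes n k a b :: nat and j :: int
    and xr :: "weight \<Rightarrow> complex mat"
    and \<B> \<A> :: "color list"
    and mB mA :: "color \<Rightarrow> nat"
    and r :: index
  assumes "n \<ge> 2" and "k \<ge> 1"
    and "root_vectors n xr"
    and "a + b = k + 1"
    and "cascade n \<B>" and "cascade n \<A>"
    and "(\<Sum>\<beta> \<in> set \<B>. mB \<beta>) = b" and "(\<Sum>\<alpha> \<in> set \<A>. mA \<alpha>) = a"
    and "r \<in> indices n"
    and "set \<B> \<subseteq> upper_triangle n r" and "set \<A> \<subseteq> lower_triangle n r"
  shows "\<exists>u \<in> free_alg (sp n).
           rel_nonzero n k xr u (int b * (- j - 1) + int a * (- j)) \<and>
           is_leading_term n k xr u (int b * (- j - 1) + int a * (- j))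
             ((\<Sum>\<beta> \<in> set \<B>. replicate_mset (mB \<beta>) (Part \<beta> (- j - 1)))
              + (\<Sum>\<alpha> \<in> set \<A>. replicate_mset (mA \<alpha>) (Part \<alpha> (- j))))"
proof -
  define B A where "B = (\<Sum>\<beta>\<in>set \<B>. replicate_mset (mB \<beta>) \<beta>)" and "A = (\<Sum>\<alpha>\<in>set \<A>. replicate_mset (mA \<alpha>) \<alpha>)"
  have wB: "size B = b" "set_mset B \<subseteq> set \<B>" "image_mset f B = (\<Sum>\<beta>\<in>set \<B>. replicate_mset (mB \<beta>) (f \<beta>))"
    and wA: "size A = a" "set_mset A \<subseteq> set \<A>" "image_mset f A = (\<Sum>\<alpha>\<in>set \<A>. replicate_mset (mA \<alpha>) (f \<alpha>))" for f :: "color \<Rightarrow> part"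
    using assms(7,8) by (simp_all add: B_def A_def weighted_multiset)
  \<comment> \<open>With \<open>- j\<close> for \<open>e\<close>, the lower degree
    \<open>e - 1\<close> is the degree \<open>- j - 1\<close> of the first cascade.\<close>
  interpret separated_cascades n B A r "- j"
  proof
    show "set_mset B \<subseteq> basis n" "set_mset A \<subseteq> basis n"
      using wB(2) wA(2) assms(10,11) by (auto simp: upper_triangle_def lower_triangle_def)
    show "nested B" "nested A" by (rule cascade_nested[OF assms(5) wB(2)] cascade_nested[OF assms(6) wA(2)])+
    show "r \<le> row x" if "x \<in># B" for x using that wB(2) assms(10) by (auto simp: upper_triangle_def)
    show "col x \<le> r" if "x \<in># A" for x using that wA(2) assms(11) by (auto simp: lower_triangle_def)
  qed
  have "\<exists>u\<in>free_alg (sp n). rel_nonzero n k xr u (int (size B) * (- j - 1) + int (size A) * - j)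
      \<and> is_leading_term n k xr u (int (size B) * (- j - 1) + int (size A) * - j) target"
    by (rule target_is_leading_term) (use assms wA(1) wB(1) in auto)
  then show ?thesis by (simp only: target_def wA wB)
qed

end
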